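(* Let $k\ge 1$ be an integer, let $N\in\mathbb{N}$ (positive), and let $m\in\mathbb{Z}$ be fixed. Then, as $n\to\infty$, $$a_{m,k}(n)=(2\pi)^{-\frac{k}{2}}\sum_{\ell=1}^N d_{m,k}(\ell)\,n^{-\frac{2+2\ell+k}{4}}\left(\pi\sqrt{\tfrac{k}{6}}\right)^{1+\ell+\frac{k}{2}} I_{-1-\ell-\frac{k}{2}}\!\left(\pi\sqrt{\tfrac{2kn}{3}}\right)+O\!\left(n^{-1-\frac{N}{2}-\frac{k}{4}}\,e^{\pi\sqrt{\frac{2kn}{3}}}\right).$$
   Context: For $w\in\mathbb{C}$, $\tau$ in the upper half-plane, put $\zeta=e^{2\pi i w}$, $q=e^{2\pi i\tau}$, $\eta(\tau)=q^{1/24}\prod_{n\ge1}(1-q^n)$, $\vartheta(w;\tau)=i\zeta^{1/2}q^{1/8}\prod_{n\ge1}(1-q^n)(1-\zeta q^n)(1-\zeta^{-1}q^{n-1})$, and $$g(w;\tau)=i\,\frac{(\zeta^{1/2}-\zeta^{-1/2})\,\eta(\tau)^3}{\vartheta(w;\tau)}=\prod_{n\ge1}\frac{(1-q^n)^2}{(1-\zeta q^n)(1-\zeta^{-1}q^n)},\qquad f_k(w;\tau)=\frac{g(w;\tau)^2}{\eta(\tau)^k}.$$ The numbers $a_{m,k}(n)$ are defined by expanding in powers of $q$ with coefficients Laurent polynomials in $\zeta$: $f_k(w;\tau)=\sum_{m,n}a_{m,k}(n)\,\zeta^m q^{n-\frac{k}{24}}$. Let $$g_{m,1}(z)=\frac{8\pi^2}{z^2}\int_0^{1/2}\frac{\sin(\pi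 w)^2}{\sinh(2\pi^2 w/z)^2}\,e^{4\pi^2w^2/z}\cos(2\pi m w)\,dw.$$ The coefficients $d_{m,k}(\ell)$ are defined by the expansion $e^{-\frac{kz}{24}}g_{m,1}(z)=\sum_{\ell=1}^N d_{m,k}(\ell)z^\ell+O(z^{N+1})$ as $z\to0$ in the region $|\mathrm{Im}(z)|\le\mathrm{Re}(z)$; explicitly, $d_{m,k}(\ell)$ is the coefficient of $z^\ell$ in the formal power series $$e^{-\frac{kz}{24}}\cdot 2\sum_{\ell_1\ge1,\ \ell_2\ge0,\ j\ge0}(-1)^j\frac{m^{2\ell_2}\,B_{2(\ell_1+\ell_2+j)}}{(2\ell_1)!\,(2\ell_2)!\,j!}\,z^{2(\ell_1+\ell_2)+j-1},$$ where $B_r$ are the Bernoulli numbers ($\frac{x}{e^x-1}=\sum_{r\ge0}B_r\frac{x^r}{r!}$) and $0^0=1$. $I_\nu$ is the modified Bessel function of the first kind, $I_\nu(2\sqrt{x})=\frac{x^{\nu/2}}{2\pi i}\int_{-\infty}^{(0+)}t^{-\nu-1}\exp(t+\frac{x}{t})\,dt$, the integral being along a counterclockwise contour looping from $-\infty$ around $0$ back to $-\infty$. *)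

theory Defs
  imports "HOL-Complex_Analysis.Complex_Analysis" "HOL-Library.Landau_Symbols"
begin

definition qpar :: "complex \<Rightarrow> complex" where
  "qpar \<tau> = exp (2 * of_real pi * \<i> * \<tau>)"

text \<open>Fractional powers of \<open>q\<close> and \<open>\<zeta>\<close> are taken through the exponents \<open>\<tau>\<close> and \<open>w\<close>:
  \<open>q\<^sup>s = exp (2\<pi>i s\<tau>)\<close>.  Infinite products are indexed from 0, so \<open>n\<close> in the usual formulas
  becomes \<open>Suc n\<close>.\<close>

definition eta :: "complex \<Rightarrow> complex" where
  "eta \<tau> = qpar (\<tau> / 24) * (\<Prod>n. 1 - qpar \<tau> ^ Suc n)"

definition theta :: "complex \<Rightarrow> complex \<Rightarrow> complex" where
  "theta w \<tau> = \<i> * qpar (w / 2) * qpar (\<tau> / 8) *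
     (\<Prod>n. (1 - qpar \<tau> ^ Suc n) * (1 - qpar w * qpar \<tau> ^ Suc n) * (1 - qpar (- w) * qpar \<tau> ^ n))"

text \<open>The product form is used as the definition of \<open>g\<close>, because the theta quotient has
  removable singularities at integral \<open>w\<close>; \<open>gfun_eq_theta_quotient\<close> below shows that the two
  agree wherever the quotient is defined.\<close>

definition gfun :: "complex \<Rightarrow> complex \<Rightarrow> complex" where
  "gfun w \<tau> = (\<Prod>n. (1 - qpar \<tau> ^ Suc n)\<^sup>2 /
     ((1 - qpar w * qpar \<tau> ^ Suc n) * (1 - qpar (- w) * qpar \<tau> ^ Suc n)))"

lemma convergent_prod_one_minus_mult_qpar_power:
  assumes "Im \<tau> > 0"
  shows "convergent_prod (\<lambda>n. 1 - c * qpar \<tau> ^ n)"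
proof -
  have "norm (qpar \<tau>) < 1"
    using assms by (simp add: qpar_def norm_exp)
  then have "summable (\<lambda>n. norm c * norm (qpar \<tau>) ^ n)"
    by (intro summable_mult summable_geometric) auto
  then have "summable (\<lambda>n. norm ((1 - c * qpar \<tau> ^ n) - 1))"
    by (simp add: norm_mult norm_power)
  then show ?thesis
    by (intro abs_convergent_prod_imp_convergent_prod summable_imp_abs_convergent_prod)
qed

lemma gfun_eq_theta_quotient:
  assumes "Im \<tau> > 0" and "w \<notin> \<int>"
  shows "gfun w \<tau> = \<i> * (qpar (w / 2) - qpar (- w / 2)) * eta \<tau> ^ 3 / theta w \<tau>"
proof -
  define q where "q = qpar \<tau>"
  define A where "A = (\<Prod>n. 1 - q ^ Suc n)"
  define B where "B = (\<Prod>n. 1 - qpar w * q ^ Suc n)"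
  define C where "C = (\<Prod>n. 1 - qpar (- w) * q ^ Suc n)"
  define C' where "C' = (\<Prod>n. 1 - qpar (- w) * q ^ n)"
  have conv: "convergent_prod (\<lambda>n. 1 - c * q ^ n)" for c
    unfolding q_def by (rule convergent_prod_one_minus_mult_qpar_power[OF assms(1)])
  have conv': "convergent_prod (\<lambda>n. 1 - c * q ^ Suc n)" for c
    using conv[of c] convergent_prod_Suc_iff[of "\<lambda>n. 1 - c * q ^ n"] by blast
  have conv1: "convergent_prod (\<lambda>n. 1 - q ^ Suc n)"
    using conv'[of 1] by simp
  have ne: "qpar (- w) \<noteq> 1"
  proof
    assume "qpar (- w) = 1"
    then obtain n :: int where "Im (2 * of_real pi * \<i> * (- w)) = of_int (2 * n) * pi"
      and "Re (2 * of_real pi * \<i> * (- w)) = 0"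
      unfolding qpar_def exp_eq_1 by blast
    then have "pi * Re w = pi * of_int (- n)" and "Im w = 0"
      by simp_all
    then have "w = of_int (- n)"
      unfolding mult_cancel_left by (simp add: complex_eq_iff)
    then show False using assms(2) by (metis Ints_of_int)
  qed
  have g: "gfun w \<tau> = A\<^sup>2 / (B * C)"
    unfolding gfun_def A_def B_def C_def q_def[symmetric]
    by (simp only: prodinf_power[OF conv1, symmetric] prodinf_mult[OF conv' conv']
          prodinf_divide[OF convergent_prod_power[OF conv1] convergent_prod_mult[OF conv' conv']])
  have th: "theta w \<tau> = \<i> * qpar (w / 2) * qpar (\<tau> / 8) * (A * B * C')"
    unfolding theta_def A_def B_def C'_def q_def[symmetric]
    by (simp only: prodinf_mult[OF conv1 conv'] prodinf_mult[OF convergent_prod_mult[OF conv1 conv'] conv])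
  have C': "C' = (1 - qpar (- w)) * C"
    unfolding C_def C'_def using prodinf_split_head[OF conv[of "qpar (- w)"]] ne by simp
  have e: "eta \<tau> ^ 3 = qpar (\<tau> / 8) * A ^ 3"
    unfolding eta_def A_def q_def[symmetric] power_mult_distrib
    by (simp add: qpar_def exp_of_nat_mult[symmetric] mult_ac)
  have z: "qpar (- w / 2) = qpar (w / 2) * qpar (- w)"
    unfolding qpar_def by (simp add: exp_add[symmetric] algebra_simps)
  have A0: "A \<noteq> 0"
  proof -
    have "norm q < 1" using assms(1) by (simp add: q_def qpar_def norm_exp)
    have "q ^ Suc n \<noteq> 1" for n
    proof
      assume "q ^ Suc n = 1"
      then have "norm q ^ Suc n = 1" by (metis norm_one norm_power)
      moreover have "norm q ^ Suc n \<le> norm q"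
        using \<open>norm q < 1\<close> power_le_one[of "norm q" n] by (simp add: mult_left_le)
      ultimately show False using \<open>norm q < 1\<close> by simp
    qed
    then show ?thesis unfolding A_def by (intro prodinf_nonzero conv1) auto
  qed
  have nz: "qpar x \<noteq> 0" for x by (simp add: qpar_def)
  show ?thesis
  proof (cases "B * C = 0")
    case True
    then show ?thesis using g th C' by auto
  next
    case False
    then show ?thesis
      unfolding g th C' e z using A0 nz ne
      by (simp add: field_simps power2_eq_square power3_eq_cube)
  qed
qed

definition fk :: "nat \<Rightarrow> complex \<Rightarrow> complex \<Rightarrow> complex" where
  "fk k w \<tau> = (gfun w \<tau>)\<^sup>2 / eta \<tau> ^ k"

text \<open>\<open>a m n\<close> is the coefficient of \<open>\<zeta>\<^sup>m q\<^bsup>n - k/24\<^esup>\<close>: for each \<open>n\<close> the coefficient of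
  \<open>q\<^bsup>n - k/24\<^esup>\<close> is a Laurent polynomial in \<open>\<zeta>\<close>, and the expansion holds in
  \<open>\<bar>q\<bar> < \<bar>\<zeta>\<bar> < \<bar>q\<bar>\<^sup>-\<^sup>1\<close>, the annulus around \<open>\<bar>\<zeta>\<bar> = 1\<close> that is free of poles.\<close>

definition is_fk_expansion :: "nat \<Rightarrow> (int \<Rightarrow> nat \<Rightarrow> complex) \<Rightarrow> bool" where
  "is_fk_expansion k a \<longleftrightarrow>
     (\<forall>n. finite {m. a m n \<noteq> 0}) \<and>
     (\<forall>w \<tau>. Im \<tau> > 0 \<longrightarrow> \<bar>Im w\<bar> < Im \<tau> \<longrightarrow>
        (\<lambda>n. (\<Sum>m | a m n \<noteq> 0. a m n * qpar w powi m) * qpar ((of_nat n - of_nat k / 24) * \<tau>))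
          sums fk k w \<tau>)"

definition acoeff :: "nat \<Rightarrow> int \<Rightarrow> nat \<Rightarrow> complex" where
  "acoeff k = (THE a. is_fk_expansion k a)"

definition gm1 :: "int \<Rightarrow> complex \<Rightarrow> complex" where
  "gm1 m z = 8 * of_real pi ^ 2 / z\<^sup>2 *
     integral {0..1/2} (\<lambda>w::real.
        of_real (sin (pi * w)) ^ 2 / sinh (of_real (2 * pi\<^sup>2 * w) / z) ^ 2 *
        exp (of_real (4 * pi\<^sup>2 * w\<^sup>2) / z) * of_real (cos (2 * pi * of_int m * w)))"

text \<open>The value at index 0, which does not occur in the expansion, is set to 0 so that the
  coefficient sequence is unique.\<close>

definition is_gm1_expansion :: "int \<Rightarrow> nat \<Rightarrow> (nat \<Rightarrow> complex) \<Rightarrow> bool" where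
  "is_gm1_expansion m k d \<longleftrightarrow> d 0 = 0 \<and>
     (\<forall>N\<ge>1. (\<lambda>z. exp (- of_nat k * z / 24) * gm1 m z - (\<Sum>l=1..N. d l * z ^ l))
        \<in> O[at 0 within {z. \<bar>Im z\<bar> \<le> Re z}](\<lambda>z. z ^ (N + 1)))"

definition dcoeff :: "int \<Rightarrow> nat \<Rightarrow> nat \<Rightarrow> complex" where
  "dcoeff m k = (THE d. is_gm1_expansion m k d)"

text \<open>The loop integral from \<open>-\<infinity>\<close> counterclockwise around 0 back to \<open>-\<infinity>\<close>, for integrands
  holomorphic off the nonpositive real axis.  The loop is taken along the half-line \<open>Im t = -1\<close>,
  \<open>Re t \<le> 0\<close>, the right half of the unit circle, and the half-line \<open>Im t = 1\<close>, \<open>Re t \<le> 0\<close>; it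
  stays off the branch cut of the principal power.\<close>

definition hankel_integral :: "(complex \<Rightarrow> complex) \<Rightarrow> complex" where
  "hankel_integral h =
     (LINT s:{..0}|lborel. h (Complex s (-1))) +
     contour_integral (part_circlepath 0 1 (- pi / 2) (pi / 2)) h -
     (LINT s:{..0}|lborel. h (Complex s 1))"

text \<open>\<open>I\<^sub>\<nu>(y)\<close> for \<open>y > 0\<close>, where \<open>y = 2\<surd>x\<close>.\<close>

definition bessel_I :: "real \<Rightarrow> real \<Rightarrow> complex" where
  "bessel_I \<nu> y = (let x = (y / 2)\<^sup>2 in
     of_real (x powr (\<nu> / 2)) / (2 * of_real pi * \<i>) *
     hankel_integral (\<lambda>t. t powr (- of_real \<nu> - 1) * exp (t + of_real x / t)))"

end

theory Submission
  imports Defs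
begin

text \<open>The proof is by the circle method.  For fixed \<open>m\<close> the numbers \<open>a\<^bsub>m,k\<^esub>(n)\<close> are the Taylor coefficients of
  the Fourier coefficient \<open>F(q) = \<integral> f(w, q) e\<^bsup>-2\<pi>imw\<^esup> dw\<close> over \<open>[-1/2, 1/2]\<close>, so Cauchy's formula on
  \<open>q = e\<^bsup>-z\<^esup>\<close>, \<open>Re z = c / \<surd>n\<close> with \<open>c = \<pi>\<surd>(k/6)\<close>, expresses them as an integral of \<open>F(e\<^bsup>-z\<^esup>) e\<^bsup>nz\<^esup>\<close>.  On the minor arc
  \<open>\<bar>Im z\<bar> \<ge> Re z\<close> the Lambert series of \<open>ln f\<close> shows that the integrand is exponentially smaller
  than \<open>e\<^bsup>2c\<surd>n\<^esup>\<close>.  On the major arc the modular transformations of \<open>\<eta>\<close> and \<open>\<vartheta>\<close> replace \<open>F(e\<^bsup>-z\<^esup>)\<close> by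
  \<open>(z/2\<pi>)\<^bsup>k/2\<^esup> e\<^bsup>c\<^sup>2/z\<^esup> e\<^bsup>-kz/24\<^esup> g\<^bsub>m,1\<^esub>(z)\<close> up to an exponentially small factor, and the expansion of the
  last two factors in powers of \<open>z\<close> leaves integrals of \<open>z\<^bsup>l+k/2\<^esup> e\<^bsup>nz + c\<^sup>2/z\<^esup>\<close>, which are Hankel
  integrals for \<open>I\<^bsub>-1-l-k/2\<^esub>\<close> up to pieces of size \<open>e\<^bsup>3c\<surd>n/2\<^esup>\<close>.

  The transformation of \<open>\<vartheta>\<close> is obtained from its quasi-periodicity: the quotient of the two sides is an
  elliptic function without poles.  That of \<open>\<eta>\<close> follows by evaluating the former at half periods.\<close>

section \<open>The product \<open>\<Prod>(1 - cq\<^sup>n)\<close>\<close>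

text \<open>\<open>acoeff\<close> and \<open>dcoeff\<close> are definite descriptions, so existence
  and uniqueness of both expansions have to be proved before any estimate can start. The cone |Im z|
  <= Re z serves twice: \<open>gm1\<close> is expanded in it, and its edges separate the two arcs.
  Inside it norm z, Re z and 1 / Re (1/z) are comparable, which turns errors exponential in 1/z into
  arbitrary powers of z. Outside it a single term of the Lambert series of the eta product already
  loses enough. The theta quotient g causes no exponential growth on |zeta| = 1, because its
  logarithm is a Lambert series with real coefficients c^r + c^(-r) - 2 in [-4, 0]; all the growth
  sits in eta^(-k). The delicate point on the major arc is uniformity in w: the transformation sends
  zeta to exp(4 pi^2 w / z), and the new products are close to 1 only while w stays below 1 by a
  fixed amount. The evenness of f in w therefore matters: it folds the integral onto [0, 1/2]. The
  vertical line and the Hankel loop are compared through the values of one primitive on the slit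
  plane.\<close>

definition qp :: "complex \<Rightarrow> complex \<Rightarrow> complex" where
  "qp c q = (\<Prod>n. 1 - c * q ^ Suc n)"

lemma convergent_prod_qp:
  fixes c q :: complex
  assumes "norm q < 1"
  shows "convergent_prod (\<lambda>n. 1 - c * q ^ Suc n)"
proof -
  have "summable (\<lambda>n. norm c * (norm q * norm q ^ n))"
    using assms by (intro summable_mult summable_geometric) auto
  then have "summable (\<lambda>n. norm ((1 - c * q ^ Suc n) - 1))"
    by (simp add: norm_mult norm_power mult_ac)
  then show ?thesis
    by (intro abs_convergent_prod_imp_convergent_prod summable_imp_abs_convergent_prod)
qed

lemma qp_LIMSEQ:
  assumes "norm q < 1"
  shows "(\<lambda>N. \<Prod>n<N. 1 - c * q ^ Suc n) \<longlonglongrightarrow> qp c q"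
  using convergent_prod_LIMSEQ[OF convergent_prod_qp[OF assms, of c]]
  unfolding qp_def LIMSEQ_lessThan_iff_atMost .

lemma qp_eq_0_iff:
  assumes "norm q < 1"
  shows "qp c q = 0 \<longleftrightarrow> (\<exists>n. c * q ^ Suc n = 1)"
  using has_prod_eq_0_iff[OF convergent_prod_has_prod[OF convergent_prod_qp[OF assms, of c]]]
  unfolding qp_def by (auto simp: image_iff)

text \<open>\<open>qp c q\<close> is the q-Pochhammer symbol (cq; q)_infinity. Moving its first
  factor out is the source of the quasi-periodicity of theta.\<close>

lemma qp_shift:
  assumes "norm q < 1"
  shows "qp c q = (1 - c * q) * qp (c * q) q"
proof -
  have "(\<lambda>N. \<Prod>n<Suc N. 1 - c * q ^ Suc n) \<longlonglongrightarrow> qp c q"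
    using qp_LIMSEQ[OF assms] by (rule LIMSEQ_Suc)
  moreover have "(\<lambda>N. (1 - c * q) * (\<Prod>n<N. 1 - (c * q) * q ^ Suc n)) \<longlonglongrightarrow> (1 - c * q) * qp (c * q) q"
    by (intro tendsto_intros qp_LIMSEQ assms)
  moreover have "(\<Prod>n<Suc N. 1 - c * q ^ Suc n) = (1 - c * q) * (\<Prod>n<N. 1 - (c * q) * q ^ Suc n)" for N
    unfolding prod.lessThan_Suc_shift by (simp add: mult_ac)
  ultimately show ?thesis
    using LIMSEQ_unique by simp
qed

lemma qp_zero_right [simp]: "qp c 0 = 1"
  by (simp add: qp_def)

lemma qp_nonzero:
  assumes "norm q < 1" "norm (c * q) < 1"
  shows "qp c q \<noteq> 0"
proof
  assume "qp c q = 0"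
  then obtain n where n: "c * q ^ Suc n = 1"
    using assms qp_eq_0_iff by blast
  have "norm (c * q ^ Suc n) = norm (c * q) * norm q ^ n"
    by (simp add: norm_mult norm_power)
  also have "\<dots> \<le> norm (c * q) * 1"
    using assms by (intro mult_left_mono power_le_one) auto
  finally show False using n assms by simp
qed

text \<open>Both arguments may vary, because the product is later used as a holomorphic function of
  w (through c) and of \<tau> (through q). On a compact set the maxima of the two norms give one
  geometric majorant for the M-test.\<close>

lemma uniform_limit_qp:
  fixes C Q :: "'a::topological_space \<Rightarrow> complex"
  assumes X: "compact X" and C: "continuous_on X C" and Q: "continuous_on X Q"
    and Q1: "\<And>x. x \<in> X \<Longrightarrow> norm (Q x) < 1"
  shows "uniform_limit X (\<lambda>N x. \<Prod>n<N. 1 - C x * Q x ^ Suc n) (\<lambda>x. qp (C x) (Q x)) sequentially"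
proof (cases "X = {}")
  case False
  have "compact ((\<lambda>x. norm (Q x)) ` X)"
    by (intro compact_continuous_image continuous_intros Q X)
  then obtain x0 where x0: "x0 \<in> X" "\<And>x. x \<in> X \<Longrightarrow> norm (Q x) \<le> norm (Q x0)"
    using continuous_attains_sup[OF X False continuous_on_norm[OF Q]] by blast
  obtain x1 where x1: "x1 \<in> X" "\<And>x. x \<in> X \<Longrightarrow> norm (C x) \<le> norm (C x1)"
    using continuous_attains_sup[OF X False continuous_on_norm[OF C]] by blast
  define r M where "r = norm (Q x0)" and "M = norm (C x1)"
  have "uniformly_convergent_on X (\<lambda>N x. \<Sum>n<N. norm ((1 - C x * Q x ^ Suc n) - 1))"
  proof (rule Weierstrass_m_test')
    show "norm (norm (1 - C x * Q x ^ Suc n - 1)) \<le> M * r ^ Suc n" if "x \<in> X" for n x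
      using x0(2)[OF that] x1(2)[OF that] unfolding r_def M_def
      by (auto simp: norm_mult norm_power intro!: mult_mono power_mono)
    show "summable (\<lambda>n. M * r ^ Suc n)"
      using Q1[OF x0(1)] by (intro summable_mult) (simp add: r_def summable_Suc_iff summable_geometric del: power_Suc)
  qed
  then have "uniformly_convergent_on X (\<lambda>N x. \<Prod>n<N. 1 - C x * Q x ^ Suc n)"
    by (intro uniformly_convergent_on_prod' X continuous_intros C Q)
  then obtain l where l: "uniform_limit X (\<lambda>N x. \<Prod>n<N. 1 - C x * Q x ^ Suc n) l sequentially"
    by (auto simp: uniformly_convergent_on_def)
  have "l x = qp (C x) (Q x)" if "x \<in> X" for x
    using LIMSEQ_unique[OF tendsto_uniform_limitI[OF l that] qp_LIMSEQ[OF Q1[OF that]]] .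
  then show ?thesis
    using uniform_limit_cong'[of X "\<lambda>N x. \<Prod>n<N. 1 - C x * Q x ^ Suc n"
        "\<lambda>N x. \<Prod>n<N. 1 - C x * Q x ^ Suc n" l "\<lambda>x. qp (C x) (Q x)"] l by simp
qed (simp add: uniform_limit_iff)

lemma holomorphic_on_qp [holomorphic_intros]:
  assumes S: "open S" and C: "C holomorphic_on S" and Q: "Q holomorphic_on S"
    and Q1: "\<And>x. x \<in> S \<Longrightarrow> norm (Q x) < 1"
  shows "(\<lambda>x. qp (C x) (Q x)) holomorphic_on S"
proof (rule holomorphic_uniform_sequence[OF S])
  show "(\<lambda>x. \<Prod>n<N. 1 - C x * Q x ^ Suc n) holomorphic_on S" for N
    by (intro holomorphic_intros C Q)
  fix x assume "x \<in> S"
  then obtain d where d: "d > 0" "cball x d \<subseteq> S"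
    using S open_contains_cball by blast
  have "continuous_on (cball x d) C" "continuous_on (cball x d) Q"
    using C Q d by (meson holomorphic_on_imp_continuous_on continuous_on_subset)+
  then have "uniform_limit (cball x d) (\<lambda>N x. \<Prod>n<N. 1 - C x * Q x ^ Suc n) (\<lambda>x. qp (C x) (Q x)) sequentially"
    using Q1 d by (intro uniform_limit_qp) auto
  with d show "\<exists>d>0. cball x d \<subseteq> S \<and>
      uniform_limit (cball x d) (\<lambda>N x. \<Prod>n<N. 1 - C x * Q x ^ Suc n) (\<lambda>x. qp (C x) (Q x)) sequentially"
    by blast
qed

lemma one_minus_mult_power_nonzero:
  assumes "norm q < 1" "norm (c * q) < 1"
  shows "1 - c * q ^ Suc n \<noteq> (0::complex)"
  using qp_nonzero[OF assms] qp_eq_0_iff[OF assms(1)] by auto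

text \<open>Lambert series of \<open>ln (qp c q)\<close>: expand each logarithm and sum over the factors first.\<close>

lemma qp_eq_exp_Lambert:
  assumes q: "norm q < 1" and c: "norm (c * q) < 1"
  defines "t \<equiv> \<lambda>r. (c * q) ^ Suc r / (of_nat (Suc r) * (1 - q ^ Suc r))"
  shows "summable (\<lambda>r. norm (t r))" and "qp c q = exp (- suminf t)"
proof -
  define f :: "nat \<times> nat \<Rightarrow> complex" where
    "f = (\<lambda>(n, r). (c * q ^ Suc n) ^ Suc r / of_nat (Suc r))"
  \<comment> \<open>Majorant for \<open>f\<close>: the factor 1/(r+1) is dropped and |q|^(n(r+1)) is
    weakened to |q|^n, which leaves a product of two geometric series. The resulting absolute
    summability permits summing in either order.\<close>
  define g :: "nat \<times> nat \<Rightarrow> real" where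
    "g = (\<lambda>(n, r). norm q ^ n * norm (c * q) ^ Suc r)"
  have sg: "(g has_sum (1 / (1 - norm q) * (norm (c * q) / (1 - norm (c * q))))) (UNIV \<times> UNIV)"
  proof (rule has_sum_SigmaI)
    have geo: "((\<lambda>n. s ^ n) has_sum (1 / (1 - s))) (UNIV :: nat set)" if "0 \<le> s" "s < 1" for s :: real
      using that by (intro norm_summable_imp_has_sum geometric_sums) (auto simp: summable_geometric)
    show "((\<lambda>r. g (n, r)) has_sum (norm q ^ n * (norm (c * q) / (1 - norm (c * q))))) UNIV" for n
      using has_sum_cmult_right[OF geo[of "norm (c * q)"], of "norm q ^ n * norm (c * q)"] c
      by (simp add: g_def mult_ac)
    show 1: "((\<lambda>n. norm q ^ n * (norm (c * q) / (1 - norm (c * q)))) has_sum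
        (1 / (1 - norm q) * (norm (c * q) / (1 - norm (c * q))))) UNIV"
      using q by (intro has_sum_cmult_left geo) auto
    show "g summable_on UNIV \<times> UNIV"
    proof (rule summable_on_SigmaI)
      show "((\<lambda>r. g (n, r)) has_sum (norm q ^ n * (norm (c * q) / (1 - norm (c * q))))) UNIV" for n
        using has_sum_cmult_right[OF geo[of "norm (c * q)"], of "norm q ^ n * norm (c * q)"] c
        by (simp add: g_def mult_ac)
      show "(\<lambda>n. norm q ^ n * (norm (c * q) / (1 - norm (c * q)))) summable_on UNIV"
        using 1 by (auto simp: summable_on_def)
    qed (auto simp: g_def)
  qed
  have fg: "norm (f x) \<le> g x" for x
  proof -
    obtain n r where x: "x = (n, r)" by (cases x)
    have "norm (f x) = norm (c * q) ^ Suc r * (norm q ^ n) ^ Suc r / real (Suc r)"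
      by (simp add: x f_def norm_divide norm_power norm_mult power_mult_distrib mult_ac del: power_Suc of_nat_Suc)
         (simp add: power_mult_distrib mult_ac)
    also have "\<dots> \<le> norm (c * q) ^ Suc r * (norm q ^ n) ^ Suc r / 1"
      by (intro divide_left_mono) auto
    also have "\<dots> \<le> norm (c * q) ^ Suc r * (norm q ^ n) ^ 1"
      using q unfolding div_by_1 by (intro mult_left_mono power_decreasing power_le_one) auto
    finally show ?thesis by (simp add: x g_def mult_ac)
  qed
  have fa: "(\<lambda>x. norm (f x)) summable_on (UNIV \<times> UNIV)"
    using sg fg by (intro Infinite_Sum.abs_summable_on_comparison_test'[of g]) (auto simp: summable_on_def)
  then have fs: "f summable_on (UNIV \<times> UNIV)"
    by (rule abs_summable_summable)
  define S where "S = infsum f (UNIV \<times> UNIV)"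
  have S: "(f has_sum S) (UNIV \<times> UNIV)"
    using fs unfolding S_def by (rule has_sum_infsum)
  have cn: "norm (c * q ^ Suc n) < 1" for n
  proof -
    have "norm (c * q ^ Suc n) = norm (c * q) * norm q ^ n"
      by (simp add: norm_mult norm_power)
    also have "\<dots> \<le> norm (c * q) * 1"
      using q by (intro mult_left_mono power_le_one) auto
    finally show ?thesis using c by simp
  qed
  have row: "((\<lambda>r. f (n, r)) has_sum (- ln (1 - c * q ^ Suc n))) UNIV" for n
  proof (rule norm_summable_imp_has_sum)
    \<comment> \<open>The logarithm series starts at r = 0, where the term is 0 because division by
      zero yields 0; hence the shift by one below leaves the sum unchanged.\<close>
    have "(\<lambda>r. - (- ((c * q ^ Suc n) ^ r) / of_nat r)) sums - ln (1 + (- (c * q ^ Suc n)))"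
      using sums_minus[OF Ln_series'[of "- (c * q ^ Suc n)"]] cn[of n] by simp
    then show "(\<lambda>r. f (n, r)) sums - ln (1 - c * q ^ Suc n)"
      using sums_Suc_iff[of "\<lambda>r. - (- ((c * q ^ Suc n) ^ r) / of_nat r)" "- ln (1 - c * q ^ Suc n)"]
      by (simp add: f_def)
    show "summable (\<lambda>r. norm (f (n, r)))"
    proof (rule summable_comparison_test')
      show "summable (\<lambda>r. norm q ^ n * norm (c * q) ^ Suc r)"
        using c by (intro summable_mult) (simp add: summable_Suc_iff summable_geometric del: power_Suc)
      show "norm (norm (f (n, r))) \<le> norm q ^ n * norm (c * q) ^ Suc r" for r
        using fg[of "(n, r)"] by (simp add: g_def)
    qed
  qed
  have "((\<lambda>n. - ln (1 - c * q ^ Suc n)) has_sum S) UNIV"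
    by (rule has_sum_SigmaD[OF S row])
  from sums_minus[OF has_sum_imp_sums[OF this]]
  have sumln: "(\<lambda>n. ln (1 - c * q ^ Suc n)) sums (- S)"
    by simp
  have "qp c q = prodinf (\<lambda>n. exp (ln (1 - c * q ^ Suc n)))"
    unfolding qp_def using one_minus_mult_power_nonzero[OF q c]
    by (intro prodinf_cong) (auto simp: exp_Ln)
  also have "\<dots> = exp (- S)"
    using prodinf_exp[of "\<lambda>n. ln (1 - c * q ^ Suc n)"] sumln by (simp add: sums_iff)
  finally have qS: "qp c q = exp (- S)" .
  have power_less_one: "x ^ Suc r < 1" if "0 \<le> x" "x < 1" for x :: real and r
    using mult_left_mono[OF power_le_one[of x r], of x] that by simp
  have q1: "norm (q ^ Suc r) < 1" for r
    unfolding norm_power using q by (intro power_less_one) auto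
  have col: "((\<lambda>n. f (n, r)) has_sum t r) UNIV" for r
  proof (rule norm_summable_imp_has_sum)
    have "f (n, r) = (c * q) ^ Suc r / of_nat (Suc r) * (q ^ Suc r) ^ n" for n
    proof -
      have "(c * q ^ Suc n) ^ Suc r = (c * q) ^ Suc r * (q ^ n) ^ Suc r"
        unfolding power_mult_distrib[symmetric] by (simp only: power_Suc mult_ac)
      also have "(q ^ n) ^ Suc r = (q ^ Suc r) ^ n"
        by (simp only: power_mult[symmetric] mult.commute)
      finally show ?thesis by (simp add: f_def del: power_Suc of_nat_Suc)
    qed
    then have fe: "(\<lambda>n. f (n, r)) = (\<lambda>n. (c * q) ^ Suc r / of_nat (Suc r) * (q ^ Suc r) ^ n)" by auto
    have "(\<lambda>n. f (n, r)) sums ((c * q) ^ Suc r / of_nat (Suc r) * (1 / (1 - q ^ Suc r)))"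
      unfolding fe by (intro sums_mult geometric_sums q1)
    then show "(\<lambda>n. f (n, r)) sums t r" by (simp add: t_def)
    show "summable (\<lambda>n. norm (f (n, r)))"
    proof -
      have "summable (\<lambda>n. norm ((c * q) ^ Suc r / of_nat (Suc r)) * norm (q ^ Suc r) ^ n)"
        by (intro summable_mult summable_geometric) (use q1 in auto)
      then show ?thesis
        by (simp only: norm_mult norm_power[symmetric] \<open>\<And>n. f (n, r) = _\<close>)
    qed
  qed
  have S': "((\<lambda>(r, n). f (n, r)) has_sum S) (UNIV \<times> UNIV)"
    using S by (subst (asm) has_sum_swap) (simp add: case_prod_unfold)
  have ts: "(t has_sum S) UNIV"
    by (rule has_sum_SigmaD[OF S']) (use col in auto)
  then have "t summable_on UNIV" by (rule has_sum_imp_summable)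
  then have "(\<lambda>r. norm (t r)) summable_on UNIV"
    by (rule summable_on_iff_abs_summable_on_complex[THEN iffD1])
  then show "summable (\<lambda>r. norm (t r))"
    by (rule summable_on_imp_summable)
  show "qp c q = exp (- suminf t)"
    using qS has_sum_imp_sums[OF ts] by (simp add: sums_iff)
qed

section \<open>The theta transformation\<close>

lemma qpar_add: "qpar (a + b) = qpar a * qpar b"
  by (simp add: qpar_def ring_distribs exp_add)

lemma qpar_diff: "qpar (a - b) = qpar a / qpar b"
  by (simp add: qpar_def ring_distribs exp_diff)

lemma qpar_minus: "qpar (- a) = inverse (qpar a)"
  by (simp add: qpar_def exp_minus)

lemma qpar_nonzero [simp]: "qpar a \<noteq> 0"
  by (simp add: qpar_def)

lemma qpar_power: "qpar a ^ n = qpar (of_nat n * a)"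
  by (simp add: qpar_def exp_of_nat_mult[symmetric] mult_ac)

lemma qpar_0 [simp]: "qpar 0 = 1"
  by (simp add: qpar_def)

lemma norm_qpar: "norm (qpar a) = exp (- 2 * pi * Im a)"
  by (simp add: qpar_def norm_exp)

lemma norm_qpar_less_1: "Im a > 0 \<Longrightarrow> norm (qpar a) < 1"
  by (simp add: norm_qpar)

lemma qpar_eq_1_iff: "qpar a = 1 \<longleftrightarrow> a \<in> \<int>"
proof
  assume "qpar a = 1"
  then obtain n :: int where n: "Im (2 * of_real pi * \<i> * a) = of_int (2 * n) * pi"
    and "Re (2 * of_real pi * \<i> * a) = 0"
    unfolding qpar_def exp_eq_1 by blast
  then have "pi * Re a = pi * of_int n" and "Im a = 0"
    by simp_all
  then have "a = of_int n"
    unfolding mult_cancel_left by (simp add: complex_eq_iff)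
  then show "a \<in> \<int>" by simp
next
  assume "a \<in> \<int>"
  then obtain n where "a = of_int n" by (rule Ints_cases)
  then show "qpar a = 1"
    using exp_integer_2pi[of "of_int n"] by (simp add: qpar_def mult_ac)
qed

lemma qpar_int [simp]: "qpar (of_int n) = 1" "qpar (of_nat k) = 1" "qpar 1 = 1"
  by (simp_all add: qpar_eq_1_iff)

lemma qpar_add_int [simp]: "qpar (a + 1) = qpar a"
  by (simp add: qpar_add)

lemma holomorphic_on_qpar [holomorphic_intros]:
  "f holomorphic_on S \<Longrightarrow> (\<lambda>x. qpar (f x)) holomorphic_on S"
  unfolding qpar_def by (intro holomorphic_intros)

lemma sin_pi_eq_qpar: "sin (of_real pi * w) = - \<i> / 2 * (qpar (w / 2) - qpar (- w / 2))"
proof -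
  have "qpar (w / 2) = exp (\<i> * (of_real pi * w))" "qpar (- w / 2) = exp (- (\<i> * (of_real pi * w)))"
    by (simp_all add: qpar_def mult_ac)
  then show ?thesis
    unfolding sin_exp_eq by (simp add: field_simps)
qed

text \<open>The reciprocal of the normalised theta function \<open>h\<close> is \<open>g\<close> up to a sine factor.  Being
  normalised by \<open>h'(0) = \<pi>\<close>, it transforms without an undetermined constant.\<close>

definition ntheta :: "complex \<Rightarrow> complex \<Rightarrow> complex" where
  "ntheta \<tau> w = sin (of_real pi * w) * qp (qpar w) (qpar \<tau>) * qp (qpar (- w)) (qpar \<tau>) / qp 1 (qpar \<tau>) ^ 2"

lemma qp_1_nonzero: "norm q < 1 \<Longrightarrow> qp 1 q \<noteq> 0"
  by (rule qp_nonzero) auto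

lemma holomorphic_on_ntheta [holomorphic_intros]:
  assumes "Im \<tau> > 0" "f holomorphic_on S"
  shows "(\<lambda>w. ntheta \<tau> (f w)) holomorphic_on S"
proof -
  have "ntheta \<tau> holomorphic_on UNIV"
    unfolding ntheta_def using norm_qpar_less_1[OF assms(1)]
    by (auto intro!: holomorphic_intros simp: qp_1_nonzero)
  then show ?thesis
    using holomorphic_on_compose_gen[OF assms(2), of "ntheta \<tau>" UNIV] by (simp add: o_def)
qed

lemma ntheta_minus: "ntheta \<tau> (- w) = - ntheta \<tau> w"
  by (simp add: ntheta_def)

lemma ntheta_add_1: "ntheta \<tau> (w + 1) = - ntheta \<tau> w"
proof -
  have "sin (of_real pi * (w + 1)) = - sin (of_real pi * w)"
    by (simp add: ring_distribs sin_add flip: sin_of_real cos_of_real)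
  moreover have "qpar (- (w + 1)) = qpar (- w)"
    by (simp add: qpar_minus qpar_add del: minus_add_distrib)
  ultimately show ?thesis by (simp add: ntheta_def)
qed

text \<open>The shift multiplies zeta = \<open>qpar w\<close> by q, so one product loses its first
  factor and the other gains one. What remains is a rational identity in u = zeta^(1/2) and s =
  q^(1/2); the roots occur because the sine contains half-integral powers.\<close>

lemma ntheta_add_tau:
  assumes "Im \<tau> > 0"
  shows "ntheta \<tau> (w + \<tau>) = - qpar (- \<tau> / 2 - w) * ntheta \<tau> w"
proof -
  define q where "q = qpar \<tau>"
  have q: "norm q < 1" "q \<noteq> 0" using assms by (simp_all add: q_def norm_qpar_less_1)
  define u where "u = qpar (w / 2)"
  define s where "s = qpar (\<tau> / 2)"
  have nz: "u \<noteq> 0" "s \<noteq> 0" by (simp_all add: u_def s_def)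
  have qs: "q = s ^ 2" and uw: "qpar w = u ^ 2"
    by (simp_all add: q_def s_def u_def qpar_power)
  have e1: "qp (qpar w) q = (1 - u\<^sup>2 * s\<^sup>2) * qp (u\<^sup>2 * s\<^sup>2) q"
    using qp_shift[OF q(1), of "qpar w"] by (simp add: uw qs)
  have e2: "qp (qpar (- (w + \<tau>))) q = (1 - inverse (u\<^sup>2)) * qp (qpar (- w)) q"
  proof -
    have "qpar (- (w + \<tau>)) * q = qpar (- w)" by (simp add: q_def qpar_add[symmetric])
    moreover have "qpar (- w) = inverse (u\<^sup>2)" by (simp add: qpar_minus uw)
    ultimately show ?thesis
      using qp_shift[OF q(1), of "qpar (- (w + \<tau>))"] by simp
  qed
  have e3: "qpar (w + \<tau>) = u\<^sup>2 * s\<^sup>2"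
    by (simp only: qpar_add uw qs[symmetric] q_def[symmetric])
  have e4: "sin (of_real pi * (w + \<tau>)) = - \<i> / 2 * (u * s - inverse (u * s))"
  proof -
    have "qpar ((w + \<tau>) / 2) = u * s"
      unfolding u_def s_def qpar_add[symmetric] add_divide_distrib ..
    moreover from this have "qpar (- (w + \<tau>) / 2) = inverse (u * s)"
      by (simp only: minus_divide_left[symmetric] qpar_minus)
    ultimately show ?thesis unfolding sin_pi_eq_qpar by simp
  qed
  have e5: "sin (of_real pi * w) = - \<i> / 2 * (u - inverse u)"
    unfolding sin_pi_eq_qpar minus_divide_left[symmetric] qpar_minus u_def by (rule refl)
  have e6: "qpar (- \<tau> / 2 - w) = inverse s * inverse (u\<^sup>2)"
    by (simp only: qpar_diff minus_divide_left[symmetric] qpar_minus uw s_def) (simp only: divide_inverse)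
  \<comment> \<open>Only the sine and the two end factors change under the shift. Isolating them
    reduces the claim to the identity in u and s.\<close>
  have rearrange: "(c * X) * A * (Y * B) / D = - Z * ((c * U) * (V * A) * B / D)"
    if "X * Y = - Z * U * V" for c X Y Z U V A B D :: complex
  proof -
    have "(c * X) * A * (Y * B) / D = (X * Y) * (c * A * B / D)" by (simp add: mult_ac)
    also have "\<dots> = - Z * ((c * U) * (V * A) * B / D)" unfolding that by (simp add: mult_ac)
    finally show ?thesis .
  qed
  have "(u * s - inverse (u * s)) * (1 - inverse (u\<^sup>2)) =
      - (inverse s * inverse (u\<^sup>2)) * (u - inverse u) * (1 - u\<^sup>2 * s\<^sup>2)"
    using nz by (simp add: field_simps power2_eq_square)
  then show ?thesis
    unfolding ntheta_def q_def[symmetric] e1 e2 e3 e4 e5 e6 by (rule rearrange)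
qed

text \<open>A convergent product vanishes only if one of its factors does. The sine accounts for the
  integers, the two products for the remaining lattice points on either side of the real
  line.\<close>

lemma ntheta_eq_0D:
  assumes "Im \<tau> > 0" "ntheta \<tau> w = 0"
  obtains m n :: int where "w = of_int m + of_int n * \<tau>"
proof -
  have q: "norm (qpar \<tau>) < 1" using assms by (simp add: norm_qpar_less_1)
  from assms(2) qp_1_nonzero[OF q] consider "sin (of_real pi * w) = 0"
    | "qp (qpar w) (qpar \<tau>) = 0" | "qp (qpar (- w)) (qpar \<tau>) = 0"
    by (auto simp: ntheta_def)
  then show ?thesis
  proof cases
    case 1
    then obtain n :: int where "of_real pi * w = of_real pi * of_int n"
      unfolding sin_eq_0 by (auto simp: mult_ac)
    then show ?thesis using that[of n 0] by simp
  next
    case 2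
    then obtain n where "qpar w * qpar \<tau> ^ Suc n = 1"
      using qp_eq_0_iff[OF q] by blast
    then have "w + of_nat (Suc n) * \<tau> \<in> \<int>"
      by (simp only: qpar_power qpar_add[symmetric] qpar_eq_1_iff)
    then obtain m where "w + of_nat (Suc n) * \<tau> = of_int m" by (rule Ints_cases)
    then have "w = of_int m + of_int (- int (Suc n)) * \<tau>" by (simp add: algebra_simps)
    then show ?thesis by (rule that)
  next
    case 3
    then obtain n where "qpar (- w) * qpar \<tau> ^ Suc n = 1"
      using qp_eq_0_iff[OF q] by blast
    then have "- w + of_nat (Suc n) * \<tau> \<in> \<int>"
      by (simp only: qpar_power qpar_add[symmetric] qpar_eq_1_iff)
    then obtain m where "- w + of_nat (Suc n) * \<tau> = of_int m" by (rule Ints_cases)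
    then have "w = of_int (- m) + of_int (int (Suc n)) * \<tau>" by (simp add: algebra_simps)
    then show ?thesis by (rule that)
  qed
qed

text \<open>At w = 0 both products equal \<open>qp 1\<close>, which the denominator cancels; the
  slope is that of the sine alone.\<close>

lemma DERIV_ntheta_0:
  assumes "Im \<tau> > 0"
  shows "(ntheta \<tau> has_field_derivative of_real pi) (at 0)"
proof -
  have q: "norm (qpar \<tau>) < 1" using assms by (simp add: norm_qpar_less_1)
  define k where "k = (\<lambda>w. qp (qpar w) (qpar \<tau>) * qp (qpar (- w)) (qpar \<tau>) / qp 1 (qpar \<tau>) ^ 2)"
  have "k holomorphic_on UNIV"
    unfolding k_def using q by (auto intro!: holomorphic_intros simp: qp_1_nonzero)
  then have k: "(k has_field_derivative deriv k 0) (at 0)"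
    by (intro holomorphic_derivI) auto
  have k0: "k 0 = 1"
    using qp_1_nonzero[OF q] by (simp add: k_def power2_eq_square)
  have "((\<lambda>w. sin (of_real pi * w) * k w) has_field_derivative of_real pi) (at 0)"
    by (rule derivative_eq_intros k | simp add: k0)+
  moreover have "ntheta \<tau> = (\<lambda>w. sin (of_real pi * w) * k w)"
    by (auto simp: ntheta_def k_def)
  ultimately show ?thesis by simp
qed

text \<open>Functions with the quasi-periodicity of \<open>h\<close> that vanish at the lattice points are multiples
  of \<open>h\<close>: the quotient is doubly periodic and, after removing singularities, entire.\<close>

lemma ntheta_unique:
  assumes \<tau>: "Im \<tau> > 0" and R: "R holomorphic_on UNIV"
    and R1: "\<And>w. R (w + 1) = - R w"
    and R\<tau>: "\<And>w. R (w + \<tau>) = - qpar (- \<tau> / 2 - w) * R w"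
    and R0: "R 0 = 0" and R': "(R has_field_derivative of_real pi) (at 0)"
  shows "R w = ntheta \<tau> w"
proof -
  define L where "L = {w. \<exists>m n :: int. w = of_int m + of_int n * \<tau>}"
  \<comment> \<open>The value 1 on the lattice is the limit of the quotient at 0, since both
    functions have slope pi there; double periodicity carries it to every other lattice
    point.\<close>
  define Q where "Q = (\<lambda>w. if w \<in> L then 1 else R w / ntheta \<tau> w)"
  have \<tau>L: "w + 1 \<in> L \<longleftrightarrow> w \<in> L" "w + \<tau> \<in> L \<longleftrightarrow> w \<in> L" for w
  proof -
    have shift: "w + (of_int a + of_int b * \<tau>) \<in> L" if w: "w \<in> L" for w and a b :: int
    proof -
      obtain m n :: int where "w = of_int m + of_int n * \<tau>"
        using w unfolding L_def by blast
      then have "w + (of_int a + of_int b * \<tau>) = of_int (m + a) + of_int (n + b) * \<tau>"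
        by (simp add: algebra_simps)
      then show ?thesis unfolding L_def by blast
    qed
    show "w + 1 \<in> L \<longleftrightarrow> w \<in> L"
      using shift[of w 1 0] shift[of "w + 1" "-1" 0] by auto
    show "w + \<tau> \<in> L \<longleftrightarrow> w \<in> L"
      using shift[of w 0 1] shift[of "w + \<tau>" 0 "-1"] by auto
  qed
  have Q1: "Q (w + 1) = Q w" and Q\<tau>: "Q (w + \<tau>) = Q w" for w
    by (auto simp: Q_def \<tau>L R1 R\<tau> ntheta_add_1 ntheta_add_tau[OF \<tau>])
  have int_period: "f (w + of_int m * t) = f w" if "\<And>w. f (w + t) = f w" for f :: "complex \<Rightarrow> complex" and m t w
  proof (induction m rule: int_induct[where k = 0])
    case (step1 i)
    then show ?case using that[of "w + of_int i * t"] by (simp add: algebra_simps)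
  next
    case (step2 i)
    then show ?case using that[of "w + of_int (i - 1) * t"] by (simp add: algebra_simps)
  qed simp
  have lattice_zero: "X w = 0"
    if "\<And>w. X (w + 1) = - X w" "\<And>w. X (w + \<tau>) = - qpar (- \<tau> / 2 - w) * X w" "X 0 = 0" and w: "w \<in> L"
    for X :: "complex \<Rightarrow> complex" and w
  proof -
    \<comment> \<open>The multipliers never vanish, so the indicator of the zero set is doubly
      periodic even though \<open>X\<close> is not.\<close>
    define Z where "Z = (\<lambda>w. if X w = 0 then 1 else 0 :: complex)"
    have "Z (w + 1) = Z w" "Z (w + \<tau>) = Z w" for w
      by (simp_all add: Z_def that)
    then have "Z (0 + of_int m * 1 + of_int n * \<tau>) = Z 0" for m n :: int
      using int_period[of Z \<tau> "0 + of_int m * 1" n] int_period[of Z 1 0 m] by simp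
    moreover obtain m n :: int where "w = of_int m + of_int n * \<tau>"
      using w unfolding L_def by blast
    ultimately have "Z w = Z 0" by simp
    then show ?thesis by (simp add: Z_def that(3) split: if_splits)
  qed
  have ntheta_L: "ntheta \<tau> w = 0" if "w \<in> L" for w
    by (rule lattice_zero[OF ntheta_add_1 ntheta_add_tau[OF \<tau>] _ that]) (simp add: ntheta_def)
  have R_L: "R w = 0" if "w \<in> L" for w
    by (rule lattice_zero[OF R1 R\<tau> R0 that])
  have QL: "Q (w + l) = Q w" if l: "l \<in> L" for w l
  proof -
    obtain m n :: int where l': "l = of_int m + of_int n * \<tau>"
      using l unfolding L_def by blast
    have "Q (w + l) = Q ((w + of_int m * 1) + of_int n * \<tau>)" by (simp add: l' add_ac)
    also have "\<dots> = Q w"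
      using int_period[of Q \<tau> "w + of_int m * 1" n, OF Q\<tau>] int_period[of Q 1 w m, OF Q1] by simp
    finally show ?thesis .
  qed
  have nz: "ntheta \<tau> w \<noteq> 0" if "w \<notin> L" for w
    using ntheta_eq_0D[OF \<tau>, of w] that unfolding L_def by blast
  have lim0: "((\<lambda>w. R w / ntheta \<tau> w) \<longlongrightarrow> 1) (at 0)"
  proof -
    have "((\<lambda>w. R w / w) \<longlongrightarrow> of_real pi) (at 0)"
      using R' R0 unfolding has_field_derivative_iff by simp
    moreover have "((\<lambda>w. ntheta \<tau> w / w) \<longlongrightarrow> of_real pi) (at 0)"
      using DERIV_ntheta_0[OF \<tau>] unfolding has_field_derivative_iff by (simp add: ntheta_def[of _ 0])
    ultimately have "((\<lambda>w. (R w / w) / (ntheta \<tau> w / w)) \<longlongrightarrow> of_real pi / of_real pi) (at 0)"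
      by (intro tendsto_divide) auto
    then have "((\<lambda>w. (R w / w) / (ntheta \<tau> w / w)) \<longlongrightarrow> 1) (at 0)" by simp
    then show ?thesis
      by (rule Lim_transform_eventually) (auto simp: eventually_at_filter)
  qed
  \<comment> \<open>The lattice is isolated at 0 because \<open>ntheta\<close> vanishes on it and
    has nonzero slope at 0; this replaces a geometric argument for discreteness.\<close>
  have near0: "\<exists>e>0. \<forall>w. w \<in> ball 0 e \<longrightarrow> w \<in> L \<longrightarrow> w = 0"
  proof -
    have "((\<lambda>w. ntheta \<tau> w / w) \<longlongrightarrow> of_real pi) (at 0)"
      using DERIV_ntheta_0[OF \<tau>] unfolding has_field_derivative_iff by (simp add: ntheta_def[of _ 0])
    then have "eventually (\<lambda>w. ntheta \<tau> w / w \<noteq> 0) (at 0)"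
      by (rule tendsto_imp_eventually_ne) simp
    then obtain e where e: "e > 0" "\<And>w. w \<noteq> 0 \<Longrightarrow> dist w 0 < e \<Longrightarrow> ntheta \<tau> w \<noteq> 0"
      unfolding eventually_at by auto
    then show ?thesis using e ntheta_L by (intro exI[of _ e]) (auto simp: dist_commute)
  qed
  have Q0: "Q field_differentiable at 0"
  proof -
    obtain e where e: "e > 0" "\<And>w. w \<in> ball 0 e \<Longrightarrow> w \<in> L \<Longrightarrow> w = 0"
      using near0 by blast
    have "Q holomorphic_on ball 0 e"
    proof (rule no_isolated_singularity'[of "{0}"])
      have 0: "(0::complex) \<in> L" by (auto simp: L_def intro!: exI[of _ 0])
      have "eventually (\<lambda>w. R w / ntheta \<tau> w = Q w) (at 0)"
        unfolding eventually_at using e by (auto simp: Q_def dist_commute intro!: exI[of _ e])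
      then have "(Q \<longlongrightarrow> 1) (at 0)"
        using Lim_transform_eventually[OF lim0] by blast
      then show "(Q \<longlongrightarrow> Q z) (at z within ball 0 e)" if "z \<in> {0}" for z
        using that 0 by (auto simp: Q_def intro: tendsto_within_subset)
      have "(\<lambda>w. R w / ntheta \<tau> w) holomorphic_on (ball 0 e - {0})"
        using e nz by (intro holomorphic_intros holomorphic_on_subset[OF R] \<tau>) auto
      then show "Q holomorphic_on (ball 0 e - {0})"
        by (rule holomorphic_transform) (use e in \<open>auto simp: Q_def\<close>)
    qed auto
    then show ?thesis using e(1)
      by (meson centre_in_ball holomorphic_on_imp_differentiable_at open_ball)
  qed
  \<comment> \<open>At a lattice point, periodicity moves the question to 0. Elsewhere
    \<open>Q\<close> is the plain quotient on the open set where \<open>ntheta\<close> does not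
    vanish.\<close>
  have closed_L: "Q field_differentiable at w" for w
  proof (cases "w \<in> L")
    case True
    then have "Q = (\<lambda>x. Q (x + (- w)))"
    proof (intro ext)
      fix x show "Q x = Q (x + - w)" using QL[OF True, of "x - w"] by simp
    qed
    moreover have "(\<lambda>x. Q (x + (- w))) field_differentiable at w"
      using Q0 DERIV_shift[of Q _ w "- w"] unfolding field_differentiable_def by simp
    ultimately show ?thesis by simp
  next
    case False
    have "continuous_on UNIV (ntheta \<tau>)"
      using \<tau> by (intro holomorphic_on_imp_continuous_on holomorphic_intros)
    then have "open (ntheta \<tau> -` (- {0}))"
      by (intro open_vimage) auto
    have "(\<lambda>w. R w / ntheta \<tau> w) holomorphic_on (ntheta \<tau> -` (- {0}))"
      by (intro holomorphic_intros holomorphic_on_subset[OF R] \<tau>) auto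
    then have "Q holomorphic_on (ntheta \<tau> -` (- {0}))"
      by (rule holomorphic_transform) (use ntheta_L in \<open>auto simp: Q_def\<close>)
    with \<open>open (ntheta \<tau> -` (- {0}))\<close> nz[OF False] show ?thesis
      by (intro holomorphic_on_imp_differentiable_at[of Q "ntheta \<tau> -` (- {0})"]) auto
  qed
  then have holQ: "Q holomorphic_on UNIV"
    by (simp add: holomorphic_on_def)
  have "bounded (range Q)"
  proof -
    \<comment> \<open>The closed fundamental parallelogram: reducing both lattice coordinates to
      their fractional parts shows that \<open>Q\<close> takes all its values there.\<close>
    define K where "K = (\<lambda>(a, b). of_real a + of_real b * \<tau>) ` ({0..1} \<times> {0..1})"
    have "compact (Q ` K)"
      unfolding K_def
      by (intro compact_continuous_image continuous_on_subset[OF holomorphic_on_imp_continuous_on[OF holQ]]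
          compact_Times) (auto simp: case_prod_unfold intro!: continuous_intros)
    moreover have "Q w \<in> Q ` K" for w
    proof -
      define b where "b = Im w / Im \<tau>"
      define a where "a = Re w - b * Re \<tau>"
      have w: "w = of_real a + of_real b * \<tau>"
        using \<tau> by (auto simp: complex_eq_iff a_def b_def)
      have "Q w = Q ((of_real (frac a) + of_real (frac b) * \<tau>) + (of_int \<lfloor>a\<rfloor> + of_int \<lfloor>b\<rfloor> * \<tau>))"
        by (simp add: w frac_def algebra_simps)
      also have "\<dots> = Q (of_real (frac a) + of_real (frac b) * \<tau>)"
        by (rule QL) (auto simp: L_def)
      finally show ?thesis
        using frac_lt_1[of a] frac_lt_1[of b]
        by (force simp: K_def intro!: image_eqI[of _ Q] image_eqI[of _ _ "(frac a, frac b)"])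
    qed
    ultimately show ?thesis
      by (meson bounded_subset compact_imp_bounded image_subsetI)
  qed
  with holQ have "Q constant_on UNIV" by (rule Liouville_theorem)
  then obtain c where c: "\<And>w. Q w = c" by (auto simp: constant_on_def)
  have "(0::complex) \<in> L" by (auto simp: L_def intro!: exI[of _ 0])
  then have "c = 1" using c[of 0] by (simp add: Q_def)
  show ?thesis
  proof (cases "w \<in> L")
    case True
    then show ?thesis by (simp add: R_L ntheta_L)
  next
    case False
    then show ?thesis using c[of w] \<open>c = 1\<close> nz[OF False] by (simp add: Q_def)
  qed
qed

text \<open>Jacobi's imaginary transformation. Dividing w by \<tau> exchanges the two periods, the
  Gaussian factor corrects the multipliers, and the factor \<tau> restores the slope pi at 0. The
  right side thus meets the hypotheses of \<open>ntheta_unique\<close>.\<close>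

lemma ntheta_transform:
  assumes \<tau>: "Im \<tau> > 0"
  shows "ntheta \<tau> w = \<tau> * qpar (- w\<^sup>2 / (2 * \<tau>)) * ntheta (- 1 / \<tau>) (w / \<tau>)"
proof -
  define \<sigma> where "\<sigma> = - 1 / \<tau>"
  have \<tau>0: "\<tau> \<noteq> 0" using \<tau> by auto
  have \<sigma>: "Im \<sigma> > 0"
    using \<tau> by (simp add: \<sigma>_def Im_divide sum_power2_gt_zero_iff)
  define R where "R = (\<lambda>w. \<tau> * qpar (- w\<^sup>2 / (2 * \<tau>)) * ntheta \<sigma> (w / \<tau>))"
  have "R w = ntheta \<tau> w"
  proof (rule ntheta_unique[OF \<tau>])
    show "R holomorphic_on UNIV"
      unfolding R_def using \<tau>0 \<sigma> by (intro holomorphic_intros) auto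
    show "R 0 = 0" by (simp add: R_def ntheta_def)
    show "R (w + \<tau>) = - qpar (- \<tau> / 2 - w) * R w" for w
    proof -
      have "(w + \<tau>) / \<tau> = w / \<tau> + 1" using \<tau>0 by (simp add: field_simps)
      moreover have "- (w + \<tau>)\<^sup>2 / (2 * \<tau>) = (- \<tau> / 2 - w) + (- w\<^sup>2 / (2 * \<tau>))"
        using \<tau>0 by (simp add: field_simps power2_eq_square)
      ultimately show ?thesis by (simp only: R_def ntheta_add_1 qpar_add) simp
    qed
    show "R (w + 1) = - R w" for w
    proof -
      have 1: "w / \<tau> = (w + 1) / \<tau> + \<sigma>" using \<tau>0 by (simp add: \<sigma>_def field_simps)
      have 2: "(- w\<^sup>2 / (2 * \<tau>)) + (- \<sigma> / 2 - (w + 1) / \<tau>) = - (w + 1)\<^sup>2 / (2 * \<tau>)"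
        using \<tau>0 by (simp add: \<sigma>_def field_simps power2_eq_square)
      show ?thesis
        unfolding R_def 1 ntheta_add_tau[OF \<sigma>]
        by (simp only: 2[symmetric] qpar_add mult_minus_left mult_minus_right minus_minus mult.assoc)
    qed
    have "((\<lambda>w. ntheta \<sigma> (w / \<tau>)) has_field_derivative of_real pi * (1 / \<tau>)) (at 0)"
      by (rule DERIV_chain'[of "\<lambda>w. w / \<tau>"]) (auto intro!: derivative_eq_intros DERIV_ntheta_0[OF \<sigma>] simp: \<tau>0)
    moreover have "((\<lambda>w. \<tau> * qpar (- w\<^sup>2 / (2 * \<tau>))) has_field_derivative 0) (at 0)"
      unfolding qpar_def using \<tau>0 by (auto intro!: derivative_eq_intros)
    ultimately have "(R has_field_derivative 0 * ntheta \<sigma> (0 / \<tau>) +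
        of_real pi * (1 / \<tau>) * (\<tau> * qpar (- 0\<^sup>2 / (2 * \<tau>)))) (at 0)"
      unfolding R_def by (intro DERIV_mult)
    then show "(R has_field_derivative of_real pi) (at 0)"
      using \<tau>0 by simp
  qed
  then show ?thesis by (simp add: R_def \<sigma>_def)
qed

section \<open>The eta transformation\<close>

lemma qp_mult_minus:
  assumes "norm q < 1"
  shows "qp c q * qp (- c) q = qp (c\<^sup>2) (q\<^sup>2)"
proof (rule LIMSEQ_unique)
  show "(\<lambda>N. (\<Prod>n<N. 1 - c * q ^ Suc n) * (\<Prod>n<N. 1 - (- c) * q ^ Suc n)) \<longlonglongrightarrow> qp c q * qp (- c) q"
    by (intro tendsto_mult qp_LIMSEQ assms)
  have "(1 - c * q ^ Suc n) * (1 - (- c) * q ^ Suc n) = 1 - c\<^sup>2 * (q\<^sup>2) ^ Suc n" for n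
  proof -
    have "(q\<^sup>2) ^ Suc n = q ^ Suc n * q ^ Suc n"
      by (simp only: power2_eq_square power_mult_distrib)
    then show ?thesis by (simp add: algebra_simps power2_eq_square)
  qed
  moreover have "norm (q\<^sup>2) < 1"
    using assms by (simp add: norm_power power_less_one_iff)
  ultimately show "(\<lambda>N. (\<Prod>n<N. 1 - c * q ^ Suc n) * (\<Prod>n<N. 1 - (- c) * q ^ Suc n)) \<longlonglongrightarrow> qp (c\<^sup>2) (q\<^sup>2)"
    using qp_LIMSEQ[of "q\<^sup>2" "c\<^sup>2"] by (simp only: prod.distrib[symmetric])
qed

text \<open>Factors are sorted by the parity of the exponent. Since \<open>qp\<close> starts with
  exponent 1, \<open>qp q\<close> in q^2 begins with 1 - q^3, and the factor 1 - q has to be written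
  separately.\<close>

lemma qp_even_odd:
  assumes "norm q < 1"
  shows "qp 1 q = (1 - q) * qp q (q\<^sup>2) * qp 1 (q\<^sup>2)"
proof (rule LIMSEQ_unique)
  have q2: "norm (q\<^sup>2) < 1"
    using assms by (simp add: norm_power power_less_one_iff)
  show "(\<lambda>N. \<Prod>n<2 * Suc N. 1 - 1 * q ^ Suc n) \<longlonglongrightarrow> qp 1 q"
    by (rule filterlim_compose[OF qp_LIMSEQ[OF assms]])
       (auto intro!: filterlim_subseq simp: strict_mono_def)
  have split: "(\<Prod>n<2 * N. 1 - 1 * q ^ Suc n) = (\<Prod>j<N. 1 - q * (q\<^sup>2) ^ j) * (\<Prod>j<N. 1 - 1 * (q\<^sup>2) ^ Suc j)" for N
  proof (induction N)
    case (Suc N)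
    have "q ^ Suc (2 * N) = q * (q\<^sup>2) ^ N" "q ^ Suc (Suc (2 * N)) = (q\<^sup>2) ^ Suc N"
      by (simp_all add: power_mult) (simp add: power2_eq_square)
    then show ?case using Suc by (simp del: power_Suc add: mult_ac)
  qed simp
  have eq: "(\<Prod>n<2 * Suc N. 1 - 1 * q ^ Suc n) =
      (1 - q) * (\<Prod>j<N. 1 - q * (q\<^sup>2) ^ Suc j) * (\<Prod>j<Suc N. 1 - 1 * (q\<^sup>2) ^ Suc j)" for N
    unfolding split by (subst prod.lessThan_Suc_shift) simp
  show "(\<lambda>N. \<Prod>n<2 * Suc N. 1 - 1 * q ^ Suc n) \<longlonglongrightarrow> (1 - q) * qp q (q\<^sup>2) * qp 1 (q\<^sup>2)"
    unfolding eq by (intro tendsto_intros qp_LIMSEQ LIMSEQ_Suc[OF qp_LIMSEQ] q2)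
qed

text \<open>Euler's identity \<open>\<Prod>(1 + q\<^sup>n)(1 - q\<^bsup>2n-1\<^esup>) = 1\<close> with \<open>q = s\<^sup>2\<close>.\<close>

lemma qp_half_period_product:
  assumes "norm s < 1"
  shows "qp (- 1) (s\<^sup>2) * ((1 - s) * qp s (s\<^sup>2)) * ((1 + s) * qp (- s) (s\<^sup>2)) = 1"
proof -
  define q where "q = s\<^sup>2"
  have q: "norm q < 1"
    using assms by (simp add: q_def norm_power power_less_one_iff)
  have "qp s q * qp (- s) q = qp q (q\<^sup>2)"
    using qp_mult_minus[OF q, of s] by (simp add: q_def)
  moreover have "qp 1 q * qp (- 1) q = qp 1 (q\<^sup>2)"
    using qp_mult_minus[OF q, of 1] by simp
  moreover have "(1 - s) * (1 + s) = 1 - q"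
    by (simp add: q_def algebra_simps power2_eq_square)
  ultimately have "qp 1 q * (qp (- 1) q * ((1 - s) * qp s q) * ((1 + s) * qp (- s) q)) = qp 1 q"
    using qp_even_odd[OF q] by (metis (no_types, opaque_lifting) mult.assoc mult.commute)
  then show ?thesis
    using qp_1_nonzero[OF q] by (simp flip: q_def)
qed

lemma qpar_half: "qpar (1 / 2) = - 1" and qpar_quarter: "qpar (1 / 4) = \<i>"
proof -
  have "2 * of_real pi * \<i> * (1 / 2) = \<i> * of_real pi" "2 * of_real pi * \<i> * (1 / 4) = \<i> * of_real (pi / 2)"
    by simp_all
  then show "qpar (1 / 2) = - 1" "qpar (1 / 4) = \<i>"
    unfolding qpar_def by (simp_all only: cis_conv_exp[symmetric] cis_pi cis_pi_half)
qed

text \<open>Each value is an elementary factor times the square of a product, divided by P^2, and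
  the three products multiply to 1 by Euler's identity. Only P^6 survives, which is why the
  transformation of eta is first obtained for sixth powers.\<close>

lemma ntheta_half_periods:
  assumes "Im \<tau> > 0"
  shows "ntheta \<tau> (1 / 2) * ntheta \<tau> (\<tau> / 2) * ntheta \<tau> ((1 + \<tau>) / 2) =
    \<i> / 4 / (qpar (\<tau> / 2) * qp 1 (qpar \<tau>) ^ 6)"
proof -
  define q s r where "q = qpar \<tau>" and "s = qpar (\<tau> / 2)" and "r = qpar (\<tau> / 4)"
  define P where "P = qp 1 q"
  have q: "norm q < 1" and s: "norm s < 1" "s \<noteq> 0" and r: "r \<noteq> 0"
    using assms by (simp_all add: q_def s_def r_def norm_qpar_less_1)
  have qs: "q = s\<^sup>2" and sr: "s = r\<^sup>2"
    by (simp_all add: q_def s_def r_def qpar_power)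
  have sq: "inverse s * q = s" using s by (simp add: qs power2_eq_square)
  have P: "P \<noteq> 0" using qp_1_nonzero[OF q] by (simp add: P_def)
  have mhalf: "qpar (- (1 / 2)) = - 1"
    unfolding qpar_minus qpar_half by simp
  have 1: "ntheta \<tau> (1 / 2) = (qp (- 1) q)\<^sup>2 / P\<^sup>2"
    unfolding ntheta_def mhalf qpar_half q_def[symmetric] P_def[symmetric]
    by (simp add: power2_eq_square flip: sin_of_real)
  have s2: "qpar (- (\<tau> / 2)) = inverse s" by (simp add: s_def qpar_minus)
  have sin1: "sin (of_real pi * (\<tau> / 2)) = \<i> / 2 * inverse r * (1 - s)"
  proof -
    have "qpar (\<tau> / 2 / 2) = r" "qpar (- (\<tau> / 2) / 2) = inverse r"
      by (simp_all add: r_def flip: qpar_minus)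
    then show ?thesis
      unfolding sin_pi_eq_qpar using r by (simp add: sr field_simps power2_eq_square)
  qed
  have 2: "ntheta \<tau> (\<tau> / 2) = \<i> / 2 * inverse r * ((1 - s) * qp s q)\<^sup>2 / P\<^sup>2"
  proof -
    have e: "qp (inverse s) q = (1 - s) * qp s q"
      using qp_shift[OF q, of "inverse s"] unfolding sq .
    show ?thesis
      unfolding ntheta_def sin1 s2 s_def[symmetric] q_def[symmetric] P_def[symmetric] e
      by (simp add: power2_eq_square mult_ac)
  qed
  have s3: "qpar ((1 + \<tau>) / 2) = - s" "qpar (- ((1 + \<tau>) / 2)) = - inverse s"
    by (simp_all only: add_divide_distrib qpar_add qpar_minus qpar_half s_def) simp_all
  have sin2: "sin (of_real pi * ((1 + \<tau>) / 2)) = 1 / 2 * inverse r * (1 + s)"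
  proof -
    have "(1 + \<tau>) / 2 / 2 = 1 / 4 + \<tau> / 4" "- ((1 + \<tau>) / 2) / 2 = - (1 / 4 + \<tau> / 4)"
      by (simp_all add: field_simps)
    then have "qpar ((1 + \<tau>) / 2 / 2) = \<i> * r" "qpar (- ((1 + \<tau>) / 2) / 2) = inverse (\<i> * r)"
      by (simp_all only: qpar_add qpar_minus qpar_quarter r_def)
    then show ?thesis
      unfolding sin_pi_eq_qpar using r by (simp add: sr field_simps power2_eq_square)
  qed
  have sq': "(- inverse s) * q = - s" using sq by simp
  have 3: "ntheta \<tau> ((1 + \<tau>) / 2) = 1 / 2 * inverse r * ((1 + s) * qp (- s) q)\<^sup>2 / P\<^sup>2"
  proof -
    have e: "qp (- inverse s) q = (1 + s) * qp (- s) q"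
      using qp_shift[OF q, of "- inverse s"] unfolding sq' by simp
    show ?thesis
      unfolding ntheta_def sin2 s3 q_def[symmetric] P_def[symmetric] e
      by (simp add: power2_eq_square mult_ac)
  qed
  have "ntheta \<tau> (1 / 2) * ntheta \<tau> (\<tau> / 2) * ntheta \<tau> ((1 + \<tau>) / 2) =
      \<i> / 4 / (r\<^sup>2 * P ^ 6) * (qp (- 1) q * ((1 - s) * qp s q) * ((1 + s) * qp (- s) q))\<^sup>2"
  proof -
    have P6: "P ^ 6 = P\<^sup>2 * P\<^sup>2 * P\<^sup>2" by (simp flip: power_add)
    have "a\<^sup>2 / p * (\<i> / 2 * inverse r * b\<^sup>2 / p) * (1 / 2 * inverse r * c\<^sup>2 / p) =
        \<i> / 4 / (r\<^sup>2 * (p * p * p)) * (a * b * c)\<^sup>2" for a b c p :: complex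
      using r by (cases "p = 0") (simp_all add: field_simps power2_eq_square)
    then show ?thesis unfolding 1 2 3 P6 .
  qed
  also have "qp (- 1) q * ((1 - s) * qp s q) * ((1 + s) * qp (- s) q) = 1"
    using qp_half_period_product[OF s(1)] by (simp add: qs)
  finally show ?thesis
    by (simp add: P_def q_def sr[symmetric] s_def)
qed

lemma eta_conv_qp: "eta \<tau> = qpar (\<tau> / 24) * qp 1 (qpar \<tau>)"
  by (simp add: eta_def qp_def)

text \<open>The map w to w / \<tau> permutes the half periods up to sign and lattice translation:
  1/2 and \<tau>/2 change places, and (1 + \<tau>)/2 goes to its counterpart for the new lattice.
  Multiplying the three theta transformations and inserting \<open>ntheta_half_periods\<close> on
  both sides leaves eta alone.\<close>

lemma eta_transform_power6:
  assumes \<tau>: "Im \<tau> > 0"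
  shows "eta (- 1 / \<tau>) ^ 6 = (- \<i> * \<tau>) ^ 3 * eta \<tau> ^ 6"
proof -
  define \<sigma> where "\<sigma> = - 1 / \<tau>"
  have \<tau>0: "\<tau> \<noteq> 0" using \<tau> by auto
  have \<sigma>: "Im \<sigma> > 0"
    using \<tau> by (simp add: \<sigma>_def Im_divide sum_power2_gt_zero_iff)
  define P P' where "P = qp 1 (qpar \<tau>)" and "P' = qp 1 (qpar \<sigma>)"
  have nz: "P \<noteq> 0" "P' \<noteq> 0"
    using \<tau> \<sigma> by (simp_all add: P_def P'_def qp_1_nonzero norm_qpar_less_1)
  have 1: "ntheta \<tau> (1 / 2) = - \<tau> * qpar (\<sigma> / 8) * ntheta \<sigma> (\<sigma> / 2)"
  proof -
    have "1 / 2 / \<tau> = - (\<sigma> / 2)" "- (1 / 2)\<^sup>2 / (2 * \<tau>) = \<sigma> / 8"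
      using \<tau>0 by (simp_all add: \<sigma>_def field_simps power2_eq_square)
    then show ?thesis
      using ntheta_transform[OF \<tau>, of "1 / 2"] by (simp only: \<sigma>_def[symmetric] ntheta_minus) simp
  qed
  have 2: "ntheta \<tau> (\<tau> / 2) = \<tau> * qpar (- \<tau> / 8) * ntheta \<sigma> (1 / 2)"
  proof -
    have "\<tau> / 2 / \<tau> = 1 / 2" "- (\<tau> / 2)\<^sup>2 / (2 * \<tau>) = - \<tau> / 8"
      using \<tau>0 by (simp_all add: field_simps power2_eq_square)
    then show ?thesis
      using ntheta_transform[OF \<tau>, of "\<tau> / 2"] by (simp only: \<sigma>_def[symmetric])
  qed
  have 3: "ntheta \<tau> ((1 + \<tau>) / 2) = \<tau> * qpar (\<sigma> / 8 - 1 / 4 - \<tau> / 8) * ntheta \<sigma> ((1 + \<sigma>) / 2)"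
  proof -
    have e: "(1 + \<tau>) / 2 / \<tau> = - ((1 + \<sigma>) / 2 + (- 1))" "- ((1 + \<tau>) / 2)\<^sup>2 / (2 * \<tau>) = \<sigma> / 8 - 1 / 4 - \<tau> / 8"
      using \<tau>0 by (simp_all add: \<sigma>_def field_simps power2_eq_square)
    have "ntheta \<sigma> (- ((1 + \<sigma>) / 2 + (- 1))) = ntheta \<sigma> ((1 + \<sigma>) / 2)"
      unfolding ntheta_minus using ntheta_add_1[of \<sigma> "(1 + \<sigma>) / 2 + (- 1)"] by simp
    then show ?thesis
      using ntheta_transform[OF \<tau>, of "(1 + \<tau>) / 2"] by (simp only: \<sigma>_def[symmetric] e)
  qed
  define B where "B = (\<lambda>\<tau>. ntheta \<tau> (1 / 2) * ntheta \<tau> (\<tau> / 2) * ntheta \<tau> ((1 + \<tau>) / 2))"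
  have "B \<tau> = - (\<tau> ^ 3) * (qpar (\<sigma> / 8) * qpar (- \<tau> / 8) * qpar (\<sigma> / 8 - 1 / 4 - \<tau> / 8)) * B \<sigma>"
    unfolding B_def 1 2 3 by (simp add: power3_eq_cube mult_ac)
  also have "qpar (\<sigma> / 8) * qpar (- \<tau> / 8) * qpar (\<sigma> / 8 - 1 / 4 - \<tau> / 8) = qpar (\<sigma> / 4 - \<tau> / 4 - 1 / 4)"
    unfolding qpar_add[symmetric] by (rule arg_cong[of _ _ qpar]) simp
  also have "\<dots> = - \<i> * qpar (\<sigma> / 4) / qpar (\<tau> / 4)"
    unfolding qpar_diff qpar_quarter by simp
  finally have B: "B \<tau> = \<i> * \<tau> ^ 3 * qpar (\<sigma> / 4) / qpar (\<tau> / 4) * B \<sigma>" by simp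
  have half: "qpar (x / 2) = qpar (x / 4) * qpar (x / 4)" for x
    unfolding qpar_add[symmetric] by (rule arg_cong[of _ _ qpar]) simp
  have "\<i> / 4 / (qpar (\<tau> / 4) * qpar (\<tau> / 4) * P ^ 6) =
      \<i> * \<tau> ^ 3 * qpar (\<sigma> / 4) / qpar (\<tau> / 4) * (\<i> / 4 / (qpar (\<sigma> / 4) * qpar (\<sigma> / 4) * P' ^ 6))"
    using B unfolding B_def ntheta_half_periods[OF \<tau>] ntheta_half_periods[OF \<sigma>] P_def P'_def half .
  then have "qpar (\<sigma> / 4) * P' ^ 6 = \<i> * \<tau> ^ 3 * (qpar (\<tau> / 4) * P ^ 6)"
    using nz by (simp add: divide_simps)
  moreover have "eta \<tau> ^ 6 = qpar (\<tau> / 4) * P ^ 6" "eta \<sigma> ^ 6 = qpar (\<sigma> / 4) * P' ^ 6"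
    by (simp_all add: eta_conv_qp P_def P'_def power_mult_distrib qpar_power)
  moreover have "(- \<i> * \<tau>) ^ 3 = \<i> * \<tau> ^ 3"
  proof -
    have "(- \<i>) ^ 3 = \<i>" by (simp add: power3_eq_cube)
    then show ?thesis by (simp only: power_mult_distrib)
  qed
  ultimately show ?thesis by (simp add: \<sigma>_def)
qed

lemma holomorphic_on_eta [holomorphic_intros]:
  assumes "open S" "f holomorphic_on S" "\<And>x. x \<in> S \<Longrightarrow> Im (f x) > 0"
  shows "(\<lambda>x. eta (f x)) holomorphic_on S"
  unfolding eta_conv_qp using assms
  by (intro holomorphic_on_mult holomorphic_on_qp holomorphic_on_qpar holomorphic_on_divide holomorphic_on_const)
     (auto simp: norm_qpar_less_1)

lemma eta_nonzero: "Im \<tau> > 0 \<Longrightarrow> eta \<tau> \<noteq> 0"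
  by (simp add: eta_conv_qp qp_1_nonzero norm_qpar_less_1)

text \<open>On the half plane the quotient of the two sides is continuous with values in the sixth roots
  of unity, hence constant; at \<open>z = 2\<pi>\<close> both eta arguments are \<open>\<i>\<close>.\<close>

lemma eta_transform:
  assumes "Re z > 0"
  shows "eta (2 * of_real pi * \<i> / z) = csqrt (z / (2 * of_real pi)) * eta (\<i> * z / (2 * of_real pi))"
proof -
  define D where "D = {z. Re z > 0}"
  define V where "V = (\<lambda>z. eta (2 * of_real pi * \<i> / z) / (csqrt (z / (2 * of_real pi)) * eta (\<i> * z / (2 * of_real pi))))"
  have D0: "z \<noteq> 0" if "z \<in> D" for z using that by (auto simp: D_def)
  have im: "Im (2 * of_real pi * \<i> / z) > 0" "Im (\<i> * z / (2 * of_real pi)) > 0" if "z \<in> D" for z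
    using that by (auto simp: D_def Im_divide Re_divide power2_eq_square sum_squares_gt_zero_iff)
  have cs: "csqrt (z / (2 * of_real pi)) \<noteq> 0" if "z \<in> D" for z
    using D0[OF that] by simp
  have V6: "V z ^ 6 = 1" if "z \<in> D" for z
  proof -
    have e: "- 1 / (\<i> * z / (2 * of_real pi)) = 2 * of_real pi * \<i> / z"
      using D0[OF that] by (simp add: field_simps)
    have "csqrt (z / (2 * of_real pi)) ^ 6 = (csqrt (z / (2 * of_real pi)) ^ 2) ^ 3"
      by (simp only: power_mult[symmetric]) simp
    then have "csqrt (z / (2 * of_real pi)) ^ 6 = (- \<i> * (\<i> * z / (2 * of_real pi))) ^ 3"
      by simp
    then show ?thesis
      using eta_transform_power6[OF im(2)[OF that]] eta_nonzero[OF im(1)[OF that]]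
        eta_nonzero[OF im(2)[OF that]] D0[OF that] unfolding e
      by (simp add: V_def power_divide power_mult_distrib)
  qed
  have "V constant_on D"
  proof (rule continuous_finite_range_constant)
    show "connected D" unfolding D_def by (intro convex_connected convex_halfspace_Re_gt)
    have "V ` D \<subseteq> {x. x ^ 6 = 1}" using V6 by auto
    then show "finite (V ` D)"
      by (rule finite_subset) (rule finite_roots_unity, simp)
    have nonpos: "z / (2 * of_real pi) \<notin> \<real>\<^sub>\<le>\<^sub>0" if "z \<in> D" for z
      using that by (auto simp: D_def complex_nonpos_Reals_iff divide_le_0_iff not_le)
    have "open D" unfolding D_def by (simp add: open_halfspace_Re_gt)
    have "(\<lambda>z. eta (2 * of_real pi * \<i> / z)) holomorphic_on D"
      using D0 im(1) by (intro holomorphic_on_eta \<open>open D\<close> holomorphic_intros) auto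
    moreover have "(\<lambda>z. eta (\<i> * z / (2 * of_real pi))) holomorphic_on D"
      using im(2) by (intro holomorphic_on_eta \<open>open D\<close> holomorphic_intros) auto
    moreover have "(\<lambda>z. csqrt (z / (2 * of_real pi))) holomorphic_on D"
      using nonpos by (intro holomorphic_on_csqrt' holomorphic_intros) auto
    ultimately have "V holomorphic_on D"
      unfolding V_def using cs im(2) eta_nonzero
      by (intro holomorphic_on_divide holomorphic_on_mult) auto
    then show "continuous_on D V" by (rule holomorphic_on_imp_continuous_on)
  qed
  then obtain c where c: "\<And>z. z \<in> D \<Longrightarrow> V z = c" by (auto simp: constant_on_def)
  have "V (2 * of_real pi) = 1"
    using eta_nonzero[of \<i>] by (simp add: V_def)
  moreover have "2 * of_real pi \<in> D" by (simp add: D_def)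
  ultimately have "c = 1" using c by metis
  moreover have "z \<in> D" using assms by (simp add: D_def)
  ultimately have "V z = 1" using c by blast
  then show ?thesis
    using cs[OF \<open>z \<in> D\<close>] eta_nonzero[OF im(2)[OF \<open>z \<in> D\<close>]] by (simp add: V_def)
qed

section \<open>Expansion of \<open>gm1\<close> at the origin\<close>

lemma norm_sinh_ge:
  fixes v :: complex
  shows "sinh (Re v) \<le> norm (sinh v)"
proof -
  have "norm (exp v) - norm (exp (- v)) \<le> norm (exp v - exp (- v))"
    by (rule norm_triangle_ineq2)
  moreover have "sinh v = (exp v - exp (- v)) / 2"
    by (simp add: sinh_def scaleR_conv_of_real)
  ultimately show ?thesis
    by (simp add: sinh_def norm_divide)
qed

text \<open>One term of the exponential series is at most the whole sum.\<close>

lemma power_le_fact_exp: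
  fixes t :: real
  assumes "t \<ge> 0"
  shows "t ^ n \<le> fact n * exp t"
proof -
  have "(\<Sum>i\<in>{n}. inverse (fact i) * t ^ i) \<le> (\<Sum>i. inverse (fact i) * t ^ i)"
    using summable_exp[of t] assms by (intro sum_le_suminf) auto
  also have "\<dots> = exp t"
    by (simp add: exp_def scaleR_conv_of_real)
  finally show ?thesis by (simp add: field_simps)
qed

lemma power_le_exp:
  fixes t :: real
  assumes "t \<ge> 0" "c > 0"
  shows "t ^ n \<le> fact n / c ^ n * exp (c * t)"
  using power_le_fact_exp[of "c * t" n] assms by (simp add: power_mult_distrib field_simps)

text \<open>Near 0 the double zero of sinh^2 is absorbed by y^b with b >= 2. For large y the
  quotient exp y / sinh^2 decays like exp(-y); half of that decay is kept, the other half pays for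
  y^b.\<close>

lemma sinh_bound:
  assumes "b \<ge> 2"
  obtains C :: real where "C > 0"
    "\<And>y. y > 0 \<Longrightarrow> y ^ b * exp y / sinh y ^ 2 \<le> C * exp (- y / 2)"
proof
  define C :: real where "C = fact b * 4 ^ b * exp (1 / 4)"
  show "C > 0" by (simp add: C_def)
  fix y :: real assume y: "y > 0"
  \<comment> \<open>With this choice 1 + 2y <= exp(2y) is equivalent to y exp y <= t sinh y.
    Bounding t^b by an exponential of rate 1/4 then costs exp(y/2) and explains the factors 4^b and
    exp (1/4) in \<open>C\<close>.\<close>
  define t where "t = 1 + 2 * y"
  have t: "t > 0" "t \<le> exp (2 * y)" using y exp_ge_add_one_self[of "2 * y"] by (simp_all add: t_def)
  have "y * exp y \<le> t * sinh y"
  proof -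
    have "t * sinh y - y * exp y = (exp y * exp y * (1 + 2 * y) - (1 + 2 * y) - 2 * y * (exp y * exp y)) / (2 * exp y)"
      by (simp add: t_def sinh_def exp_minus field_simps)
    also have "\<dots> = (exp (2 * y) - (1 + 2 * y)) / (2 * exp y)"
    proof -
      have "exp (2 * y) = exp y * exp y" by (simp flip: exp_add)
      then show ?thesis by (simp add: algebra_simps)
    qed
    also have "\<dots> \<ge> 0" using t by (intro divide_nonneg_pos) (auto simp: t_def)
    finally show ?thesis by simp
  qed
  then have "(y * exp y)\<^sup>2 \<le> (t * sinh y)\<^sup>2"
    using y by (intro power_mono) auto
  then have 1: "y\<^sup>2 * exp y * exp y \<le> t\<^sup>2 * sinh y ^ 2"
    by (simp add: power_mult_distrib power2_eq_square mult_ac)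
  have s: "sinh y ^ 2 > 0" using y by simp
  obtain b' where b: "b = b' + 2" using assms by (metis add.commute le_Suc_ex)
  have "y ^ b * exp y * exp y = y ^ b' * (y\<^sup>2 * exp y * exp y)" by (simp add: b power_add power2_eq_square)
  also have "\<dots> \<le> t ^ b' * (t\<^sup>2 * sinh y ^ 2)"
    by (rule mult_mono[OF power_mono 1]) (use y t in \<open>auto simp: t_def\<close>)
  also have "\<dots> = t ^ b * sinh y ^ 2" by (simp add: b power_add power2_eq_square)
  finally have "y ^ b * exp y / sinh y ^ 2 \<le> t ^ b * exp (- y)"
    using s by (simp add: divide_le_eq exp_minus field_simps)
  also have "\<dots> \<le> (fact b / (1 / 4) ^ b * exp (1 / 4 * t)) * exp (- y)"
    using t by (intro mult_right_mono power_le_exp) auto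
  also have "\<dots> = C * exp (- y / 2)"
    by (simp add: C_def t_def power_divide mult_exp_exp field_simps)
  finally show "y ^ b * exp y / sinh y ^ 2 \<le> C * exp (- y / 2)" .
qed

definition sector :: "complex set" where
  "sector = {z. \<bar>Im z\<bar> \<le> Re z}"

lemma convex_sector_pos: "convex {u. Re u > 0 \<and> \<bar>Im u\<bar> \<le> Re u}"
proof -
  have "{u. Re u > 0 \<and> \<bar>Im u\<bar> \<le> Re u} = {u. Re u > 0} \<inter> ({u. Im u - Re u \<le> 0} \<inter> {u. - Im u - Re u \<le> 0})"
    by auto
  then show ?thesis
  proof (rule ssubst, intro convex_Int convex_halfspace_Re_gt)
    show "convex {u. Im u - Re u \<le> 0}"
      using convex_halfspace_le[of "Complex (-1) 1" 0] by (simp add: inner_complex_def)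
    show "convex {u. - Im u - Re u \<le> 0}"
      using convex_halfspace_le[of "Complex (-1) (-1)" 0] by (simp add: inner_complex_def minus_le_iff)
  qed
qed

text \<open>The point of working in a sector: bounds in Re u and in norm u become interchangeable up
  to constants.\<close>

lemma norm_le_2_Re:
  assumes "\<bar>Im u\<bar> \<le> Re u"
  shows "norm u \<le> 2 * Re u"
  using cmod_le[of u] assms by linarith

text \<open>The scaling law behind the expansion of \<open>gm1\<close>: rotating the ray of integration of the
  holomorphic function \<open>u\<^sup>a / sinh(2\<pi>\<^sup>2u)\<^sup>2\<close> does not change its integral over \<open>[0, \<infinity>)\<close>.  The rotation
  is carried out with a primitive on the right half plane, and \<open>K\<close> is the difference of its
  limits at \<open>\<infinity>\<close> and \<open>0\<close>.\<close>

lemma sinh_integral_scaling: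
  assumes a: "a \<ge> 2"
  obtains K :: complex and C :: real where "C > 0"
    "\<And>s. Re s > 0 \<Longrightarrow> \<bar>Im s\<bar> \<le> Re s \<Longrightarrow> \<exists>I. ((\<lambda>w::real. of_real w ^ a / sinh (of_real (2 * pi\<^sup>2 * w) * s) ^ 2)
        has_integral I) {0..1/2} \<and> norm (I * s ^ (a + 1) - K) \<le> C * (1 + norm s) * exp (- Re s / 2)"
proof -
  define f :: "complex \<Rightarrow> complex" where "f = (\<lambda>u. u ^ a / sinh (of_real (2 * pi\<^sup>2) * u) ^ 2)"
  define S where "S = {u. Re u > 0 \<and> \<bar>Im u\<bar> \<le> Re u}"
  obtain C where C: "C > 0" "\<And>y::real. y > 0 \<Longrightarrow> y ^ a * exp y / sinh y ^ 2 \<le> C * exp (- y / 2)"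
    using sinh_bound[OF a] by blast
  have pi1: "1 \<le> pi\<^sup>2"
    using pi_ge_two by (simp add: one_le_power)
  have f_bound: "norm (f u) \<le> C * exp (- Re u)" if "u \<in> S" for u
  proof -
    define y where "y = 2 * pi\<^sup>2 * Re u"
    have u: "Re u > 0" "\<bar>Im u\<bar> \<le> Re u" using that by (auto simp: S_def)
    then have y: "y > 0" by (simp add: y_def)
    have "Re u * 1 \<le> Re u * pi\<^sup>2" using u pi1 by (intro mult_left_mono) auto
    then have "2 * Re u \<le> y" by (simp add: y_def mult_ac)
    then have uy: "norm u \<le> y" and uy2: "Re u \<le> y / 2"
      using norm_le_2_Re[OF u(2)] u by simp_all
    have "sinh y \<le> norm (sinh (of_real (2 * pi\<^sup>2) * u))"
      using norm_sinh_ge[of "of_real (2 * pi\<^sup>2) * u"] by (simp add: y_def)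
    then have "norm (f u) \<le> y ^ a / sinh y ^ 2"
      unfolding f_def norm_divide norm_power using y uy by (intro frac_le power_mono) auto
    also have "\<dots> \<le> y ^ a * exp y / sinh y ^ 2"
      using y by (intro divide_right_mono) auto
    also have "\<dots> \<le> C * exp (- y / 2)" by (rule C(2)[OF y])
    also have "\<dots> \<le> C * exp (- Re u)" using C(1) uy2 by simp
    finally show ?thesis .
  qed
  have sinh_nz: "sinh (of_real (2 * pi\<^sup>2) * u) \<noteq> 0" if "Re u > 0" for u
  proof -
    have "0 < sinh (2 * pi\<^sup>2 * Re u)" using that by simp
    also have "\<dots> \<le> norm (sinh (of_real (2 * pi\<^sup>2) * u))"
      using norm_sinh_ge[of "of_real (2 * pi\<^sup>2) * u"] by simp
    finally show ?thesis by auto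
  qed
  have "f holomorphic_on {u. Re u > 0}"
    unfolding f_def sinh_def scaleR_conv_of_real using sinh_nz
    by (intro holomorphic_intros) (auto simp: sinh_def scaleR_conv_of_real)
  then obtain G where G0: "\<And>u. u \<in> {u. Re u > 0} \<Longrightarrow> (G has_field_derivative f u) (at u within {u. Re u > 0})"
    using holomorphic_convex_primitive'[of "{u. Re u > 0}" f] convex_halfspace_Re_gt[of 0] open_halfspace_Re_gt[of 0]
    by auto
  have G: "(G has_field_derivative f u) (at u)" if "Re u > 0" for u
    using G0[of u] that at_within_open[of u "{u. Re u > 0}"] open_halfspace_Re_gt[of 0] by simp
  \<comment> \<open>The part of the sector to the right of the smaller real part is convex and
    contains u and v, so the size of \<open>f\<close> at its left edge bounds the whole
    increment.\<close>
  have lip: "norm (G u - G v) \<le> C * exp (- min (Re u) (Re v)) * norm (u - v)" if "u \<in> S" "v \<in> S" for u v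
  proof -
    define T where "T = S \<inter> {x. Re x \<ge> min (Re u) (Re v)}"
    have "convex T"
      unfolding T_def S_def by (rule convex_Int[OF convex_sector_pos convex_halfspace_Re_ge])
    then show ?thesis
    proof (rule field_differentiable_bound)
      show "(G has_field_derivative f x) (at x within T)" if "x \<in> T" for x
        using that by (intro has_field_derivative_at_within[OF G]) (auto simp: T_def S_def)
      show "norm (f x) \<le> C * exp (- min (Re u) (Re v))" if "x \<in> T" for x
      proof -
        have "norm (f x) \<le> C * exp (- Re x)" using that by (intro f_bound) (auto simp: T_def)
        also have "\<dots> \<le> C * exp (- min (Re u) (Re v))" using that C(1) by (auto simp: T_def)
        finally show ?thesis .
      qed
    qed (use that in \<open>auto simp: T_def\<close>)
  qed
  have lip': "norm (G u - G v) \<le> C * norm (u - v)" if "u \<in> S" "v \<in> S" for u v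
  proof -
    have "exp (- min (Re u) (Re v)) \<le> 1" using that by (auto simp: S_def)
    then have "C * exp (- min (Re u) (Re v)) * norm (u - v) \<le> C * 1 * norm (u - v)"
      using C(1) by (intro mult_mono) auto
    with lip[OF that] show ?thesis by simp
  qed
  have realS: "of_real x \<in> S" if "x > 0" for x :: real using that by (simp add: S_def)
  \<comment> \<open>\<open>G\<close> is given on the open half plane only, so its boundary value at
    0 has to be constructed. The Lipschitz bound makes \<open>G\<close> Cauchy along 1/(n+1) and
    controls the approach from every direction in the sector.\<close>
  obtain g0 where g0: "\<And>u. u \<in> S \<Longrightarrow> norm (G u - g0) \<le> C * norm u"
  proof -
    define e where "e = (\<lambda>n. complex_of_real (inverse (of_nat (Suc n))))"
    have e0: "e \<longlonglongrightarrow> 0"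
      using tendsto_of_real[OF LIMSEQ_inverse_real_of_nat, where 'a = complex] unfolding e_def of_real_0 .
    have eS: "e n \<in> S" for n unfolding e_def by (rule realS) simp
    have "Cauchy (\<lambda>n. G (e n))"
    proof (rule metric_CauchyI)
      fix r :: real assume r: "r > 0"
      have "Cauchy e" using e0 LIMSEQ_imp_Cauchy by blast
      from metric_CauchyD[OF this, of "r / C"] r C(1) obtain M
        where M: "\<And>m n. m \<ge> M \<Longrightarrow> n \<ge> M \<Longrightarrow> dist (e m) (e n) < r / C" by auto
      show "\<exists>M. \<forall>m\<ge>M. \<forall>n\<ge>M. dist (G (e m)) (G (e n)) < r"
      proof (intro exI[of _ M] allI impI)
        fix m n assume "M \<le> m" "M \<le> n"
        from M[OF this] C(1) have "C * norm (e m - e n) < r" by (simp add: dist_norm field_simps)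
        with lip'[OF eS[of m] eS[of n]] show "dist (G (e m)) (G (e n)) < r" by (simp add: dist_norm)
      qed
    qed
    then obtain g0 where g0: "(\<lambda>n. G (e n)) \<longlonglongrightarrow> g0"
      using Cauchy_convergent_iff convergent_def by blast
    have "norm (G u - g0) \<le> C * norm u" if "u \<in> S" for u
    proof (rule LIMSEQ_le)
      show "(\<lambda>n. norm (G u - G (e n))) \<longlonglongrightarrow> norm (G u - g0)"
        by (intro tendsto_intros g0)
      show "(\<lambda>n. C * norm (u - e n)) \<longlonglongrightarrow> C * norm u"
        using tendsto_mult_left[OF tendsto_norm[OF tendsto_diff[OF tendsto_const e0]], of C u] by simp
    qed (use lip'[OF that eS] in auto)
    then show ?thesis by (rule that)
  qed
  have Gexp: "norm (G (of_real y) - G (of_real x)) \<le> C * exp (- x)" if "0 < x" "x \<le> y" for x y :: real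
  proof (cases "x = y")
    case False
    have "norm (G (of_real y) - G (of_real x)) \<le> (- C * exp (- y)) - (- C * exp (- x))"
    proof (rule differentiable_bound_general)
      show "x < y" using False that by simp
      have d: "((\<lambda>t. G (of_real t)) has_vector_derivative f (of_real t)) (at t)" if "t > 0" for t
        using has_vector_derivative_real_field[OF G[of "of_real t"]] that by simp
      show "continuous_on {x..y} (\<lambda>t. G (of_real t))"
      proof (intro continuous_at_imp_continuous_on ballI)
        fix t assume "t \<in> {x..y}"
        then show "isCont (\<lambda>t. G (of_real t)) t"
          using has_vector_derivative_continuous[OF d[of t]] \<open>0 < x\<close> by simp
      qed
      show "((\<lambda>t. G (of_real t)) has_vector_derivative f (of_real t)) (at t)" if "x < t" for t
        using d[of t] that \<open>0 < x\<close> by simp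
      show "((\<lambda>t. - C * exp (- t)) has_vector_derivative C * exp (- t)) (at t)" for t
        by (auto intro!: derivative_eq_intros simp flip: has_real_derivative_iff_has_vector_derivative)
      show "norm (f (of_real t)) \<le> C * exp (- t)" if "x < t" for t
        using f_bound[OF realS[of t]] that \<open>0 < x\<close> by simp
    qed (intro continuous_intros)
    also have "\<dots> \<le> C * exp (- x)" using C(1) by simp
    finally show ?thesis .
  qed (use C in simp)
  \<comment> \<open>The limit at infinity is taken along the integers. A point u of the sector is
    compared first with its real part, which costs the factor norm u, and then with the tail of the
    real axis.\<close>
  obtain g1 where g1: "\<And>u. u \<in> S \<Longrightarrow> norm (G u - g1) \<le> C * (1 + norm u) * exp (- Re u)"
  proof -
    define e where "e = (\<lambda>n. G (of_real (real (Suc n))))"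
    have eb: "norm (e n - e m) \<le> C * exp (- real (Suc m))" if "m \<le> n" for m n
      unfolding e_def by (rule Gexp) (use that in auto)
    have lim: "(\<lambda>n. C * exp (- real (Suc n))) \<longlonglongrightarrow> 0"
      by (intro tendsto_mult_right_zero filterlim_compose[OF exp_at_bot] LIMSEQ_Suc)
         (simp add: filterlim_uminus_at_bot filterlim_real_sequentially)
    have "Cauchy e"
    proof (rule metric_CauchyI)
      fix r :: real assume "r > 0"
      then obtain M where M: "\<And>n. n \<ge> M \<Longrightarrow> C * exp (- real (Suc n)) < r"
        using order_tendstoD(2)[OF lim, of r] unfolding eventually_sequentially by blast
      have "dist (e m) (e n) < r" if "m \<ge> M" "n \<ge> M" for m n
      proof (cases "m \<le> n")
        case True
        then show ?thesis using eb[of m n] M[of m] that by (simp add: dist_norm norm_minus_commute)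
      next
        case False
        then show ?thesis using eb[of n m] M[of n] that by (simp add: dist_norm)
      qed
      then show "\<exists>M. \<forall>m\<ge>M. \<forall>n\<ge>M. dist (e m) (e n) < r" by blast
    qed
    then obtain g1 where g1: "e \<longlonglongrightarrow> g1"
      using Cauchy_convergent_iff convergent_def by blast
    have "norm (G u - g1) \<le> C * (1 + norm u) * exp (- Re u)" if "u \<in> S" for u
    proof -
      have u: "Re u > 0" using that by (simp add: S_def)
      have "norm (g1 - G (of_real (Re u))) \<le> C * exp (- Re u)"
      proof (rule LIMSEQ_le_const2)
        show "(\<lambda>n. norm (e n - G (of_real (Re u)))) \<longlonglongrightarrow> norm (g1 - G (of_real (Re u)))"
          by (intro tendsto_intros g1)
        obtain N where "real N \<ge> Re u" using real_arch_simple by blast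
        then have "norm (e n - G (of_real (Re u))) \<le> C * exp (- Re u)" if "n \<ge> N" for n
          unfolding e_def using u that by (intro Gexp) auto
        then show "\<exists>N. \<forall>n\<ge>N. norm (e n - G (of_real (Re u))) \<le> C * exp (- Re u)" by blast
      qed
      moreover have "norm (G u - G (of_real (Re u))) \<le> C * exp (- Re u) * norm u"
      proof -
        have "u - of_real (Re u) = \<i> * of_real (Im u)" by (simp add: complex_eq_iff)
        then have "norm (u - of_real (Re u)) \<le> norm u"
          using abs_Im_le_cmod[of u] by (simp add: norm_mult)
        then have "C * exp (- Re u) * norm (u - of_real (Re u)) \<le> C * exp (- Re u) * norm u"
          using C(1) by (intro mult_left_mono) auto
        then show ?thesis
          using lip[OF that realS[OF u]] by simp
      qed
      moreover have "G u - g1 = (G u - G (of_real (Re u))) - (g1 - G (of_real (Re u)))" by simp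
      ultimately have "norm (G u - g1) \<le> C * exp (- Re u) * norm u + C * exp (- Re u)"
        by (smt (verit) norm_triangle_ineq4)
      then show ?thesis by (simp add: algebra_simps)
    qed
    then show ?thesis by (rule that)
  qed
  have "\<exists>I. ((\<lambda>w::real. of_real w ^ a / sinh (of_real (2 * pi\<^sup>2 * w) * s) ^ 2) has_integral I) {0..1/2} \<and>
      norm (I * s ^ (a + 1) - (g1 - g0)) \<le> C * (1 + norm s) * exp (- Re s / 2)"
    if s: "Re s > 0" "\<bar>Im s\<bar> \<le> Re s" for s
  proof -
    have s0: "s \<noteq> 0" using s by auto
    \<comment> \<open>\<open>H\<close> continues the primitive along the ray to w = 0, so that the
      fundamental theorem applies on the closed interval.\<close>
    define H where "H = (\<lambda>w::real. if w \<le> 0 then g0 else G (of_real w * s))"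
    have inS: "of_real w * s \<in> S" if "w > 0" for w
      using s that by (auto simp: S_def abs_mult)
    have Gd: "((\<lambda>w. G (of_real w * s)) has_vector_derivative s * f (of_real w * s)) (at w)" if "w > 0" for w
    proof -
      have "((\<lambda>w. of_real w * s) has_vector_derivative s) (at w)"
        by (auto intro!: derivative_eq_intros simp: has_vector_derivative_def scaleR_conv_of_real)
      moreover have "Re (of_real w * s) > 0" using that s by simp
      ultimately show ?thesis
        using field_vector_diff_chain_at[of "\<lambda>w. of_real w * s" s w G "f (of_real w * s)"] G
        by (simp add: o_def)
    qed
    have "((\<lambda>w. s * f (of_real w * s)) has_integral (H (1/2) - H 0)) {0..1/2}"
    proof (rule fundamental_theorem_of_calculus_interior)
      show "(H has_vector_derivative s * f (of_real w * s)) (at w)" if "w \<in> {0<..<1/2}" for w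
      proof (rule has_vector_derivative_transform_within_open[OF Gd])
        show "w \<in> {0<..}" "open {0::real<..}" "w > 0" using that by auto
      qed (auto simp: H_def)
      show "continuous_on {0..1/2} H"
        unfolding continuous_on_eq_continuous_within
      proof
        fix w :: real assume w: "w \<in> {0..1/2}"
        show "continuous (at w within {0..1/2}) H"
        proof (cases "w = 0")
          case True
          have "((\<lambda>x. H x) \<longlongrightarrow> g0) (at 0 within {0..1/2})"
          proof (rule Lim_null[THEN iffD2], rule Lim_null_comparison)
            show "eventually (\<lambda>x. norm (H x - g0) \<le> C * norm (of_real x * s)) (at 0 within {0..1/2})"
              unfolding eventually_at_filter using g0[OF inS] C(1)
              by (auto simp: H_def)
            show "((\<lambda>x. C * norm (of_real x * s)) \<longlongrightarrow> 0) (at 0 within {0..1/2})"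
              by (rule tendsto_eq_intros refl | simp)+
          qed
          then show ?thesis using True by (simp add: continuous_within H_def)
        next
          case False
          with w have "w > 0" by simp
          have "isCont (\<lambda>w. G (of_real w * s)) w"
            using Gd[OF \<open>w > 0\<close>] by (rule has_vector_derivative_continuous)
          moreover have "eventually (\<lambda>x. G (of_real x * s) = H x) (at w)"
            using eventually_at_in_open'[of "{0<..}" w] \<open>w > 0\<close>
            by (auto elim!: eventually_mono simp: H_def)
          moreover have "H w = G (of_real w * s)" using \<open>w > 0\<close> by (simp add: H_def)
          ultimately have "(H \<longlongrightarrow> H w) (at w)"
            using Lim_transform_eventually[of "\<lambda>w. G (of_real w * s)" "H w" "at w" H]
            unfolding continuous_at by simp
          then show ?thesis
            unfolding continuous_within by (rule tendsto_within_subset) simp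
        qed
      qed
    qed simp
    then have "((\<lambda>w. inverse (s ^ (a + 1)) * (s * f (of_real w * s))) has_integral
        inverse (s ^ (a + 1)) * (G (of_real (1/2) * s) - g0)) {0..1/2}"
      by (intro has_integral_mult_right) (simp add: H_def)
    moreover have "inverse (s ^ (a + 1)) * (s * f (of_real w * s)) = of_real w ^ a / sinh (of_real (2 * pi\<^sup>2 * w) * s) ^ 2" for w
      using s0 by (simp add: f_def power_mult_distrib field_simps)
    ultimately have I: "((\<lambda>w::real. of_real w ^ a / sinh (of_real (2 * pi\<^sup>2 * w) * s) ^ 2) has_integral
        inverse (s ^ (a + 1)) * (G (of_real (1/2) * s) - g0)) {0..1/2}"
      by simp
    \<comment> \<open>Up to the scaling factor the integral over [0, 1/2] is G(s/2) - g0, so its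
      distance from K = g1 - g0 is the exponentially small tail G(s/2) - g1.\<close>
    have "inverse (s ^ (a + 1)) * (G (of_real (1/2) * s) - g0) * s ^ (a + 1) - (g1 - g0) = G (of_real (1/2) * s) - g1"
      using s0 by (simp add: field_simps)
    also have "norm \<dots> \<le> C * (1 + norm (of_real (1/2) * s)) * exp (- Re (of_real (1/2) * s))"
      by (rule g1[OF inS]) simp
    also have "\<dots> \<le> C * (1 + norm s) * exp (- Re s / 2)"
      using C(1) by (intro mult_mono) (auto simp: norm_mult)
    finally show ?thesis using I by blast
  qed
  then show ?thesis using that C(1) by blast
qed

section \<open>Polynomial approximation of \<open>gm1\<close> in the sector\<close>

lemma sin_squared_mult_cos_Taylor:
  fixes m :: int
  obtains p :: "nat \<Rightarrow> real" and A :: real where "p 0 = 0" "p 1 = 0" "A \<ge> 0"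
    "\<And>w. w \<ge> 0 \<Longrightarrow> \<bar>sin (pi * w) ^ 2 * cos (2 * pi * of_int m * w) - (\<Sum>i<M. p i * w ^ i)\<bar> \<le> A * w ^ M"
proof
  \<comment> \<open>Product-to-sum: the function is a combination of three cosines with frequencies
    m, m + 1 and m - 1, each with the Lagrange remainder of its Maclaurin series.\<close>
  define b c :: "nat \<Rightarrow> real" where "b = (!) [2 * pi * of_int m, 2 * pi * of_int (m + 1), 2 * pi * of_int (m - 1)]"
    and "c = (!) [1 / 2, - 1 / 4, - 1 / 4]"
  define p where "p = (\<lambda>i. \<Sum>j<3. c j * (cos_coeff i * b j ^ i))"
  define A where "A = (\<Sum>j<3. \<bar>c j\<bar> * (\<bar>b j\<bar> ^ M / fact M))"
  \<comment> \<open>The expansion thus starts at w^2, which compensates the double zero of sinh^2 in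
    the later integrals.\<close>
  show "p 0 = 0" "p 1 = 0"
    by (simp_all add: p_def c_def b_def eval_nat_numeral cos_coeff_def)
  show "A \<ge> 0" unfolding A_def by (intro sum_nonneg) auto
  fix w :: real assume w: "w \<ge> 0"
  have trig: "sin (pi * w) ^ 2 * cos (2 * pi * of_int m * w) = (\<Sum>j<3. c j * cos (b j * w))"
  proof -
    have 1: "sin (pi * w) ^ 2 = (1 - cos (2 * pi * w)) / 2"
      using cos_double_sin[of "pi * w"] by (simp add: mult_ac)
    have 2: "cos (2 * pi * of_int (m + 1) * w) = cos (2 * pi * of_int m * w + 2 * pi * w)"
      "cos (2 * pi * of_int (m - 1) * w) = cos (2 * pi * of_int m * w - 2 * pi * w)"
      by (simp_all add: algebra_simps)
    have "(\<Sum>j<3. c j * cos (b j * w)) = 1 / 2 * cos (2 * pi * of_int m * w)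
        - 1 / 4 * cos (2 * pi * of_int (m + 1) * w) - 1 / 4 * cos (2 * pi * of_int (m - 1) * w)"
      by (simp add: c_def b_def eval_nat_numeral)
    also have "\<dots> = sin (pi * w) ^ 2 * cos (2 * pi * of_int m * w)"
      unfolding 1 2 cos_add cos_diff by (simp add: field_simps)
    finally show ?thesis by simp
  qed
  have rem: "\<bar>cos (b j * w) - (\<Sum>i<M. cos_coeff i * (b j * w) ^ i)\<bar> \<le> \<bar>b j\<bar> ^ M / fact M * w ^ M" for j
  proof -
    obtain t where "cos (b j * w) = (\<Sum>i<M. cos_coeff i * (b j * w) ^ i) +
        (cos (t + 1 / 2 * real M * pi) / fact M) * (b j * w) ^ M"
      using Maclaurin_cos_expansion[of "b j * w" M] by blast
    then have "\<bar>cos (b j * w) - (\<Sum>i<M. cos_coeff i * (b j * w) ^ i)\<bar> =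
        \<bar>cos (t + 1 / 2 * real M * pi)\<bar> * (\<bar>b j\<bar> ^ M / fact M * w ^ M)"
      using w by (simp add: abs_mult power_abs power_mult_distrib)
    also have "\<dots> \<le> 1 * (\<bar>b j\<bar> ^ M / fact M * w ^ M)"
      using w by (intro mult_right_mono) auto
    finally show ?thesis by simp
  qed
  have "(\<Sum>i<M. p i * w ^ i) = (\<Sum>i<M. \<Sum>j<3. c j * (cos_coeff i * (b j * w) ^ i))"
    unfolding p_def sum_distrib_right by (simp add: power_mult_distrib mult_ac)
  also have "\<dots> = (\<Sum>j<3. c j * (\<Sum>i<M. cos_coeff i * (b j * w) ^ i))"
    unfolding sum_distrib_left by (rule sum.swap)
  finally have "sin (pi * w) ^ 2 * cos (2 * pi * of_int m * w) - (\<Sum>i<M. p i * w ^ i) =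
      (\<Sum>j<3. c j * (cos (b j * w) - (\<Sum>i<M. cos_coeff i * (b j * w) ^ i)))"
    unfolding trig by (simp add: sum_subtractf right_diff_distrib)
  also have "\<bar>\<dots>\<bar> \<le> (\<Sum>j<3. \<bar>c j\<bar> * (\<bar>b j\<bar> ^ M / fact M * w ^ M))"
  proof (rule order_trans[OF sum_abs], rule sum_mono)
    fix j
    show "\<bar>c j * (cos (b j * w) - (\<Sum>i<M. cos_coeff i * (b j * w) ^ i))\<bar> \<le> \<bar>c j\<bar> * (\<bar>b j\<bar> ^ M / fact M * w ^ M)"
      unfolding abs_mult by (intro mult_left_mono rem) simp
  qed
  also have "\<dots> = A * w ^ M" unfolding A_def sum_distrib_right by (simp add: mult_ac)
  finally show "\<bar>sin (pi * w) ^ 2 * cos (2 * pi * of_int m * w) - (\<Sum>i<M. p i * w ^ i)\<bar> \<le> A * w ^ M" .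
qed

lemma integrable_on_continuous_quotient:
  fixes f g :: "real \<Rightarrow> complex"
  assumes "continuous_on UNIV f" "continuous_on UNIV g"
    and "\<And>x. x \<in> {a..b} \<Longrightarrow> norm (f x / g x) \<le> B"
  shows "(\<lambda>x. f x / g x) integrable_on {a..b}"
proof (rule measurable_bounded_by_integrable_imp_integrable)
  have "(\<lambda>x. f x / g x) \<in> borel_measurable borel"
    by (intro borel_measurable_divide borel_measurable_continuous_onI assms)
  then have "(\<lambda>x. f x / g x) \<in> borel_measurable lebesgue"
    by (intro measurable_completion) simp
  then show "(\<lambda>x. f x / g x) \<in> borel_measurable (lebesgue_on {a..b})"
    by (rule measurable_restrict_space1)
  show "(\<lambda>_. B) integrable_on {a..b}" by (rule integrable_const_ivl)
qed (use assms(3) in auto)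

lemma sector_inverse:
  assumes "z \<in> sector" "z \<noteq> 0"
  shows "Re (1 / z) > 0" "\<bar>Im (1 / z)\<bar> \<le> Re (1 / z)" "norm (1 / z) \<le> 2 * Re (1 / z)"
proof -
  have "Re z > 0" using assms by (auto simp: sector_def complex_eq_iff)
  then show 1: "Re (1 / z) > 0" "\<bar>Im (1 / z)\<bar> \<le> Re (1 / z)"
    using assms by (auto simp: Re_divide Im_divide sector_def sum_power2_gt_zero_iff divide_right_mono)
  then show "norm (1 / z) \<le> 2 * Re (1 / z)" by (intro norm_le_2_Re)
qed

definition sh :: "complex \<Rightarrow> real \<Rightarrow> complex" where "sh s w = sinh (of_real (2 * pi\<^sup>2 * w) * s)"

lemma norm_sh_ge: "sinh (2 * pi\<^sup>2 * w * Re s) \<le> norm (sh s w)"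
  using norm_sinh_ge[of "of_real (2 * pi\<^sup>2 * w) * s"] by (simp add: sh_def)

lemma norm_exp_le_of_le_half:
  assumes s: "Re s > 0" and "0 \<le> w" "w \<le> 1 / 2"
  shows "norm (exp (of_real (4 * pi\<^sup>2 * w\<^sup>2) * s)) \<le> exp (2 * pi\<^sup>2 * w * Re s)"
proof -
  have "w * w \<le> w * (1 / 2)" using assms(2,3) by (intro mult_left_mono) auto
  then have "4 * w\<^sup>2 \<le> 2 * w" by (simp add: power2_eq_square)
  then have "pi\<^sup>2 * Re s * (4 * w\<^sup>2) \<le> pi\<^sup>2 * Re s * (2 * w)"
    using s by (intro mult_left_mono) auto
  then show ?thesis by (simp add: norm_exp mult_ac)
qed

text \<open>The exponential factor \<open>exp(4\<pi>\<^sup>2w\<^sup>2/z)\<close> is dominated by \<open>sinh(2\<pi>\<^sup>2w/z)\<close> on \<open>[0, 1/2]\<close>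
  because \<open>2w\<^sup>2 \<le> w\<close> there.\<close>

lemma power_exp_sinh_le:
  assumes b: "b \<ge> 2"
  obtains C :: real where "C > 0"
    "\<And>s w. Re s > 0 \<Longrightarrow> w \<ge> 0 \<Longrightarrow>
       w ^ b * exp (2 * pi\<^sup>2 * w * Re s) / norm (sh s w) ^ 2 \<le> C / Re s ^ b * exp (- Re s * w)"
proof -
  obtain C :: real where C: "C > 0" "\<And>y. y > 0 \<Longrightarrow> y ^ b * exp y / sinh y ^ 2 \<le> C * exp (- y / 2)"
    using sinh_bound[OF b] by blast
  show ?thesis
  proof (rule that[OF C(1)])
    fix s :: complex and w :: real assume s: "Re s > 0" and w: "w \<ge> 0"
    show "w ^ b * exp (2 * pi\<^sup>2 * w * Re s) / norm (sh s w) ^ 2 \<le> C / Re s ^ b * exp (- Re s * w)"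
    proof (cases "w = 0")
      case True
      then show ?thesis using b s C(1) by (simp add: zero_power)
    next
      case False
      define y where "y = 2 * pi\<^sup>2 * w * Re s"
      have y: "y > 0" using False w s by (simp add: y_def)
      have pi1: "1 \<le> pi\<^sup>2" using pi_ge_two by (simp add: one_le_power)
      have "w * Re s * 1 \<le> w * Re s * pi\<^sup>2" using w s pi1 by (intro mult_left_mono) auto
      then have yw: "w * Re s \<le> y / 2" by (simp add: y_def mult_ac)
      have wy: "w \<le> y / Re s" using yw y s by (simp add: field_simps)
      have "w ^ b * exp y / norm (sh s w) ^ 2 \<le> (y / Re s) ^ b * exp y / sinh y ^ 2"
        using norm_sh_ge[of w s] wy w y s unfolding y_def[symmetric]
        by (intro frac_le mult_right_mono power_mono) auto
      also have "\<dots> = (y ^ b * exp y / sinh y ^ 2) / Re s ^ b"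
        by (simp add: power_divide)
      also have "\<dots> \<le> (C * exp (- y / 2)) / Re s ^ b"
        using C(2)[OF y] s by (intro divide_right_mono) auto
      also have "\<dots> \<le> (C * exp (- Re s * w)) / Re s ^ b"
        using yw C(1) s by (intro divide_right_mono mult_left_mono) (auto simp: mult_ac)
      finally show ?thesis by (simp add: y_def)
    qed
  qed
qed

lemma has_integral_exp_minus:
  fixes r :: real
  assumes "r > 0"
  shows "((\<lambda>w. exp (- r * w)) has_integral (1 - exp (- r / 2)) / r) {0..1/2}"
proof -
  have "((\<lambda>w. exp (- r * w)) has_integral (- exp (- r * (1/2)) / r) - (- exp (- r * 0) / r)) {0..1/2}"
    using assms by (intro fundamental_theorem_of_calculus)
      (auto intro!: derivative_eq_intros simp flip: has_real_derivative_iff_has_vector_derivative)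
  then show ?thesis by (simp add: diff_divide_distrib)
qed

text \<open>In the sector Re (1/z) is at least half of norm (1/z), so the exponential beats every
  power of norm z; one extra power pays for the factor 1 + norm (1/z).\<close>

lemma one_plus_exp_minus_le:
  assumes "z \<in> sector" "z \<noteq> 0" "norm z \<le> 1"
  shows "(1 + norm (1 / z)) * exp (- Re (1 / z) / 2) \<le> 2 * fact (n + 1) * 4 ^ (n + 1) * norm z ^ n"
proof -
  define x where "x = norm (1 / z)"
  have x: "x \<ge> 1" using assms by (simp add: x_def norm_divide divide_simps)
  have "exp (- Re (1 / z) / 2) \<le> exp (- x / 4)"
    using sector_inverse(3)[OF assms(1,2)] by (simp add: x_def)
  then have "(1 + x) * exp (- Re (1 / z) / 2) \<le> (2 * x) * exp (- x / 4)"
    using x by (intro mult_mono) auto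
  also have "\<dots> = 2 * x ^ (n + 1) * exp (- x / 4) / x ^ n" using x by simp
  also have "\<dots> \<le> 2 * (fact (n + 1) / (1 / 4) ^ (n + 1) * exp (1 / 4 * x)) * exp (- x / 4) / x ^ n"
    using x by (intro divide_right_mono mult_right_mono mult_left_mono power_le_exp) auto
  also have "\<dots> = 2 * fact (n + 1) * 4 ^ (n + 1) * (exp (1 / 4 * x) * exp (- x / 4)) / x ^ n"
    by (simp add: power_divide)
  also have "exp (1 / 4 * x) * exp (- x / 4) = 1" by (simp flip: exp_add)
  also have "2 * fact (n + 1) * 4 ^ (n + 1) * 1 / x ^ n = 2 * fact (n + 1) * 4 ^ (n + 1) * norm z ^ n"
    using assms by (simp add: x_def norm_divide power_divide)
  finally show ?thesis by (simp add: x_def)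
qed

definition gm1_integrand :: "int \<Rightarrow> complex \<Rightarrow> real \<Rightarrow> complex" where
  "gm1_integrand m s w = of_real (sin (pi * w) ^ 2 * cos (2 * pi * of_int m * w)) *
     exp (of_real (4 * pi\<^sup>2 * w\<^sup>2) * s) / sh s w ^ 2"

lemma gm1_conv_integrand:
  "gm1 m z = 8 * of_real pi ^ 2 * (1 / z) ^ 2 * integral {0..1/2} (gm1_integrand m (1 / z))"
proof -
  have "of_real (sin (pi * w)) ^ 2 / sinh (of_real (2 * pi\<^sup>2 * w) / z) ^ 2 *
    exp (of_real (4 * pi\<^sup>2 * w\<^sup>2) / z) * of_real (cos (2 * pi * of_int m * w)) = gm1_integrand m (1 / z) w" for w
    by (simp add: gm1_integrand_def sh_def)
  then show ?thesis
    by (simp add: gm1_def power_divide)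
qed

text \<open>The inequality sin(pi w)^2 <= (pi w)^2 supplies exactly the power w^2 at which
  \<open>power_exp_sinh_le\<close> begins to apply. The bound is uniform in w, and its order 1/(Re
  s)^2 balances the prefactor s^2 of \<open>gm1\<close>.\<close>

lemma gm1_integrand_bound:
  obtains C :: real where "C > 0"
    "\<And>m s w. Re s > 0 \<Longrightarrow> w \<in> {0..1/2} \<Longrightarrow> norm (gm1_integrand m s w) \<le> C / Re s ^ 2"
proof -
  obtain C0 :: real where C0: "C0 > 0" "\<And>s w. Re s > 0 \<Longrightarrow> w \<ge> 0 \<Longrightarrow>
       w ^ 2 * exp (2 * pi\<^sup>2 * w * Re s) / norm (sh s w) ^ 2 \<le> C0 / Re s ^ 2 * exp (- Re s * w)"
    using power_exp_sinh_le[of 2] by auto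
  show ?thesis
  proof (rule that[of "pi\<^sup>2 * C0"])
    show "pi\<^sup>2 * C0 > 0" using C0(1) by simp
    fix m :: int and s :: complex and w :: real
    assume s: "Re s > 0" and w: "w \<in> {0..1/2}"
    have "\<bar>sin (pi * w)\<bar>\<^sup>2 \<le> (pi * w)\<^sup>2"
      using abs_sin_x_le_abs_x[of "pi * w"] w by (intro power_mono) auto
    then have "\<bar>sin (pi * w)\<bar>\<^sup>2 * \<bar>cos (2 * pi * of_int m * w)\<bar> \<le> (pi * w)\<^sup>2 * 1"
      by (intro mult_mono) auto
    then have "\<bar>sin (pi * w) ^ 2 * cos (2 * pi * of_int m * w)\<bar> \<le> pi\<^sup>2 * w\<^sup>2"
      by (simp add: abs_mult power_mult_distrib)
    then have "norm (gm1_integrand m s w) \<le> (pi\<^sup>2 * w\<^sup>2) * exp (2 * pi\<^sup>2 * w * Re s) / norm (sh s w) ^ 2"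
      unfolding gm1_integrand_def norm_divide norm_mult[of _ "exp _"] norm_power norm_of_real
      using norm_exp_le_of_le_half[OF s, of w] w by (intro divide_right_mono mult_mono) auto
    also have "\<dots> = pi\<^sup>2 * (w\<^sup>2 * exp (2 * pi\<^sup>2 * w * Re s) / norm (sh s w) ^ 2)" by simp
    also have "\<dots> \<le> pi\<^sup>2 * (C0 / Re s ^ 2 * exp (- Re s * w))"
      using C0(2)[OF s, of w] w by (intro mult_left_mono) auto
    also have "\<dots> \<le> pi\<^sup>2 * (C0 / Re s ^ 2 * 1)"
      using C0(1) s w by (intro mult_left_mono) auto
    finally show "norm (gm1_integrand m s w) \<le> pi\<^sup>2 * C0 / Re s ^ 2" by simp
  qed
qed

lemma gm1_integrand_integrable:
  assumes "Re s > 0"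
  shows "gm1_integrand m s integrable_on {0..1/2}"
proof -
  obtain C :: real where "C > 0" and
    C: "\<And>m s w. Re s > 0 \<Longrightarrow> w \<in> {0..1/2} \<Longrightarrow> norm (gm1_integrand m s w) \<le> C / Re s ^ 2"
    by (rule gm1_integrand_bound) (rule that)
  have "norm (gm1_integrand m s w) \<le> C / Re s ^ 2" if "w \<in> {0..1/2}" for w
    by (rule C[OF assms that])
  moreover have "continuous_on UNIV (\<lambda>w. of_real (sin (pi * w) ^ 2 * cos (2 * pi * of_int m * w)) *
     exp (of_real (4 * pi\<^sup>2 * w\<^sup>2) * s))"
    by (intro continuous_intros)
  moreover have "continuous_on UNIV (\<lambda>w. sh s w ^ 2)"
    unfolding sh_def sinh_def by (intro continuous_intros)
  ultimately show ?thesis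
    unfolding gm1_integrand_def by (intro integrable_on_continuous_quotient)
qed

text \<open>The trigonometric factor is expanded in powers of w and the Gaussian in powers of w^2 s,
  where s = 1/z. A term w^(i+2) (w^2 s)^j integrates to a constant times s^(j - (i+2j+3)) up to an
  exponentially small error, and the prefactor s^2 turns this into z^(i+j+1). Hence there is no
  constant term.\<close>

lemma gm1_poly_approx:
  obtains P :: "complex poly" and C :: real where "poly P 0 = 0"
    "\<And>z. z \<in> sector \<Longrightarrow> z \<noteq> 0 \<Longrightarrow> norm z \<le> 1 \<Longrightarrow> norm (gm1 m z - poly P z) \<le> C * norm z ^ (N + 1)"
proof -
  define \<phi> where "\<phi> = (\<lambda>w::real. sin (pi * w) ^ 2 * cos (2 * pi * of_int m * w))"
  obtain p :: "nat \<Rightarrow> real" and A where p: "p 0 = 0" "p 1 = 0" and A: "A \<ge> 0"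
    "\<And>w. w \<ge> 0 \<Longrightarrow> \<bar>\<phi> w - (\<Sum>i<N+3. p i * w ^ i)\<bar> \<le> A * w ^ (N + 3)"
    using sin_squared_mult_cos_Taylor[of m "N + 3"] unfolding \<phi>_def by blast
  define Q where "Q = (\<lambda>a K C. C > 0 \<and> (\<forall>s. Re s > 0 \<longrightarrow> \<bar>Im s\<bar> \<le> Re s \<longrightarrow> (\<exists>I. ((\<lambda>w::real. of_real w ^ (a + 2) / sh s w ^ 2)
        has_integral I) {0..1/2} \<and> norm (I * s ^ (a + 3) - K) \<le> C * (1 + norm s) * exp (- Re s / 2))))"
  have "\<exists>K C. Q a K C" for a
  proof -
    have "2 \<le> a + 2" by simp
    then obtain K :: complex and C :: real where "C > 0"
      and "\<And>s. Re s > 0 \<Longrightarrow> \<bar>Im s\<bar> \<le> Re s \<Longrightarrow> \<exists>I. ((\<lambda>w::real. of_real w ^ (a + 2) / sinh (of_real (2 * pi\<^sup>2 * w) * s) ^ 2)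
        has_integral I) {0..1/2} \<and> norm (I * s ^ (a + 2 + 1) - K) \<le> C * (1 + norm s) * exp (- Re s / 2)"
      by (rule sinh_integral_scaling) blast
    then show ?thesis
      unfolding sh_def Q_def by (intro exI[of _ K] exI[of _ C]) (simp add: numeral_3_eq_3)
  qed
  then obtain K where "\<forall>a. \<exists>C. Q a (K a) C" by (metis choice)
  then obtain CK where Q: "\<And>a. Q a (K a) (CK a)" by (metis choice)
  have CK: "\<And>a. CK a > 0" using Q by (simp add: Q_def)
  have K: "\<exists>I. ((\<lambda>w::real. of_real w ^ (a + 2) / sh s w ^ 2) has_integral I) {0..1/2} \<and>
      norm (I * s ^ (a + 3) - K a) \<le> CK a * (1 + norm s) * exp (- Re s / 2)"
    if "Re s > 0" "\<bar>Im s\<bar> \<le> Re s" for a s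
    using Q[of a] that unfolding Q_def by blast
  \<comment> \<open>The exponents N + 3 and 2N + 4 belong to the two remainders: w^(N+3) from the
    trigonometric Taylor polynomial, and w^2 w^(2N+2) from that polynomial times the exponential
    remainder. The latter carries (Re s)^(N+1), so both end at (Re s)^(-N-3).\<close>
  obtain C1 :: real where C1: "C1 > 0" "\<And>s w. Re s > 0 \<Longrightarrow> w \<ge> 0 \<Longrightarrow>
       w ^ (N + 3) * exp (2 * pi\<^sup>2 * w * Re s) / norm (sh s w) ^ 2 \<le> C1 / Re s ^ (N + 3) * exp (- Re s * w)"
    using power_exp_sinh_le[of "N + 3"] by auto
  obtain C2 :: real where C2: "C2 > 0" "\<And>s w. Re s > 0 \<Longrightarrow> w \<ge> 0 \<Longrightarrow>
       w ^ (2 * N + 4) * exp (2 * pi\<^sup>2 * w * Re s) / norm (sh s w) ^ 2 \<le> C2 / Re s ^ (2 * N + 4) * exp (- Re s * w)"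
    using power_exp_sinh_le[of "2 * N + 4"] by auto
  define B where "B = (\<Sum>i<N+1. \<bar>p (i + 2)\<bar>)"
  have B: "B \<ge> 0" unfolding B_def by (intro sum_nonneg) auto
  define D where "D = A * C1 + B * (8 * pi\<^sup>2) ^ (N + 1) * C2"
  have D: "D \<ge> 0" using A B C1 C2 by (simp add: D_def)
  define c where "c = (\<lambda>i j. p (i + 2) * (4 * pi\<^sup>2) ^ j / fact j)"
  define P :: "complex poly" where
    "P = (\<Sum>i<N+1. \<Sum>j\<le>N. monom (of_real (8 * pi\<^sup>2 * c i j) * K (i + 2 * j)) (i + j + 1))"
  define C where "C = 32 * pi\<^sup>2 * D * 2 ^ (N + 2) +
    (\<Sum>i<N+1. \<Sum>j\<le>N. 8 * pi\<^sup>2 * \<bar>c i j\<bar> * CK (i + 2 * j)) * (2 * fact (N + 2) * 4 ^ (N + 2))"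
  have sumS: "(\<Sum>i<N+3. p i * w ^ i) = (\<Sum>i<N+1. p (i + 2) * w ^ (i + 2))" for w
    using p by (simp add: sum.lessThan_Suc_shift numeral_3_eq_3 del: sum.lessThan_Suc)
  show ?thesis
  proof (rule that)
    show "poly P 0 = 0" by (simp add: P_def poly_sum poly_monom)
    fix z assume z: "z \<in> sector" "z \<noteq> 0" "norm z \<le> 1"
    define s where "s = 1 / z"
    define R where "R = Re s"
    have s: "Re s > 0" "\<bar>Im s\<bar> \<le> Re s" "norm s \<le> 2 * R" and R: "R > 0"
      using sector_inverse[OF z(1,2)] by (simp_all add: s_def R_def)
    define e where "e = (\<lambda>w::real. exp (of_real (4 * pi\<^sup>2 * w\<^sup>2) * s))"
    define F where "F = gm1_integrand m s"
    define S where "S = (\<lambda>w. \<Sum>i<N+1. p (i + 2) * w ^ (i + 2))"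
    define E where "E = (\<lambda>w. \<Sum>j\<le>N. (of_real (4 * pi\<^sup>2 * w\<^sup>2) * s) ^ j / fact j)"
    define T where "T = (\<lambda>w::real. \<Sum>i<N+1. \<Sum>j\<le>N. of_real (c i j) * s ^ j * (of_real w ^ (i + 2 * j + 2) / sh s w ^ 2))"
    have ebound: "norm (e w) \<le> exp (2 * pi\<^sup>2 * w * R)" if "w \<in> {0..1/2}" for w
      using norm_exp_le_of_le_half[OF s(1), of w] that by (simp add: e_def R_def)
    have gm1_eq: "gm1 m z = 8 * of_real pi ^ 2 * s ^ 2 * integral {0..1/2} F"
      unfolding F_def s_def by (rule gm1_conv_integrand)
    have Fint: "F integrable_on {0..1/2}"
      unfolding F_def by (rule gm1_integrand_integrable[OF s(1)])
    have F_eq: "F w = of_real (\<phi> w) * e w / sh s w ^ 2" for w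
      by (simp add: F_def gm1_integrand_def \<phi>_def e_def)
    have "\<forall>a. \<exists>I. ((\<lambda>w::real. of_real w ^ (a + 2) / sh s w ^ 2) has_integral I) {0..1/2} \<and>
        norm (I * s ^ (a + 3) - K a) \<le> CK a * (1 + norm s) * exp (- Re s / 2)"
      using K[OF s(1,2)] by blast
    from choice[OF this]
    obtain I where I: "\<And>a. ((\<lambda>w::real. of_real w ^ (a + 2) / sh s w ^ 2) has_integral I a) {0..1/2}"
        "\<And>a. norm (I a * s ^ (a + 3) - K a) \<le> CK a * (1 + norm s) * exp (- Re s / 2)"
      by blast
    have Tint: "(T has_integral (\<Sum>i<N+1. \<Sum>j\<le>N. of_real (c i j) * s ^ j * I (i + 2 * j))) {0..1/2}"
      unfolding T_def by (intro has_integral_sum has_integral_mult_right I) auto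
    have T_eq: "T w = of_real (S w) * E w / sh s w ^ 2" for w
    proof -
      have "of_real (S w) * E w = (\<Sum>i<N+1. \<Sum>j\<le>N. of_real (c i j) * s ^ j * of_real w ^ (i + 2 * j + 2))"
        unfolding S_def E_def of_real_sum sum_product
      proof (intro sum.cong refl)
        fix i j
        have "(x\<^sup>2) ^ n = (x ^ n)\<^sup>2" for x :: complex and n
          by (simp only: power_mult[symmetric] mult.commute)
        then show "of_real (p (i + 2) * w ^ (i + 2)) * ((of_real (4 * pi\<^sup>2 * w\<^sup>2) * s) ^ j / fact j) =
            of_real (c i j) * s ^ j * of_real w ^ (i + 2 * j + 2)"
          by (simp add: c_def power_mult_distrib power_add power_mult mult_ac)
      qed
      then show ?thesis by (simp only: T_def sum_divide_distrib times_divide_eq_right)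
    qed
    have diff: "norm (F w - T w) \<le> D / R ^ (N + 3) * exp (- R * w)" if w: "w \<in> {0..1/2}" for w
    proof -
      define Y where "Y = exp (2 * pi\<^sup>2 * w * R)"
      have Y: "Y > 0" by (simp add: Y_def)
      have w0: "w \<ge> 0" "w \<le> 1" using w by auto
      have 1: "\<bar>\<phi> w - S w\<bar> \<le> A * w ^ (N + 3)"
        using A(2)[OF w0(1)] unfolding sumS S_def .
      have 2: "\<bar>S w\<bar> \<le> B * w\<^sup>2"
      proof -
        have "\<bar>S w\<bar> \<le> (\<Sum>i<N+1. \<bar>p (i + 2)\<bar> * w\<^sup>2)"
          unfolding S_def
        proof (rule order_trans[OF sum_abs], rule sum_mono)
          fix i
          have "w ^ (i + 2) \<le> w\<^sup>2" using w0 by (intro power_decreasing) auto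
          then show "\<bar>p (i + 2) * w ^ (i + 2)\<bar> \<le> \<bar>p (i + 2)\<bar> * w\<^sup>2"
            unfolding abs_mult using w0 by (intro mult_left_mono) auto
        qed
        then show ?thesis by (simp add: B_def sum_distrib_right del: sum.lessThan_Suc)
      qed
      have 3: "norm (e w - E w) \<le> Y * ((8 * pi\<^sup>2 * R) ^ (N + 1) * w ^ (2 * N + 2))"
      proof -
        define v where "v = of_real (4 * pi\<^sup>2 * w\<^sup>2) * s"
        have "Re v = 4 * pi\<^sup>2 * w\<^sup>2 * R" by (simp add: v_def R_def)
        then have "exp \<bar>Re v\<bar> = norm (e w)" using s(1) by (simp add: e_def norm_exp v_def abs_mult)
        then have ev: "exp \<bar>Re v\<bar> \<le> Y" using ebound[OF w] by (simp add: Y_def)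
        have "norm v = 4 * pi\<^sup>2 * w\<^sup>2 * norm s" by (simp add: v_def norm_mult norm_power)
        also have "\<dots> \<le> 4 * pi\<^sup>2 * w\<^sup>2 * (2 * R)" using s(3) by (intro mult_left_mono) auto
        finally have v: "norm v \<le> 8 * pi\<^sup>2 * R * w\<^sup>2" by (simp add: mult_ac)
        have "norm (e w - E w) \<le> exp \<bar>Re v\<bar> * norm v ^ Suc N / fact N"
          using Taylor_exp[of v N] by (simp add: e_def E_def v_def)
        also have "\<dots> \<le> exp \<bar>Re v\<bar> * norm v ^ Suc N / 1"
          by (intro divide_left_mono) auto
        also have "\<dots> \<le> Y * (8 * pi\<^sup>2 * R * w\<^sup>2) ^ Suc N"
          unfolding div_by_1 using ev v Y by (intro mult_mono power_mono) auto
        also have "(8 * pi\<^sup>2 * R * w\<^sup>2) ^ Suc N = (8 * pi\<^sup>2 * R) ^ (N + 1) * w ^ (2 * N + 2)"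
        proof -
          have "w ^ (2 * N + 2) = (w\<^sup>2) ^ Suc N" using power_mult[of w 2 "Suc N"] by simp
          then show ?thesis by (simp only: power_mult_distrib Suc_eq_plus1)
        qed
        finally show ?thesis .
      qed
      have "of_real (\<phi> w) * e w - of_real (S w) * E w = of_real (\<phi> w - S w) * e w + of_real (S w) * (e w - E w)"
        by (simp add: algebra_simps)
      also have "norm \<dots> \<le> \<bar>\<phi> w - S w\<bar> * norm (e w) + \<bar>S w\<bar> * norm (e w - E w)"
        by (rule norm_triangle_le) (simp add: norm_mult del: of_real_diff)
      also have "\<dots> \<le> (A * w ^ (N + 3)) * Y + (B * w\<^sup>2) * (Y * ((8 * pi\<^sup>2 * R) ^ (N + 1) * w ^ (2 * N + 2)))"
        using 1 2 3 ebound[OF w] A(1) B w0 unfolding Y_def[symmetric] by (intro add_mono mult_mono) auto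
      also have "\<dots> = A * (w ^ (N + 3) * Y) + B * (8 * pi\<^sup>2 * R) ^ (N + 1) * (w ^ (2 * N + 4) * Y)"
      proof -
        have "w\<^sup>2 * w ^ (2 * N + 2) = w ^ (2 * N + 4)"
          by (simp only: power_add[symmetric]) (rule arg_cong[where f = "power w"], simp)
        then show ?thesis by (simp add: mult_ac)
      qed
      finally have num: "norm (of_real (\<phi> w) * e w - of_real (S w) * E w) \<le>
          A * (w ^ (N + 3) * Y) + B * (8 * pi\<^sup>2 * R) ^ (N + 1) * (w ^ (2 * N + 4) * Y)" .
      have "F w - T w = (of_real (\<phi> w) * e w - of_real (S w) * E w) / sh s w ^ 2"
        by (simp add: F_eq T_eq diff_divide_distrib)
      also have "norm \<dots> \<le> (A * (w ^ (N + 3) * Y) + B * (8 * pi\<^sup>2 * R) ^ (N + 1) * (w ^ (2 * N + 4) * Y)) / norm (sh s w) ^ 2"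
        unfolding norm_divide norm_power by (intro divide_right_mono num) auto
      also have "\<dots> = A * (w ^ (N + 3) * Y / norm (sh s w) ^ 2) +
          B * (8 * pi\<^sup>2 * R) ^ (N + 1) * (w ^ (2 * N + 4) * Y / norm (sh s w) ^ 2)"
        by (simp add: add_divide_distrib)
      also have "\<dots> \<le> A * (C1 / R ^ (N + 3) * exp (- R * w)) +
          B * (8 * pi\<^sup>2 * R) ^ (N + 1) * (C2 / R ^ (2 * N + 4) * exp (- R * w))"
        using C1(2)[OF s(1) w0(1)] C2(2)[OF s(1) w0(1)] A(1) B R unfolding Y_def R_def
        by (intro add_mono mult_left_mono) auto
      also have "\<dots> = D / R ^ (N + 3) * exp (- R * w)"
      proof -
        have "R ^ (2 * N + 4) = R ^ (N + 1) * R ^ (N + 3)"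
          by (simp only: power_add[symmetric]) (rule arg_cong[where f = "power R"], simp)
        then have "(8 * pi\<^sup>2 * R) ^ (N + 1) * (C2 / R ^ (2 * N + 4)) = (8 * pi\<^sup>2) ^ (N + 1) * C2 / R ^ (N + 3)"
          using R by (simp only: power_mult_distrib[of _ R]) simp
        then have "B * (8 * pi\<^sup>2 * R) ^ (N + 1) * (C2 / R ^ (2 * N + 4) * exp (- R * w)) =
            B * ((8 * pi\<^sup>2) ^ (N + 1) * C2 / R ^ (N + 3)) * exp (- R * w)"
          by (metis (no_types, opaque_lifting) mult.assoc)
        then show ?thesis by (simp only:) (simp add: D_def add_divide_distrib ring_distribs)
      qed
      finally show ?thesis .
    qed
    \<comment> \<open>Integrating exp(-R w) gains a further 1/R. After the prefactor s^2 the error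
      has order norm z^(N+2), one power better than required.\<close>
    have part1: "norm (integral {0..1/2} F - integral {0..1/2} T) \<le> D / R ^ (N + 4)"
    proof -
      have "norm (integral {0..1/2} (\<lambda>w. F w - T w)) \<le> integral {0..1/2} (\<lambda>w. D / R ^ (N + 3) * exp (- R * w))"
      proof (rule integral_norm_bound_integral)
        show "(\<lambda>w. F w - T w) integrable_on {0..1/2}"
          using Fint Tint by (intro integrable_diff) auto
        show "(\<lambda>w. D / R ^ (N + 3) * exp (- R * w)) integrable_on {0..1/2}"
          by (intro integrable_continuous_interval continuous_intros)
      qed (rule diff)
      also have "\<dots> = D / R ^ (N + 3) * ((1 - exp (- R / 2)) / R)"
        using has_integral_exp_minus[OF R] by (intro integral_unique has_integral_mult_right)
      also have "\<dots> \<le> D / R ^ (N + 3) * (1 / R)"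
        using D R by (intro mult_left_mono divide_right_mono) auto
      also have "\<dots> = D / R ^ (N + 4)" by (simp add: numeral_eq_Suc)
      finally show ?thesis using Fint Tint by (simp add: integral_diff has_integral_integrable_integral)
    qed
    have part2: "8 * of_real pi ^ 2 * s ^ 2 * integral {0..1/2} T - poly P z =
        (\<Sum>i<N+1. \<Sum>j\<le>N. of_real (8 * pi\<^sup>2 * c i j) * z ^ (i + j + 1) * (I (i + 2 * j) * s ^ (i + 2 * j + 3) - K (i + 2 * j)))"
    proof -
      have "of_real (8 * pi\<^sup>2 * c i j) * z ^ (i + j + 1) * (I (i + 2 * j) * s ^ (i + 2 * j + 3) - K (i + 2 * j)) =
          8 * of_real pi ^ 2 * s ^ 2 * (of_real (c i j) * s ^ j * I (i + 2 * j)) -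
          of_real (8 * pi\<^sup>2 * c i j) * K (i + 2 * j) * z ^ (i + j + 1)" for i j
      proof -
        have "s ^ (i + 2 * j + 3) = s ^ (i + j + 1) * (s ^ j * s ^ 2)"
          by (simp only: power_add[symmetric]) (rule arg_cong[where f = "power s"], simp)
        moreover have "z ^ (i + j + 1) * s ^ (i + j + 1) = 1"
          using z(2) by (simp add: s_def flip: power_mult_distrib)
        ultimately have "z ^ (i + j + 1) * s ^ (i + 2 * j + 3) = s ^ j * s ^ 2"
          by (metis (no_types, opaque_lifting) mult.assoc mult_1)
        then show ?thesis
          by (simp add: right_diff_distrib del: power_Suc)
      qed
      then show ?thesis
        using integral_unique[OF Tint]
        by (simp add: P_def poly_sum poly_monom sum_subtractf sum_distrib_left del: sum.lessThan_Suc sum.atMost_Suc)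
    qed
    define G where "G = (1 + norm s) * exp (- Re s / 2)"
    have G: "G \<ge> 0" "G \<le> 2 * fact (N + 2) * 4 ^ (N + 2) * norm z ^ (N + 1)"
      using one_plus_exp_minus_le[OF z, of "N + 1"] by (simp_all add: G_def s_def)
    have part2': "norm (8 * of_real pi ^ 2 * s ^ 2 * integral {0..1/2} T - poly P z) \<le>
        (\<Sum>i<N+1. \<Sum>j\<le>N. 8 * pi\<^sup>2 * \<bar>c i j\<bar> * CK (i + 2 * j)) * G"
      unfolding part2 sum_distrib_right
    proof (intro sum_norm_le)
      fix i j
      have "norm z ^ (i + j + 1) \<le> 1" using z(3) by (intro power_le_one) auto
      then have "8 * pi\<^sup>2 * \<bar>c i j\<bar> * norm z ^ (i + j + 1) * norm (I (i + 2 * j) * s ^ (i + 2 * j + 3) - K (i + 2 * j))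
          \<le> 8 * pi\<^sup>2 * \<bar>c i j\<bar> * 1 * (CK (i + 2 * j) * G)"
        using I(2)[of "i + 2 * j"] CK[of "i + 2 * j"] G(1) unfolding G_def
        by (intro mult_mono) (auto simp: mult_ac)
      then show "norm (of_real (8 * pi\<^sup>2 * c i j) * z ^ (i + j + 1) * (I (i + 2 * j) * s ^ (i + 2 * j + 3) - K (i + 2 * j)))
          \<le> 8 * pi\<^sup>2 * \<bar>c i j\<bar> * CK (i + 2 * j) * G"
        by (simp add: norm_mult norm_power abs_mult mult_ac)
    qed
    have sR: "norm s ^ 2 * (D / R ^ (N + 4)) \<le> 4 * D * 2 ^ (N + 2) * norm z ^ (N + 1)"
    proof -
      have "norm s ^ 2 \<le> (2 * R) ^ 2" using s(3) by (intro power_mono) auto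
      then have "norm s ^ 2 * (D / R ^ (N + 4)) \<le> (2 * R) ^ 2 * (D / R ^ (N + 4))"
        using D R by (intro mult_right_mono) auto
      also have "\<dots> = 4 * D * (1 / R) ^ (N + 2)"
        using R by (simp add: power_add power_divide field_simps power2_eq_square numeral_eq_Suc)
      also have "1 / R \<le> 2 * norm z"
        using s(3) R z(2) by (simp add: s_def norm_divide field_simps)
      then have "4 * D * (1 / R) ^ (N + 2) \<le> 4 * D * (2 * norm z) ^ (N + 2)"
        using D R by (intro mult_left_mono power_mono) auto
      also have "\<dots> = 4 * D * 2 ^ (N + 2) * (norm z ^ (N + 1) * norm z)"
        by (simp add: power_mult_distrib)
      also have "\<dots> \<le> 4 * D * 2 ^ (N + 2) * (norm z ^ (N + 1) * 1)"
        using D z(3) by (intro mult_left_mono) auto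
      finally show ?thesis by simp
    qed
    have "gm1 m z - poly P z = 8 * of_real pi ^ 2 * s ^ 2 * (integral {0..1/2} F - integral {0..1/2} T) +
        (8 * of_real pi ^ 2 * s ^ 2 * integral {0..1/2} T - poly P z)"
      by (simp add: gm1_eq algebra_simps)
    also have "norm \<dots> \<le> 8 * pi ^ 2 * (norm s ^ 2 * (D / R ^ (N + 4))) +
        (\<Sum>i<N+1. \<Sum>j\<le>N. 8 * pi\<^sup>2 * \<bar>c i j\<bar> * CK (i + 2 * j)) * G"
    proof (intro norm_triangle_mono part2')
      show "norm (8 * of_real pi ^ 2 * s ^ 2 * (integral {0..1/2} F - integral {0..1/2} T)) \<le>
          8 * pi ^ 2 * (norm s ^ 2 * (D / R ^ (N + 4)))"
        using mult_left_mono[OF part1, of "8 * pi ^ 2 * norm s ^ 2"]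
        by (simp add: norm_mult norm_power mult.assoc)
    qed
    also have "\<dots> \<le> 8 * pi ^ 2 * (4 * D * 2 ^ (N + 2) * norm z ^ (N + 1)) +
        (\<Sum>i<N+1. \<Sum>j\<le>N. 8 * pi\<^sup>2 * \<bar>c i j\<bar> * CK (i + 2 * j)) * (2 * fact (N + 2) * 4 ^ (N + 2) * norm z ^ (N + 1))"
      using G CK by (intro add_mono mult_left_mono sR sum_nonneg) (auto simp: less_imp_le)
    also have "\<dots> = C * norm z ^ (N + 1)"
      by (simp add: C_def algebra_simps)
    finally show "norm (gm1 m z - poly P z) \<le> C * norm z ^ (N + 1)" .
  qed
qed

section \<open>Existence and uniqueness of the expansion that defines \<open>dcoeff\<close>\<close>

lemma sector_filter_nontrivial: "at (0::complex) within sector \<noteq> bot"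
proof -
  have "0 islimpt sector"
    unfolding islimpt_approachable
  proof (intro allI impI)
    fix e :: real assume "e > 0"
    then show "\<exists>x'\<in>sector. x' \<noteq> 0 \<and> dist x' 0 < e"
      by (intro bexI[of _ "of_real (e / 2)"]) (auto simp: sector_def)
  qed
  then show ?thesis by (simp add: trivial_limit_within)
qed

text \<open>Dividing by the power of z at the lowest nonzero coefficient leaves a polynomial that
  tends to that coefficient at 0, but to 0 by the bound. This is the source of uniqueness of the
  asymptotic expansion.\<close>

lemma poly_bigo_coeff_0:
  fixes p :: "complex poly"
  assumes "poly p \<in> O[at 0 within sector](\<lambda>z. z ^ (N + 1))" "l \<le> N"
  shows "coeff p l = 0"
proof (rule ccontr)
  assume "coeff p l \<noteq> 0"
  define j where "j = (LEAST j. coeff p j \<noteq> 0)"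
  have j: "coeff p j \<noteq> 0" "j \<le> l"
    unfolding j_def by (rule LeastI Least_le, rule \<open>coeff p l \<noteq> 0\<close>)+
  have below: "coeff p i = 0" if "i < j" for i
    using that not_less_Least unfolding j_def by blast
  define r where "r = poly_shift j p"
  have "p = monom 1 j * r"
    by (rule poly_eqI) (auto simp: r_def coeff_monom_mult coeff_poly_shift below)
  then have pr: "poly p z = z ^ j * poly r z" for z by (simp add: poly_monom)
  obtain C where C: "C > 0" "eventually (\<lambda>z. norm (poly p z) \<le> C * norm (z ^ (N + 1))) (at 0 within sector)"
    using landau_o.bigE[OF assms(1)] by blast
  have "eventually (\<lambda>z::complex. z \<noteq> 0) (at 0 within sector)"
    by (simp add: eventually_at_filter)
  with C(2) have ev: "eventually (\<lambda>z. norm (poly r z) \<le> C * norm z ^ (N + 1 - j)) (at 0 within sector)"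
  proof eventually_elim
    case (elim z)
    have "norm z ^ (N + 1) = norm z ^ j * norm z ^ (N + 1 - j)"
      using j(2) assms(2) by (simp flip: power_add)
    then have "norm z ^ j * norm (poly r z) \<le> norm z ^ j * (C * norm z ^ (N + 1 - j))"
      using elim by (simp add: pr norm_mult norm_power mult_ac)
    then show ?case using elim(2) by simp
  qed
  have "((\<lambda>z. C * norm z ^ (N + 1 - j)) \<longlongrightarrow> C * norm (0::complex) ^ (N + 1 - j)) (at 0 within sector)"
    by (intro tendsto_intros)
  then have "((\<lambda>z::complex. C * norm z ^ (N + 1 - j)) \<longlongrightarrow> 0) (at 0 within sector)"
    using j(2) assms(2) by (simp add: Suc_diff_le)
  then have "(poly r \<longlongrightarrow> 0) (at 0 within sector)"
    by (rule Lim_null_comparison[OF ev])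
  moreover have "(poly r \<longlongrightarrow> poly r 0) (at 0 within sector)"
    by (intro tendsto_intros)
  ultimately have "poly r 0 = 0"
    using tendsto_unique[OF sector_filter_nontrivial] by blast
  with j(1) show False by (simp add: r_def poly_0_coeff_0 coeff_poly_shift)
qed

lemma sector_bigoI:
  fixes f :: "complex \<Rightarrow> complex"
  assumes "\<And>z. z \<in> sector \<Longrightarrow> z \<noteq> 0 \<Longrightarrow> norm z \<le> 1 \<Longrightarrow> norm (f z) \<le> C * norm z ^ n"
  shows "f \<in> O[at 0 within sector](\<lambda>z. z ^ n)"
proof (rule landau_o.bigI[of "\<bar>C\<bar> + 1"])
  show "eventually (\<lambda>z. norm (f z) \<le> (\<bar>C\<bar> + 1) * norm (z ^ n)) (at 0 within sector)"
    unfolding eventually_at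
  proof (intro exI[of _ 1] conjI ballI impI)
    fix z :: complex assume "z \<in> sector" "z \<noteq> 0 \<and> dist z 0 < 1"
    then have "norm (f z) \<le> C * norm z ^ n" by (intro assms) auto
    also have "\<dots> \<le> (\<bar>C\<bar> + 1) * norm z ^ n" by (intro mult_right_mono) auto
    finally show "norm (f z) \<le> (\<bar>C\<bar> + 1) * norm (z ^ n)" by (simp add: norm_power)
  qed simp
qed auto

text \<open>The approximant is the Taylor polynomial of the exponential times the polynomial for
  \<open>gm1\<close>. Its degree may exceed N; what counts is that it vanishes at 0 and has the
  right error order.\<close>

lemma exp_gm1_poly_approx:
  "\<exists>P. poly P 0 = 0 \<and> (\<lambda>z. exp (- of_nat k * z / 24) * gm1 m z - poly P z) \<in> O[at 0 within sector](\<lambda>z. z ^ (N + 1))"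
proof -
  obtain P C where P: "poly P 0 = 0"
    "\<And>z. z \<in> sector \<Longrightarrow> z \<noteq> 0 \<Longrightarrow> norm z \<le> 1 \<Longrightarrow> norm (gm1 m z - poly P z) \<le> C * norm z ^ (N + 1)"
    using gm1_poly_approx[of m N] by blast
  define a :: complex where "a = - of_nat k / 24"
  define E where "E = (\<Sum>i\<le>N. monom (a ^ i / fact i) i)"
  have E: "poly E z = (\<Sum>i\<le>N. (a * z) ^ i / fact i)" for z
    by (simp add: E_def poly_sum poly_monom power_mult_distrib)
  have "compact (poly P ` cball 0 1)"
    by (intro compact_continuous_image continuous_intros) auto
  then obtain B where B: "\<And>z. norm z \<le> 1 \<Longrightarrow> norm (poly P z) \<le> B"
    using compact_imp_bounded bounded_iff by (metis image_eqI mem_cball_0)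
  have B0: "B \<ge> 0" using B[of 0] by (metis norm_ge_zero norm_zero order_trans zero_le_one)
  define C' where "C' = exp (norm a) * \<bar>C\<bar> + exp (norm a) * norm a ^ Suc N * B"
  have "norm (exp (- of_nat k * z / 24) * gm1 m z - poly (E * P) z) \<le> C' * norm z ^ (N + 1)"
    if z: "z \<in> sector" "z \<noteq> 0" "norm z \<le> 1" for z
  proof -
    have az: "norm (a * z) \<le> norm a * norm z" "norm a * norm z \<le> norm a * 1"
      using mult_left_mono[of "norm z" 1 "norm a"] z(3) by (simp_all add: norm_mult)
    have e1: "norm (exp (a * z)) \<le> exp (norm a)"
      using az complex_Re_le_cmod[of "a * z"] by (simp add: norm_exp)
    have "norm (exp (a * z) - poly E z) \<le> exp \<bar>Re (a * z)\<bar> * norm (a * z) ^ Suc N / fact N"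
      unfolding E by (rule Taylor_exp)
    also have "\<dots> \<le> exp \<bar>Re (a * z)\<bar> * norm (a * z) ^ Suc N / 1"
      by (intro divide_left_mono) auto
    also have "\<dots> \<le> exp (norm a) * (norm a ^ Suc N * norm z ^ (N + 1))"
      unfolding div_by_1 using az abs_Re_le_cmod[of "a * z"]
      by (intro mult_mono) (auto simp: norm_mult power_mult_distrib)
    finally have e2: "norm (exp (a * z) - poly E z) \<le> exp (norm a) * (norm a ^ Suc N * norm z ^ (N + 1))" .
    have "exp (- of_nat k * z / 24) * gm1 m z - poly (E * P) z =
        exp (a * z) * (gm1 m z - poly P z) + (exp (a * z) - poly E z) * poly P z"
      by (simp add: a_def algebra_simps)
    also have "norm \<dots> \<le> norm (exp (a * z)) * norm (gm1 m z - poly P z) + norm (exp (a * z) - poly E z) * norm (poly P z)"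
      by (rule norm_triangle_le) (simp add: norm_mult)
    also have "\<dots> \<le> exp (norm a) * (\<bar>C\<bar> * norm z ^ (N + 1)) + exp (norm a) * (norm a ^ Suc N * norm z ^ (N + 1)) * B"
    proof (intro add_mono mult_mono e1 e2 B z(3))
      have "C * norm z ^ (N + 1) \<le> \<bar>C\<bar> * norm z ^ (N + 1)" by (intro mult_right_mono) auto
      then show "norm (gm1 m z - poly P z) \<le> \<bar>C\<bar> * norm z ^ (N + 1)" using P(2)[OF z] by linarith
    qed auto
    also have "\<dots> = C' * norm z ^ (N + 1)" by (simp add: C'_def algebra_simps)
    finally show ?thesis .
  qed
  then have "(\<lambda>z. exp (- of_nat k * z / 24) * gm1 m z - poly (E * P) z) \<in> O[at 0 within sector](\<lambda>z. z ^ (N + 1))"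
    by (rule sector_bigoI)
  with P(1) show ?thesis by (intro exI[of _ "E * P"]) simp
qed

lemma poly_of_coeff_sum:
  fixes d :: "nat \<Rightarrow> complex"
  shows "coeff (\<Sum>l=1..N. monom (d l) l) i = (if 1 \<le> i \<and> i \<le> N then d i else 0)"
    and "poly (\<Sum>l=1..N. monom (d l) l) z = (\<Sum>l=1..N. d l * z ^ l)"
  by (simp_all add: coeff_sum poly_sum poly_monom)

lemmas poly_of_coeff_sum' = poly_of_coeff_sum[unfolded One_nat_def]

text \<open>For each N there is an approximating polynomial, and polynomials of different precision
  share their low coefficients. The diagonal coefficients therefore serve all N at once, and the
  same comparison shows that no other sequence does.\<close>

lemma is_gm1_expansion_dcoeff: "is_gm1_expansion m k (dcoeff m k)"
  unfolding dcoeff_def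
proof (rule theI'[of "is_gm1_expansion m k"])
  define f where "f = (\<lambda>z. exp (- of_nat k * z / 24) * gm1 m z)"
  define O' where "O' = (\<lambda>N. O[at (0::complex) within sector](\<lambda>z. z ^ (N + 1)))"
  have mono: "g \<in> O' N" if "g \<in> O' M" "N \<le> M" for g :: "complex \<Rightarrow> complex" and N M
  proof -
    have "(\<lambda>z::complex. z ^ (M + 1)) \<in> O[at 0 within sector](\<lambda>z. z ^ (N + 1))"
    proof (rule sector_bigoI[of _ 1])
      show "norm (z ^ (M + 1)) \<le> 1 * norm z ^ (N + 1)" if "norm z \<le> 1" for z :: complex
        using that \<open>N \<le> M\<close> by (simp only: norm_power mult_1) (intro power_decreasing, auto)
    qed
    with that(1) show ?thesis unfolding O'_def by (rule landau_o.big_trans)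
  qed
  have "\<forall>N. \<exists>P. poly P 0 = 0 \<and> (\<lambda>z. f z - poly P z) \<in> O' N"
    using exp_gm1_poly_approx unfolding f_def O'_def by blast
  from choice[OF this] obtain P where P: "\<And>N. poly (P N) 0 = 0" "\<And>N. (\<lambda>z. f z - poly (P N) z) \<in> O' N"
    by blast
  have agree: "coeff p i = coeff (P N) i" if "(\<lambda>z. f z - poly p z) \<in> O' N" "i \<le> N" for p N i
  proof -
    have "(\<lambda>z. (f z - poly (P N) z) - (f z - poly p z)) \<in> O' N"
      using P(2)[of N] that(1) unfolding O'_def by (rule sum_in_bigo)
    moreover have "poly (p - P N) = (\<lambda>z. poly p z - poly (P N) z)"
      by (rule ext) simp
    ultimately have "poly (p - P N) \<in> O[at 0 within sector](\<lambda>z. z ^ (N + 1))"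
      unfolding O'_def by simp
    from poly_bigo_coeff_0[OF this that(2)] show ?thesis by simp
  qed
  define d where "d = (\<lambda>l. coeff (P l) l)"
  have sec: "{z. \<bar>Im z\<bar> \<le> Re z} = sector" by (simp add: sector_def)
  have d: "is_gm1_expansion m k d"
    unfolding is_gm1_expansion_def sec
  proof (intro conjI allI impI)
    show "d 0 = 0" using P(1)[of 0] by (simp add: d_def poly_0_coeff_0)
    fix N :: nat assume "N \<ge> 1"
    \<comment> \<open>\<open>D\<close> is the part of \<open>P N\<close> of degree at most N. The
      rest is z^(N+1) times a polynomial bounded on the unit disc, hence part of the error.\<close>
    define D where "D = (\<Sum>l=1..N. monom (d l) l)"
    have "coeff (P N - D) i = 0" if "i \<le> N" for i
    proof (cases "i = 0")
      case True
      then show ?thesis using P(1)[of N] by (simp add: D_def poly_of_coeff_sum' poly_0_coeff_0)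
    next
      case False
      have "coeff (P i) i = coeff (P N) i"
        using agree[of "P N" i i] mono[OF P(2)[of N] that] by simp
      then show ?thesis using False that by (simp add: D_def poly_of_coeff_sum' d_def)
    qed
    then have "P N - D = monom 1 (N + 1) * poly_shift (N + 1) (P N - D)"
      by (intro poly_eqI) (auto simp: coeff_monom_mult coeff_poly_shift)
    then have PD: "poly (P N) z - poly D z = z ^ (N + 1) * poly (poly_shift (N + 1) (P N - D)) z" for z
      by (metis poly_diff poly_monom poly_mult mult_1)
    have "compact (poly (poly_shift (N + 1) (P N - D)) ` cball 0 1)"
      by (intro compact_continuous_image continuous_intros) auto
    then obtain B where B: "\<And>z. norm z \<le> 1 \<Longrightarrow> norm (poly (poly_shift (N + 1) (P N - D)) z) \<le> B"
      using compact_imp_bounded bounded_iff by (metis image_eqI mem_cball_0)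
    have "(\<lambda>z. poly (P N) z - poly D z) \<in> O' N"
      unfolding O'_def
    proof (rule sector_bigoI[of _ B])
      fix z :: complex assume "norm z \<le> 1"
      then show "norm (poly (P N) z - poly D z) \<le> B * norm z ^ (N + 1)"
        unfolding PD norm_mult norm_power mult.commute[of B] by (intro mult_left_mono B) auto
    qed
    with P(2)[of N] have "(\<lambda>z. (f z - poly (P N) z) + (poly (P N) z - poly D z)) \<in> O' N"
      unfolding O'_def by (rule sum_in_bigo(1))
    then show "(\<lambda>z. exp (- of_nat k * z / 24) * gm1 m z - (\<Sum>l=1..N. d l * z ^ l)) \<in> O[at 0 within sector](\<lambda>z. z ^ (N + 1))"
      by (simp add: f_def O'_def D_def poly_of_coeff_sum')
  qed
  show "\<exists>!d. is_gm1_expansion m k d"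
  proof (rule ex1I[of "is_gm1_expansion m k" d])
    show "is_gm1_expansion m k d" by (rule d)
    fix e assume e: "is_gm1_expansion m k e"
    show "e = d"
    proof
      fix l
      show "e l = d l"
      proof (cases "l = 0")
        case True
        then show ?thesis using d e by (simp add: is_gm1_expansion_def)
      next
        case False
        then have "(\<lambda>z. f z - poly (\<Sum>i=1..l. monom (e i) i) z) \<in> O' l"
          using e unfolding is_gm1_expansion_def sec poly_of_coeff_sum O'_def f_def by auto
        from agree[OF this order_refl] False show ?thesis
          by (simp add: poly_of_coeff_sum' d_def)
      qed
    qed
  qed
qed

lemma dcoeff_approx:
  assumes "N \<ge> 1"
  obtains C \<epsilon> :: real where "C > 0" "\<epsilon> > 0"
    "\<And>z. z \<in> sector \<Longrightarrow> z \<noteq> 0 \<Longrightarrow> norm z < \<epsilon> \<Longrightarrow>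
      norm (exp (- of_nat k * z / 24) * gm1 m z - (\<Sum>l=1..N. dcoeff m k l * z ^ l)) \<le> C * norm z ^ (N + 1)"
proof -
  have sec: "{z. \<bar>Im z\<bar> \<le> Re z} = sector" by (simp add: sector_def)
  have "(\<lambda>z. exp (- of_nat k * z / 24) * gm1 m z - (\<Sum>l=1..N. dcoeff m k l * z ^ l))
      \<in> O[at 0 within sector](\<lambda>z. z ^ (N + 1))"
    using is_gm1_expansion_dcoeff[of m k] assms unfolding is_gm1_expansion_def sec by blast
  then obtain C where C: "C > 0" "eventually (\<lambda>z. norm (exp (- of_nat k * z / 24) * gm1 m z - (\<Sum>l=1..N. dcoeff m k l * z ^ l))
      \<le> C * norm (z ^ (N + 1))) (at 0 within sector)"
    using landau_o.bigE by blast
  from C(2) obtain \<epsilon> where \<epsilon>: "\<epsilon> > 0" "\<And>z. z \<in> sector \<Longrightarrow> z \<noteq> 0 \<Longrightarrow> dist z 0 < \<epsilon> \<Longrightarrow>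
      norm (exp (- of_nat k * z / 24) * gm1 m z - (\<Sum>l=1..N. dcoeff m k l * z ^ l)) \<le> C * norm (z ^ (N + 1))"
    unfolding eventually_at by blast
  show ?thesis
  proof (rule that[OF C(1) \<epsilon>(1)])
    fix z :: complex assume "z \<in> sector" "z \<noteq> 0" "norm z < \<epsilon>"
    then have "norm (exp (- of_nat k * z / 24) * gm1 m z - (\<Sum>l=1..N. dcoeff m k l * z ^ l)) \<le> C * norm (z ^ (N + 1))"
      by (intro \<epsilon>(2)) auto
    then show "norm (exp (- of_nat k * z / 24) * gm1 m z - (\<Sum>l=1..N. dcoeff m k l * z ^ l)) \<le> C * norm z ^ (N + 1)"
      unfolding norm_power .
  qed
qed

section \<open>The coefficients as Fourier integrals\<close>

text \<open>This is f_k in the variables c = zeta and q, without the factor q^(-k/24). Removing the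
  fractional power makes it holomorphic at q = 0, so that it has a Taylor series in q.\<close>

definition Phi :: "nat \<Rightarrow> complex \<Rightarrow> complex \<Rightarrow> complex" where
  "Phi k c q = qp 1 q ^ 4 / (qp c q * qp (inverse c) q) ^ 2 / qp 1 q ^ k"

lemma gfun_conv_qp:
  assumes "Im \<tau> > 0"
  shows "gfun w \<tau> = qp 1 (qpar \<tau>) ^ 2 / (qp (qpar w) (qpar \<tau>) * qp (inverse (qpar w)) (qpar \<tau>))"
proof -
  have q: "norm (qpar \<tau>) < 1" using assms by (rule norm_qpar_less_1)
  have 1: "convergent_prod (\<lambda>n. 1 - qpar \<tau> ^ Suc n)"
    using convergent_prod_qp[OF q, of 1] by simp
  have "qp 1 (qpar \<tau>) = (\<Prod>n. 1 - qpar \<tau> ^ Suc n)"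
    by (simp add: qp_def)
  then show ?thesis
    unfolding gfun_def qpar_minus
    by (simp only: qp_def[of "qpar w"] qp_def[of "inverse (qpar w)"] prodinf_power[OF 1, symmetric]
        prodinf_mult[OF convergent_prod_qp[OF q] convergent_prod_qp[OF q]]
        prodinf_divide[OF convergent_prod_power[OF 1] convergent_prod_mult[OF convergent_prod_qp[OF q] convergent_prod_qp[OF q]]])
qed

lemma fk_conv_Phi:
  assumes "Im \<tau> > 0"
  shows "fk k w \<tau> = qpar (- (of_nat k * \<tau> / 24)) * Phi k (qpar w) (qpar \<tau>)"
proof -
  have "eta \<tau> ^ k = qpar (of_nat k * \<tau> / 24) * qp 1 (qpar \<tau>) ^ k"
    by (simp add: eta_def qp_def power_mult_distrib qpar_power)
  moreover have "(a\<^sup>2 / d)\<^sup>2 / (x * p) = inverse x * (a ^ 4 / d\<^sup>2 / p)" for a d x p :: complex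
  proof -
    have "(a\<^sup>2 / d)\<^sup>2 = a ^ 4 / d\<^sup>2" by (simp add: power_divide flip: power_mult)
    then show ?thesis by (simp add: divide_inverse)
  qed
  ultimately show ?thesis
    unfolding fk_def gfun_conv_qp[OF assms] Phi_def qpar_minus by simp
qed

section \<open>Power series in q whose coefficients are Laurent polynomials in c\<close>

definition laurent_poly :: "(complex \<Rightarrow> complex) \<Rightarrow> bool" where
  "laurent_poly u \<longleftrightarrow> (\<exists>S a. finite S \<and> (\<forall>c. c \<noteq> 0 \<longrightarrow> u c = (\<Sum>m\<in>S. a m * c powi m)))"

lemma laurent_poly_monom: "laurent_poly (\<lambda>c. x * c powi m)"
  unfolding laurent_poly_def by (intro exI[of _ "{m}"] exI[of _ "\<lambda>_. x"]) simp

lemma laurent_poly_const: "laurent_poly (\<lambda>_. x)"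
  using laurent_poly_monom[of x 0] by simp

lemma laurent_poly_add:
  assumes "laurent_poly u" "laurent_poly v"
  shows "laurent_poly (\<lambda>c. u c + v c)"
proof -
  obtain S a where a: "finite S" "\<And>c. c \<noteq> 0 \<Longrightarrow> u c = (\<Sum>m\<in>S. a m * c powi m)"
    using assms(1) unfolding laurent_poly_def by blast
  obtain T b where b: "finite T" "\<And>c. c \<noteq> 0 \<Longrightarrow> v c = (\<Sum>m\<in>T. b m * c powi m)"
    using assms(2) unfolding laurent_poly_def by blast
  define d where "d = (\<lambda>m. (if m \<in> S then a m else 0) + (if m \<in> T then b m else 0))"
  have "u c + v c = (\<Sum>m\<in>S \<union> T. d m * c powi m)" if "c \<noteq> 0" for c
  proof -
    have "(\<Sum>m\<in>S \<union> T. d m * c powi m) = (\<Sum>m\<in>S \<union> T. if m \<in> S then a m * c powi m else 0) +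
        (\<Sum>m\<in>S \<union> T. if m \<in> T then b m * c powi m else 0)"
      unfolding sum.distrib[symmetric] by (intro sum.cong) (auto simp: d_def ring_distribs)
    also have "(\<Sum>m\<in>S \<union> T. if m \<in> S then a m * c powi m else 0) = u c"
      using a b that by (simp add: sum.If_cases Int_absorb1)
    also have "(\<Sum>m\<in>S \<union> T. if m \<in> T then b m * c powi m else 0) = v c"
      using a b that by (simp add: sum.If_cases Int_absorb1)
    finally show ?thesis by simp
  qed
  then show ?thesis unfolding laurent_poly_def using a(1) b(1) by blast
qed

lemma laurent_poly_sum:
  assumes "\<And>i. i \<in> I \<Longrightarrow> laurent_poly (u i)"
  shows "laurent_poly (\<lambda>c. \<Sum>i\<in>I. u i c)"
  using assms
  by (induction I rule: infinite_finite_induct) (auto intro: laurent_poly_const laurent_poly_add)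

lemma laurent_poly_cong:
  assumes "laurent_poly u" "\<And>c. c \<noteq> 0 \<Longrightarrow> u c = v c"
  shows "laurent_poly v"
  using assms unfolding laurent_poly_def by metis

lemma laurent_poly_mult:
  assumes "laurent_poly u" "laurent_poly v"
  shows "laurent_poly (\<lambda>c. u c * v c)"
proof -
  obtain S a where a: "finite S" "\<And>c. c \<noteq> 0 \<Longrightarrow> u c = (\<Sum>m\<in>S. a m * c powi m)"
    using assms(1) unfolding laurent_poly_def by blast
  obtain T b where b: "finite T" "\<And>c. c \<noteq> 0 \<Longrightarrow> v c = (\<Sum>m\<in>T. b m * c powi m)"
    using assms(2) unfolding laurent_poly_def by blast
  have "laurent_poly (\<lambda>c. \<Sum>m\<in>S. \<Sum>n\<in>T. (a m * b n) * c powi (m + n))"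
    by (intro laurent_poly_sum laurent_poly_monom)
  then show ?thesis
    by (rule laurent_poly_cong) (simp add: a(2) b(2) sum_product power_int_add mult_ac)
qed

lemma laurent_poly_inverse_arg:
  assumes "laurent_poly u"
  shows "laurent_poly (\<lambda>c. u (inverse c))"
proof -
  obtain S a where a: "finite S" "\<And>c. c \<noteq> 0 \<Longrightarrow> u c = (\<Sum>m\<in>S. a m * c powi m)"
    using assms(1) unfolding laurent_poly_def by blast
  have "laurent_poly (\<lambda>c. \<Sum>m\<in>S. a m * c powi (- m))"
    by (intro laurent_poly_sum laurent_poly_monom)
  then show ?thesis
    by (rule laurent_poly_cong) (simp add: a(2) power_int_minus power_int_inverse)
qed

text \<open>Only q is formal; c remains a complex parameter, and the requirement concerns how each
  coefficient depends on it. Analytic facts about the products can thus be combined with formal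
  closure properties.\<close>

definition laurent_fps :: "(complex \<Rightarrow> complex fps) \<Rightarrow> bool" where
  "laurent_fps A \<longleftrightarrow> (\<forall>n. laurent_poly (\<lambda>c. fps_nth (A c) n))"

lemma laurent_fps_mult:
  assumes "laurent_fps A" "laurent_fps B"
  shows "laurent_fps (\<lambda>c. A c * B c)"
  using assms unfolding laurent_fps_def fps_mult_nth
  by (auto intro!: laurent_poly_sum laurent_poly_mult)

lemma laurent_fps_1: "laurent_fps (\<lambda>_. 1)"
  unfolding laurent_fps_def by (auto intro: laurent_poly_const)

lemma laurent_fps_power:
  assumes "laurent_fps A"
  shows "laurent_fps (\<lambda>c. A c ^ n)"
  by (induction n) (auto intro: laurent_fps_mult laurent_fps_1 assms)

text \<open>With constant term 1 the recursion for the coefficients of the inverse involves no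
  division, so Laurent polynomials stay Laurent polynomials.\<close>

lemma laurent_fps_inverse:
  assumes A: "laurent_fps A" and A0: "\<And>c. fps_nth (A c) 0 = 1"
  shows "laurent_fps (\<lambda>c. inverse (A c))"
  unfolding laurent_fps_def
proof
  fix n
  show "laurent_poly (\<lambda>c. fps_nth (inverse (A c)) n)"
  proof (induction n rule: less_induct)
    case (less n)
    show ?case
    proof (cases n)
      case 0
      then show ?thesis using laurent_poly_const[of 1] by (simp add: A0)
    next
      case (Suc n')
      have eq: "fps_nth (inverse (A c)) n = (\<Sum>i=1..n. (- 1) * (fps_nth (A c) i * fps_nth (inverse (A c)) (n - i)))" for c
      proof -
        have "A c * inverse (A c) = 1"
          using A0[of c] by (simp add: inverse_mult_eq_1')
        then have "(\<Sum>i=0..n. fps_nth (A c) i * fps_nth (inverse (A c)) (n - i)) = 0"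
          using Suc by (metis fps_mult_nth fps_one_nth nat.distinct(1))
        then have "fps_nth (inverse (A c)) n + (\<Sum>i=1..n. fps_nth (A c) i * fps_nth (inverse (A c)) (n - i)) = 0"
          by (simp add: sum.atLeast_Suc_atMost A0)
        then show ?thesis
          by (simp add: sum_negf eq_neg_iff_add_eq_0)
      qed
      show ?thesis
        unfolding eq
        by (intro laurent_poly_sum laurent_poly_mult laurent_poly_const)
           (use A less.IH in \<open>auto simp: laurent_fps_def\<close>)
    qed
  qed
qed

lemma holomorphic_on_qp_ball: "qp c holomorphic_on ball 0 1"
  using holomorphic_on_qp[of "ball 0 1" "\<lambda>_. c" "\<lambda>q. q"] by (simp add: holomorphic_on_ident)

lemma has_fps_expansion_qp: "qp c has_fps_expansion fps_expansion (qp c) 0"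
  by (rule has_fps_expansion_fps_expansion[OF _ _ holomorphic_on_qp_ball]) auto

text \<open>The coefficients of the partial products are eventually constant and converge to those of the
  infinite product.\<close>

lemma laurent_fps_qp: "laurent_fps (\<lambda>c. fps_expansion (qp c) 0)"
  unfolding laurent_fps_def
proof
  fix n
  define T where "T = (\<lambda>N c. \<Prod>j<N. 1 - fps_const c * fps_X ^ Suc j :: complex fps)"
  define t where "t = (\<lambda>c N q. \<Prod>j<N. 1 - c * q ^ Suc j :: complex)"
  have T: "t c N has_fps_expansion T N c" for N c
    unfolding T_def t_def by (intro fps_expansion_intros)
  have lT: "laurent_fps (T N)" for N
  proof (induction N)
    case 0
    then show ?case using laurent_fps_1 by (simp add: T_def)
  next
    case (Suc N)
    have "laurent_fps (\<lambda>c. 1 - fps_const c * fps_X ^ Suc N)"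
      unfolding laurent_fps_def
    proof
      fix n
      have "laurent_poly (\<lambda>c. (if n = 0 then 1 else 0) + (if n = Suc N then - 1 else 0) * c powi 1)"
        by (intro laurent_poly_add laurent_poly_const laurent_poly_monom)
      then show "laurent_poly (\<lambda>c. fps_nth (1 - fps_const c * fps_X ^ Suc N) n)"
        by (rule laurent_poly_cong) (auto simp del: power_Suc)
    qed
    with Suc show ?case
      unfolding T_def prod.lessThan_Suc by (rule laurent_fps_mult)
  qed
  have stable: "fps_nth (T (n + j) c) n = fps_nth (T n c) n" for j c
  proof (induction j)
    case (Suc j)
    have "T (n + Suc j) c = T (n + j) c - fps_const c * (T (n + j) c * fps_X ^ Suc (n + j))"
      by (simp add: T_def algebra_simps)
    then have "fps_nth (T (n + Suc j) c) n = fps_nth (T (n + j) c) n"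
      by (simp only: fps_sub_nth fps_mult_left_const_nth fps_X_power_mult_right_nth) simp
    with Suc show ?case by simp
  qed simp
  have "fps_nth (T n c) n = fps_nth (fps_expansion (qp c) 0) n" for c
  proof -
    \<comment> \<open>Uniform convergence of holomorphic functions on a disc carries over to all
      derivatives at its centre, hence to Taylor coefficients.\<close>
    have "(\<lambda>N. (deriv ^^ n) (t c N) 0) \<longlonglongrightarrow> (deriv ^^ n) (qp c) 0"
    proof (rule higher_deriv_complex_uniform_limit)
      have "uniform_limit (cball 0 (1/2)) (\<lambda>N x. \<Prod>n<N. 1 - c * x ^ Suc n) (\<lambda>x. qp c x) sequentially"
        by (intro uniform_limit_qp continuous_intros) auto
      then show "uniform_limit (ball 0 (1/2)) (t c) (qp c) sequentially"
        unfolding t_def by (rule uniform_limit_on_subset) auto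
      show "\<forall>\<^sub>F N in sequentially. t c N holomorphic_on ball 0 (1/2)"
        unfolding t_def by (intro always_eventually allI holomorphic_intros)
    qed auto
    then have "(\<lambda>N. (deriv ^^ n) (t c N) 0 / fact n) \<longlonglongrightarrow> (deriv ^^ n) (qp c) 0 / fact n"
      by (intro tendsto_intros) auto
    then have "(\<lambda>N. fps_nth (T N c) n) \<longlonglongrightarrow> fps_nth (fps_expansion (qp c) 0) n"
      by (simp add: fps_nth_fps_expansion[OF T] fps_expansion_def)
    moreover have "eventually (\<lambda>N. fps_nth (T n c) n = fps_nth (T N c) n) sequentially"
      unfolding eventually_sequentially using stable[of _ c] by (metis le_Suc_ex)
    then have "(\<lambda>N. fps_nth (T N c) n) \<longlonglongrightarrow> fps_nth (T n c) n"
      by (rule Lim_transform_eventually[OF tendsto_const])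
    ultimately show ?thesis by (rule LIMSEQ_unique[symmetric])
  qed
  moreover have "laurent_poly (\<lambda>c. fps_nth (T n c) n)"
    using lT unfolding laurent_fps_def by blast
  ultimately show "laurent_poly (\<lambda>c. fps_nth (fps_expansion (qp c) 0) n)"
    by (simp add: laurent_poly_cong)
qed

definition Phi_coeff :: "nat \<Rightarrow> complex \<Rightarrow> nat \<Rightarrow> complex" where
  "Phi_coeff k c n = (deriv ^^ n) (Phi k c) 0 / fact n"

lemma laurent_poly_Phi_coeff: "laurent_poly (\<lambda>c. Phi_coeff k c n)"
proof -
  define Q where "Q = (\<lambda>c. fps_expansion (qp c) 0)"
  have Q: "qp c has_fps_expansion Q c" for c
    unfolding Q_def by (rule has_fps_expansion_qp)
  have Q0: "fps_nth (Q c) 0 = 1" for c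
    by (simp add: Q_def fps_expansion_def)
  define D where "D = (\<lambda>c. (Q c * Q (inverse c)) ^ 2)"
  have D0: "fps_nth (D c) 0 = 1" for c
    by (simp add: D_def Q0 power2_eq_square)
  have Qk0: "fps_nth (Q 1 ^ j) 0 = 1" for j
    by (induction j) (simp_all add: Q0)
  have D: "(\<lambda>q. (qp c q * qp (inverse c) q) ^ 2) has_fps_expansion D c" for c
    unfolding D_def by (intro has_fps_expansion_power has_fps_expansion_mult Q)
  have K: "(\<lambda>q. qp 1 q ^ j) has_fps_expansion Q 1 ^ j" for j
    by (intro has_fps_expansion_power Q)
  have "(\<lambda>q. qp 1 q ^ 4 * inverse ((qp c q * qp (inverse c) q) ^ 2) * inverse (qp 1 q ^ k)) has_fps_expansion
      Q 1 ^ 4 * inverse (D c) * inverse (Q 1 ^ k)" for c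
    by (rule has_fps_expansion_mult[OF has_fps_expansion_mult[OF K has_fps_expansion_inverse[OF D]]
          has_fps_expansion_inverse[OF K]]) (simp_all add: D0 Qk0)
  then have "Phi k c has_fps_expansion Q 1 ^ 4 * inverse (D c) * inverse (Q 1 ^ k)" for c
    by (simp add: Phi_def[abs_def] divide_inverse)
  then have eq: "Phi_coeff k c n = fps_nth (Q 1 ^ 4 * inverse (D c) * inverse (Q 1 ^ k)) n" for c
    unfolding Phi_coeff_def by (rule fps_nth_fps_expansion[symmetric])
  have lQ: "laurent_fps Q" unfolding Q_def by (rule laurent_fps_qp)
  then have "laurent_fps (\<lambda>c. Q (inverse c))"
    unfolding laurent_fps_def by (auto intro: laurent_poly_inverse_arg)
  with lQ have lD: "laurent_fps D"
    unfolding D_def by (intro laurent_fps_power laurent_fps_mult)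
  have const: "laurent_fps (\<lambda>_. B)" for B
    unfolding laurent_fps_def by (auto intro: laurent_poly_const)
  have "laurent_fps (\<lambda>c. Q 1 ^ 4 * inverse (D c) * inverse (Q 1 ^ k))"
    by (intro laurent_fps_mult const laurent_fps_inverse lD D0)
  then show ?thesis
    unfolding eq laurent_fps_def by blast
qed

text \<open>The hypotheses describe the annulus |q| < |c| < 1/|q| of the expansion; multiplied out
  they say |cq| < 1 and |q/c| < 1, which keeps all factors away from 0.\<close>

lemma Phi_denominator_nonzero:
  assumes "c \<noteq> 0" "norm q < norm c" "norm q < 1 / norm c"
  shows "norm q < 1" "qp c q \<noteq> 0" "qp (inverse c) q \<noteq> 0" "qp 1 q \<noteq> 0"
proof -
  have "norm c > 0" using assms(1) by simp
  then have 1: "norm (c * q) < 1" "norm (inverse c * q) < 1"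
    using assms(2,3) by (simp_all add: norm_mult norm_inverse norm_divide inverse_eq_divide pos_less_divide_eq pos_divide_less_eq mult.commute)
  show q: "norm q < 1"
  proof (cases "norm c \<le> 1")
    case False
    then have "1 / norm c \<le> 1" using \<open>norm c > 0\<close> by (simp add: divide_le_eq)
    with assms(3) show ?thesis by linarith
  qed (use assms(2) in linarith)
  show "qp c q \<noteq> 0" "qp (inverse c) q \<noteq> 0" "qp 1 q \<noteq> 0"
    using 1 q qp_nonzero[of q c] qp_nonzero[of q "inverse c"] qp_nonzero[of q 1] by auto
qed

lemma holomorphic_on_Phi:
  assumes "c \<noteq> 0"
  shows "Phi k c holomorphic_on ball 0 (min (norm c) (1 / norm c))"
proof -
  have nz: "norm q < 1" "qp c q \<noteq> 0" "qp (inverse c) q \<noteq> 0" "qp 1 q \<noteq> 0"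
    if "q \<in> ball 0 (min (norm c) (1 / norm c))" for q
    using that by (intro Phi_denominator_nonzero[OF assms]; simp)+
  then have "ball 0 (min (norm c) (1 / norm c)) \<subseteq> ball (0::complex) 1" by auto
  then have "qp x holomorphic_on ball 0 (min (norm c) (1 / norm c))" for x
    using holomorphic_on_qp_ball holomorphic_on_subset by blast
  then show ?thesis
    unfolding Phi_def[abs_def] using nz by (intro holomorphic_intros) auto
qed

lemma Phi_sums:
  assumes "c \<noteq> 0" "norm q < norm c" "norm q < 1 / norm c"
  shows "(\<lambda>n. Phi_coeff k c n * q ^ n) sums Phi k c q"
  using holomorphic_power_series[OF holomorphic_on_Phi[OF assms(1)], of q k] assms
  by (simp add: Phi_coeff_def)

lemma fk_expansion_factor:
  "qpar ((of_nat n - of_nat k / 24) * \<tau>) = qpar (- (of_nat k * \<tau> / 24)) * qpar \<tau> ^ n"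
  unfolding qpar_power qpar_add[symmetric] by (rule arg_cong[of _ _ qpar]) (simp add: algebra_simps)

lemma is_fk_expansion_exists: "\<exists>a. is_fk_expansion k a"
proof -
  have "\<forall>n. \<exists>S a. finite S \<and> (\<forall>c. c \<noteq> 0 \<longrightarrow> Phi_coeff k c n = (\<Sum>m\<in>S. a m * c powi m))"
    using laurent_poly_Phi_coeff unfolding laurent_poly_def by blast
  then obtain S where "\<forall>n. \<exists>a. finite (S n) \<and> (\<forall>c. c \<noteq> 0 \<longrightarrow> Phi_coeff k c n = (\<Sum>m\<in>S n. a m * c powi m))"
    by (metis choice)
  then obtain b where b: "\<And>n. finite (S n)" "\<And>n c. c \<noteq> 0 \<Longrightarrow> Phi_coeff k c n = (\<Sum>m\<in>S n. b n m * c powi m)"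
    by (metis choice)
  \<comment> \<open>Setting the coefficients to 0 outside \<open>S n\<close> makes the support
    finite and reconciles the sum over the support, used in \<open>is_fk_expansion\<close>, with the
    sum over \<open>S n\<close>.\<close>
  define a where "a = (\<lambda>m n. if m \<in> S n then b n m else 0)"
  have sub: "{m. a m n \<noteq> 0} \<subseteq> S n" for n by (auto simp: a_def)
  have eq: "(\<Sum>m | a m n \<noteq> 0. a m n * c powi m) = Phi_coeff k c n" if "c \<noteq> 0" for c n
  proof -
    have "(\<Sum>m | a m n \<noteq> 0. a m n * c powi m) = (\<Sum>m\<in>S n. a m n * c powi m)"
      using sub b(1) by (intro sum.mono_neutral_left) auto
    also have "\<dots> = (\<Sum>m\<in>S n. b n m * c powi m)"
      by (intro sum.cong) (auto simp: a_def)
    finally show ?thesis using b(2)[OF that] by simp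
  qed
  have "is_fk_expansion k a"
    unfolding is_fk_expansion_def
  proof (intro conjI allI impI)
    show "finite {m. a m n \<noteq> 0}" for n
      using sub b(1) by (rule finite_subset)
    fix w \<tau> assume \<tau>: "Im \<tau> > 0" and w: "\<bar>Im w\<bar> < Im \<tau>"
    have "2 * pi * (- Im w) < 2 * pi * Im \<tau>" "2 * pi * Im w < 2 * pi * Im \<tau>"
      using w by (intro mult_strict_left_mono; simp)+
    moreover have "1 / norm (qpar w) = exp (2 * pi * Im w)"
      by (simp add: norm_qpar exp_minus inverse_eq_divide)
    ultimately have "norm (qpar \<tau>) < norm (qpar w)" "norm (qpar \<tau>) < 1 / norm (qpar w)"
      by (simp_all add: norm_qpar)
    from sums_mult[OF Phi_sums[OF qpar_nonzero this, of k], of "qpar (- (of_nat k * \<tau> / 24))"]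
    show "(\<lambda>n. (\<Sum>m | a m n \<noteq> 0. a m n * qpar w powi m) * qpar ((of_nat n - of_nat k / 24) * \<tau>)) sums fk k w \<tau>"
      unfolding eq[OF qpar_nonzero] fk_expansion_factor fk_conv_Phi[OF \<tau>] by (simp add: mult_ac)
  qed
  then show ?thesis by blast
qed

section \<open>Uniqueness of the expansion of f_k and the integral formula for
  \<open>acoeff\<close>\<close>

lemma qpar_surj:
  assumes "q \<noteq> 0" "norm q < 1"
  obtains \<tau> where "Im \<tau> > 0" "qpar \<tau> = q"
proof -
  define \<tau> where "\<tau> = Ln q / (2 * of_real pi * \<i>)"
  have "qpar \<tau> = q" using assms(1) by (simp add: \<tau>_def qpar_def)
  moreover from this have "exp (- 2 * pi * Im \<tau>) < 1" using assms(2) norm_qpar[of \<tau>] by simp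
  then have "Im \<tau> > 0" by (simp add: zero_less_mult_iff)
  ultimately show ?thesis using that by blast
qed

text \<open>For real w the expansion is available at every q in the punctured unit disc, since
  \<open>qpar\<close> maps the upper half plane onto it. Continuity supplies q = 0, and a power
  series determines its coefficients.\<close>

lemma is_fk_expansion_coeff:
  assumes a: "is_fk_expansion k a"
  shows "(\<Sum>m | a m n \<noteq> 0. a m n * qpar (of_real w) powi m) = Phi_coeff k (qpar (of_real w)) n"
proof -
  define c where "c = qpar (of_real w)"
  have c: "c \<noteq> 0" "norm c = 1" by (simp_all add: c_def norm_qpar)
  define P where "P = (\<lambda>n. \<Sum>m | a m n \<noteq> 0. a m n * c powi m)"
  have sums: "(\<lambda>n. P n * q ^ n) sums Phi k c q" if q: "q \<noteq> 0" "norm q < 1" for q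
  proof -
    obtain \<tau> where \<tau>: "Im \<tau> > 0" "qpar \<tau> = q" using qpar_surj[OF q] by blast
    have "(\<lambda>n. P n * qpar ((of_nat n - of_nat k / 24) * \<tau>)) sums fk k (of_real w) \<tau>"
      using a \<tau>(1) unfolding is_fk_expansion_def P_def c_def by simp
    then have "(\<lambda>n. qpar (- (of_nat k * \<tau> / 24)) * (P n * q ^ n)) sums (qpar (- (of_nat k * \<tau> / 24)) * Phi k c q)"
      unfolding fk_expansion_factor fk_conv_Phi[OF \<tau>(1)] \<tau>(2) c_def by (simp add: mult_ac)
    then show ?thesis by (subst (asm) sums_mult_iff) auto
  qed
  have "fps_conv_radius (Abs_fps P) \<ge> norm (1 / 2 :: complex)"
    unfolding fps_conv_radius_def using sums[of "1 / 2"]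
    by (intro conv_radius_geI) (auto simp: sums_iff fps_nth_Abs_fps)
  then have rad: "fps_conv_radius (Abs_fps P) > 0"
    by (simp add: ) (metis ereal_less(2) less_le_trans half_gt_zero_iff zero_less_one)
  have ev: "eval_fps (Abs_fps P) q = Phi k c q" if "q \<noteq> 0" "norm q < 1" for q
    using sums[OF that] by (simp add: eval_fps_def sums_iff)
  have hol: "Phi k c holomorphic_on ball 0 1"
    using holomorphic_on_Phi[OF c(1), of k] c(2) by simp
  have "(Phi k c \<longlongrightarrow> Phi k c 0) (at 0)"
    using holomorphic_on_imp_continuous_on[OF hol] by (simp add: continuous_on_eq_continuous_at continuous_at)
  moreover have "(eval_fps (Abs_fps P) \<longlongrightarrow> eval_fps (Abs_fps P) 0) (at 0)"
    using continuous_eval_fps[of 0 "Abs_fps P" UNIV] rad by (simp add: continuous_at zero_ereal_def)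
  then have "(Phi k c \<longlongrightarrow> eval_fps (Abs_fps P) 0) (at 0)"
    by (rule Lim_transform_eventually) (auto simp: eventually_at ev intro!: exI[of _ 1])
  ultimately have "eval_fps (Abs_fps P) 0 = Phi k c 0"
    using LIM_unique by blast
  then have "eval_fps (Abs_fps P) q = Phi k c q" if "norm q < 1" for q
    using ev[of q] that by (cases "q = 0") auto
  then have "Phi k c has_fps_expansion Abs_fps P"
    unfolding has_fps_expansion_def using rad eventually_nhds_in_open[of "ball 0 1" "0::complex"]
    by (auto elim!: eventually_mono)
  from fps_nth_fps_expansion[OF this, of n] show ?thesis
    by (simp add: P_def c_def Phi_coeff_def)
qed

lemma qpar_powi: "qpar a powi m = qpar (of_int m * a)"
  by (simp add: qpar_def exp_power_int mult_ac)

lemma has_integral_qpar_int: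
  "((\<lambda>w::real. qpar (of_int j * of_real w)) has_integral (if j = 0 then 1 else 0)) {-1/2..1/2}"
proof (cases "j = 0")
  case True
  then show ?thesis using has_integral_const_real[of "1::complex" "-1/2" "1/2"] by simp
next
  case False
  define d where "d = 2 * of_real pi * \<i> * (of_int j :: complex)"
  have d: "d \<noteq> 0" using False by (simp add: d_def)
  have e: "qpar (of_int j * of_real w) = exp (d * of_real w)" for w
    by (simp add: qpar_def d_def mult_ac)
  have "((\<lambda>w. exp (d * of_real w)) has_integral (exp (d * of_real (1/2)) / d - exp (d * of_real (-1/2)) / d)) {-1/2..1/2}"
  proof (rule fundamental_theorem_of_calculus)
    fix w :: real
    have "((\<lambda>z. exp (d * z) / d) has_field_derivative exp (d * of_real w)) (at (of_real w))"
      using d by (auto intro!: derivative_eq_intros)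
    from has_vector_derivative_real_field[OF this]
    show "((\<lambda>w. exp (d * of_real w) / d) has_vector_derivative exp (d * of_real w)) (at w within {-1/2..1/2})"
      by (rule has_vector_derivative_at_within)
  qed simp
  moreover have "exp (d * of_real (1/2)) = exp (d * of_real (-1/2))"
  proof -
    have "exp (d * of_real (1/2)) = exp (d * of_real (-1/2)) * exp d"
      by (simp flip: exp_add)
    also have "exp d = 1" using e[of 1] by simp
    finally show ?thesis by simp
  qed
  ultimately show ?thesis using False by (simp add: e)
qed

text \<open>Orthogonality of the exponentials on [-1/2, 1/2]. The integrand does not mention
  \<open>a\<close>, which is what makes the expansion unique.\<close>

lemma is_fk_expansion_integral:
  assumes a: "is_fk_expansion k a"
  shows "((\<lambda>w::real. Phi_coeff k (qpar (of_real w)) n * qpar (- of_int m * of_real w)) has_integral a m n) {-1/2..1/2}"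
proof -
  have fin: "finite {m. a m n \<noteq> 0}" using a by (simp add: is_fk_expansion_def)
  have "((\<lambda>w::real. \<Sum>j | a j n \<noteq> 0. a j n * qpar (of_int (j - m) * of_real w)) has_integral
      (\<Sum>j | a j n \<noteq> 0. a j n * (if j - m = 0 then 1 else 0))) {-1/2..1/2}"
    by (intro has_integral_sum fin has_integral_mult_right has_integral_qpar_int)
  moreover have "(\<Sum>j | a j n \<noteq> 0. a j n * (if j - m = 0 then 1 else 0)) = a m n"
    using fin by (simp add: sum.delta' mult_delta_right if_distrib cong: if_cong)
  moreover have "(\<Sum>j | a j n \<noteq> 0. a j n * qpar (of_int (j - m) * of_real w)) =
      Phi_coeff k (qpar (of_real w)) n * qpar (- of_int m * of_real w)" for w :: real
    unfolding is_fk_expansion_coeff[OF a, symmetric] sum_distrib_right qpar_powi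
    by (intro sum.cong refl) (simp add: mult.assoc ring_distribs flip: qpar_add)
  ultimately show ?thesis by simp
qed

lemma acoeff_expansion: "is_fk_expansion k (acoeff k)"
  unfolding acoeff_def
proof (rule theI'[of "is_fk_expansion k"])
  obtain a where a: "is_fk_expansion k a" using is_fk_expansion_exists by blast
  have "b = a" if "is_fk_expansion k b" for b
    using has_integral_unique[OF is_fk_expansion_integral[OF that] is_fk_expansion_integral[OF a]] by blast
  with a show "\<exists>!a. is_fk_expansion k a" by blast
qed

section \<open>The minor arc\<close>

text \<open>This is g in the variables c = zeta and q. It is kept apart from the eta power because
  the two factors of \<open>Phi\<close> behave differently: for |c| = 1 it grows at most
  polynomially in 1/(1 - |q|).\<close>

definition theta_quot :: "complex \<Rightarrow> complex \<Rightarrow> complex" where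
  "theta_quot c q = qp 1 q ^ 2 / (qp c q * qp (inverse c) q)"

lemma Phi_conv_theta_quot: "Phi k c q = theta_quot c q ^ 2 * inverse (qp 1 q) ^ k"
proof -
  have eq: "(a\<^sup>2 / d)\<^sup>2 = a ^ 4 / d\<^sup>2" for a d :: complex
    by (simp add: power_divide flip: power_mult)
  show ?thesis
    unfolding Phi_def theta_quot_def eq by (simp add: divide_inverse power_inverse)
qed

lemma summable_power_divide_Suc:
  fixes x :: real
  assumes "0 \<le> x" "x < 1"
  shows "summable (\<lambda>r. x ^ Suc r / real (Suc r))"
proof (rule summable_comparison_test'[where N = 0])
  show "summable (\<lambda>r. x ^ Suc r)"
    using assms by (simp only: summable_Suc_iff) (simp add: summable_geometric)
  fix r
  have "x ^ Suc r / real (Suc r) \<le> x ^ Suc r / 1"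
    using assms by (intro divide_left_mono) auto
  then show "norm (x ^ Suc r / real (Suc r)) \<le> x ^ Suc r"
    using assms by (simp del: power_Suc of_nat_Suc)
qed

text \<open>Clearing the denominator leaves an expression affine in Re u, with slope 1 - 2 \<rho>
  where \<rho> = norm u. Its values at the ends Re u = -\<rho> and Re u = \<rho> are \<rho>^2 +
  \<rho>^3 and \<rho>(1 - \<rho>)(2 - \<rho>), both nonnegative; the sign of the slope decides which
  end is used.\<close>

lemma Re_divide_one_minus_ge:
  fixes u :: complex
  assumes "norm u < 1"
  shows "- norm u \<le> Re (u / (1 - u))"
proof -
  define \<rho> a where "\<rho> = norm u" and "a = Re u"
  have \<rho>: "0 \<le> \<rho>" "\<rho> < 1" "\<rho>\<^sup>2 = a\<^sup>2 + (Im u)\<^sup>2"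
    using assms by (simp_all add: \<rho>_def a_def cmod_power2)
  have a: "\<bar>a\<bar> \<le> \<rho>" unfolding \<rho>_def a_def by (rule abs_Re_le_cmod)
  have "0 \<le> a + \<rho> - \<rho>\<^sup>2 - 2 * \<rho> * a + \<rho> ^ 3"
  proof (cases "\<rho> \<le> 1 / 2")
    case True
    then have "0 \<le> (a + \<rho>) * (1 - 2 * \<rho>)" using a by (intro mult_nonneg_nonneg) auto
    moreover have "0 \<le> \<rho>\<^sup>2 + \<rho> ^ 3" using \<rho> by simp
    ultimately show ?thesis by (simp add: algebra_simps power2_eq_square)
  next
    case False
    then have "0 \<le> (\<rho> - a) * (2 * \<rho> - 1)" using a by (intro mult_nonneg_nonneg) auto
    moreover have "0 \<le> \<rho> * (1 - \<rho>) * (2 - \<rho>)" using \<rho> by (intro mult_nonneg_nonneg) auto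
    ultimately show ?thesis by (simp add: algebra_simps power2_eq_square power3_eq_cube)
  qed
  then have key: "- \<rho> * ((1 - a)\<^sup>2 + (Im u)\<^sup>2) \<le> a * (1 - a) - (Im u)\<^sup>2"
    using \<rho>(3) by (simp add: algebra_simps power2_eq_square power3_eq_cube)
  have "Re u \<noteq> 1 \<or> Im u \<noteq> 0" using assms by (auto simp: complex_eq_iff cmod_def)
  then have "(1 - a)\<^sup>2 + (Im u)\<^sup>2 > 0" by (auto simp: a_def sum_power2_gt_zero_iff)
  then show ?thesis
    using key by (simp add: Re_divide a_def[symmetric] \<rho>_def[symmetric] le_divide_eq power2_eq_square)
qed

text \<open>In the Lambert series of the logarithm the products combine to c^r + c^(-r) - 2, which
  for norm c = 1 is a real number in [-4, 0]. A one-sided bound on Re (v / (1 - v)) then suffices,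
  and the majorant sums to -4 ln (1 - norm q), uniformly in c.\<close>

lemma qp_theta_quotient_bound:
  assumes q: "norm q < 1" and c: "norm c = 1"
  shows "norm (qp 1 q ^ 2 / (qp c q * qp (inverse c) q)) \<le> (1 / (1 - norm q)) ^ 4"
proof -
  define t where "t = (\<lambda>c r. (c * q) ^ Suc r / (of_nat (Suc r) * (1 - q ^ Suc r)))"
  have cq: "norm (1 * q) < 1" "norm (c * q) < 1" "norm (inverse c * q) < 1"
    using q c by (simp_all add: norm_mult norm_inverse)
  have L: "summable (\<lambda>r. norm (t c r))" "qp c q = exp (- suminf (t c))" if "norm (c * q) < 1" for c
    unfolding t_def by (rule qp_eq_exp_Lambert[OF q that])+
  have sm: "summable (t 1)" "summable (t c)" "summable (t (inverse c))"
    by (rule summable_norm_cancel[OF L(1)], rule cq)+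
  define u where "u = (\<lambda>r. t c r + t (inverse c) r - 2 * t 1 r)"
  have su: "summable u"
    unfolding u_def by (intro summable_add summable_diff summable_mult sm)
  have "qp 1 q ^ 2 / (qp c q * qp (inverse c) q) =
      exp (suminf (t c) + suminf (t (inverse c)) - 2 * suminf (t 1))"
    unfolding L(2)[OF cq(1)] L(2)[OF cq(2)] L(2)[OF cq(3)]
    by (simp add: exp_diff exp_add exp_minus exp_double divide_inverse power_inverse)
  also have "suminf (t c) + suminf (t (inverse c)) - 2 * suminf (t 1) = suminf u"
    unfolding u_def using sm
    by (simp add: suminf_add[symmetric] suminf_diff[symmetric] suminf_mult[symmetric] summable_add summable_mult)
  finally have "norm (qp 1 q ^ 2 / (qp c q * qp (inverse c) q)) = exp (Re (suminf u))"
    by (simp add: norm_exp)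
  also have "Re (suminf u) = (\<Sum>r. Re (u r))"
    using Re_suminf[OF su] .
  also have "\<dots> \<le> (\<Sum>r. 4 * (norm q ^ Suc r / real (Suc r)))"
  proof (rule suminf_le)
    show "summable (\<lambda>r. Re (u r))" using su by (rule summable_Re)
    have "summable (\<lambda>r. norm q ^ Suc r / real (Suc r))"
      using q by (intro summable_power_divide_Suc) auto
    then show "summable (\<lambda>r. 4 * (norm q ^ Suc r / real (Suc r)))" by (rule summable_mult)
    fix r
    define v where "v = q ^ Suc r"
    define e where "e = 2 - 2 * Re (c ^ Suc r)"
    have v: "norm v < 1" "norm v = norm q ^ Suc r"
      using q by (simp_all add: v_def norm_power power_less_one_iff del: power_Suc)
    have "\<bar>Re (c ^ Suc r)\<bar> \<le> 1"
      using abs_Re_le_cmod[of "c ^ Suc r"] c by (simp add: norm_power del: power_Suc)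
    then have e: "0 \<le> e" "e \<le> 4" by (auto simp: e_def)
    have "inverse c = cnj c"
      using c by (simp add: inverse_complex_def complex_eq_iff cmod_def)
    moreover have "c ^ Suc r + cnj c ^ Suc r = of_real (2 * Re (c ^ Suc r))"
      using complex_add_cnj[of "c ^ Suc r"] by (simp only: complex_cnj_power)
    ultimately have "c ^ Suc r + inverse c ^ Suc r - 2 = of_real (- e)"
      by (simp only: e_def) (simp del: power_Suc)
    moreover have "u r = (c ^ Suc r + inverse c ^ Suc r - 2) * (v / (1 - v)) / of_nat (Suc r)"
      unfolding u_def t_def v_def power_mult_distrib by (simp add: field_simps add_divide_distrib diff_divide_distrib del: power_Suc of_nat_Suc)
    ultimately have ur: "u r = of_real (- e) * (v / (1 - v)) / of_nat (Suc r)"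
      by (simp only:)
    have "Re (u r) = - e * Re (v / (1 - v)) / real (Suc r)"
    proof -
      have "Re (of_real (- e) * w) = - e * Re w" for w :: complex by simp
      then show ?thesis unfolding ur Re_divide_of_nat by (simp only:)
    qed
    also have "\<dots> \<le> 4 * norm v / real (Suc r)"
    proof (intro divide_right_mono)
      have "e * (- Re (v / (1 - v))) \<le> e * norm v"
        using Re_divide_one_minus_ge[OF v(1)] e by (intro mult_left_mono) auto
      also have "\<dots> \<le> 4 * norm v" using e by (intro mult_right_mono) auto
      finally show "- e * Re (v / (1 - v)) \<le> 4 * norm v" by simp
    qed simp
    finally show "Re (u r) \<le> 4 * (norm q ^ Suc r / real (Suc r))" by (simp add: v(2))
  qed
  also have "(\<Sum>r. 4 * (norm q ^ Suc r / real (Suc r))) = - 4 * ln (1 - norm q)"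
  proof (cases "q = 0")
    case False
    have "ln (1 - norm q) = (\<Sum>n. (- 1) ^ n * (1 / real (n + 1)) * ((1 - norm q) - 1) ^ Suc n)"
      using q False norm_ge_zero[of q] by (intro ln_series) linarith+
    also have "(\<lambda>n. (- 1) ^ n * (1 / real (n + 1)) * ((1 - norm q) - 1) ^ Suc n) = (\<lambda>n. (- 1) * (norm q ^ Suc n / real (Suc n)))"
    proof
      fix n
      have "(- 1 :: real) ^ n * (- norm q) ^ Suc n = - (norm q ^ Suc n)"
        by (simp add: power_mult_distrib[symmetric])
      then show "(- 1) ^ n * (1 / real (n + 1)) * ((1 - norm q) - 1) ^ Suc n = (- 1) * (norm q ^ Suc n / real (Suc n))"
        by (simp del: power_Suc add: field_simps)
    qed
    finally have ln: "ln (1 - norm q) = (\<Sum>n. (- 1) * (norm q ^ Suc n / real (Suc n)))" .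
    have "summable (\<lambda>r. norm q ^ Suc r / real (Suc r))"
      using q by (intro summable_power_divide_Suc) auto
    then show ?thesis unfolding ln by (simp only: suminf_mult)
  qed simp
  finally have "norm (qp 1 q ^ 2 / (qp c q * qp (inverse c) q)) \<le> exp (- 4 * ln (1 - norm q))" by simp
  also have "\<dots> = (exp (- ln (1 - norm q))) ^ 4"
    by (simp flip: exp_of_nat_mult)
  also have "exp (- ln (1 - norm q)) = 1 / (1 - norm q)"
    using q by (simp add: exp_minus exp_ln divide_inverse)
  finally show ?thesis .
qed

text \<open>Every Lambert term but the first is bounded through |q| alone by 1/(n^2 x); the full sum
  of these bounds is pi^2/(6x). The first term is kept exactly, because there the argument of q
  enters, and the -1 removes its share from the sum over squares.\<close>

lemma norm_inverse_qp_1_le: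
  assumes "Re z > 0"
  shows "norm (inverse (qp 1 (exp (- z)))) \<le> exp ((pi\<^sup>2 / 6 - 1) / Re z + 1 / norm (exp z - 1))"
proof -
  define q where "q = exp (- z)"
  define x where "x = Re z"
  have x: "x > 0" using assms by (simp add: x_def)
  have nq: "norm q = exp (- x)" by (simp add: q_def x_def norm_exp)
  have q: "norm q < 1" using x by (simp add: nq)
  define t where "t = (\<lambda>r. (1 * q) ^ Suc r / (of_nat (Suc r) * (1 - q ^ Suc r)))"
  have "norm (1 * q) < 1" using q by simp
  then have L: "summable (\<lambda>r. norm (t r))" "qp 1 q = exp (- suminf t)"
    unfolding t_def by (rule qp_eq_exp_Lambert[OF q])+
  define b where "b = (\<lambda>r. (1 / (real (Suc r))\<^sup>2) / x + (if r = 0 then 1 / norm (exp z - 1) - 1 / x else 0))"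
  have "(\<lambda>r. (1 / (real (Suc r))\<^sup>2) / x) sums (pi\<^sup>2 / 6 / x)"
    using sums_divide[OF inverse_squares_sums, of x] by (simp add: add.commute)
  then have b: "b sums (pi\<^sup>2 / 6 / x + (1 / norm (exp z - 1) - 1 / x))"
    unfolding b_def by (rule sums_add) (rule sums_single[of 0 "\<lambda>_. 1 / norm (exp z - 1) - 1 / x"])
  have tb: "norm (t r) \<le> b r" for r
  proof (cases "r = 0")
    case True
    have "exp z - 1 = exp z * (1 - q)" by (simp add: q_def ring_distribs flip: exp_add)
    then have "norm (exp z - 1) = exp x * norm (1 - q)" by (simp add: norm_mult norm_exp x_def)
    moreover have "norm (t 0) = exp (- x) / norm (1 - q)" by (simp add: t_def norm_divide nq)
    ultimately show ?thesis using True by (simp add: b_def exp_minus field_simps)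
  next
    case False
    define n where "n = Suc r"
    have n: "real n > 0" by (simp add: n_def)
    have nqn: "norm q ^ n = exp (- (real n * x))" by (simp add: nq flip: exp_of_nat_mult)
    have "1 - norm q ^ n \<le> norm (1 - q ^ n)"
      using norm_triangle_ineq2[of 1 "q ^ n"] by (simp add: norm_power)
    moreover have pos: "norm q ^ n < 1" using n x by (simp add: nqn)
    ultimately have "norm q ^ n / (real n * norm (1 - q ^ n)) \<le> norm q ^ n / (real n * (1 - norm q ^ n))"
      using n by (intro divide_left_mono mult_left_mono mult_pos_pos) auto
    then have "norm (t r) \<le> norm q ^ n / (real n * (1 - norm q ^ n))"
      unfolding t_def n_def[symmetric] norm_divide norm_mult[of "of_nat n"] norm_power norm_of_nat mult_1 .
    also have "\<dots> = 1 / (real n * (exp (real n * x) - 1))"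
      using n pos by (simp add: nqn exp_minus field_simps)
    also have "\<dots> \<le> 1 / (real n * (real n * x))"
    proof -
      have "real n * x > 0" using n x by simp
      moreover have le: "real n * x \<le> exp (real n * x) - 1"
        using exp_ge_add_one_self[of "real n * x"] by linarith
      ultimately have "exp (real n * x) - 1 > 0" by linarith
      then show ?thesis using le n x \<open>real n * x > 0\<close>
        by (intro divide_left_mono mult_left_mono mult_pos_pos) simp_all
    qed
    also have "\<dots> = b r" using False by (simp add: b_def n_def power2_eq_square)
    finally show ?thesis .
  qed
  have "inverse (qp 1 q) = exp (suminf t)"
    unfolding L(2) by (simp add: exp_minus)
  then have "norm (inverse (qp 1 q)) = exp (Re (suminf t))" by (simp add: norm_exp)
  also have "Re (suminf t) \<le> norm (suminf t)" by (rule complex_Re_le_cmod)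
  also have "\<dots> \<le> (\<Sum>r. norm (t r))" using L(1) by (rule summable_norm)
  also have "\<dots> \<le> suminf b" using tb L(1) b by (intro suminf_le) (auto simp: sums_iff)
  also have "suminf b = (pi\<^sup>2 / 6 - 1) / x + 1 / norm (exp z - 1)"
    using b by (simp add: sums_iff diff_divide_distrib)
  finally show ?thesis by (simp add: q_def x_def)
qed

text \<open>The squared norm equals (exp x - 1)^2 + 2 exp x (1 - cos y). The first part is at least
  x^2, and |y| >= x makes the second at least x^2/2; this is the origin of 3/2.\<close>

lemma norm_exp_minus_one_ge:
  assumes x: "0 < x" "x \<le> 1" and y: "x \<le> \<bar>y\<bar>" "\<bar>y\<bar> \<le> pi"
  shows "sqrt (3 / 2) * x \<le> norm (exp (Complex x y) - 1)"
proof -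
  have "cos y \<le> cos x"
    using cos_monotone_0_pi_le[of x "\<bar>y\<bar>"] x y by simp
  moreover have "cos x \<le> 1 - x\<^sup>2 / 4"
  proof -
    obtain t where "cos x = (\<Sum>m<4. cos_coeff m * x ^ m) + (cos (t + 1 / 2 * real 4 * pi) / fact 4) * x ^ 4"
      using Maclaurin_cos_expansion[of x 4] by blast
    also have "(\<Sum>m<4. cos_coeff m * x ^ m) = 1 - x\<^sup>2 / 2"
    proof -
      have "{..<4} = {0, 1, 2, 3::nat}" by auto
      moreover have "cos_coeff 0 = 1" "cos_coeff 1 = 0" "cos_coeff 2 = - 1 / 2" "cos_coeff 3 = 0"
        by (simp_all add: cos_coeff_def fact_numeral)
      ultimately show ?thesis by simp
    qed
    also have "(cos (t + 1 / 2 * real 4 * pi) / fact 4) * x ^ 4 \<le> (1 / fact 4) * x ^ 4"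
      by (intro mult_right_mono divide_right_mono) auto
    also have "x ^ 4 \<le> x ^ 2" using x by (intro power_decreasing) auto
    then have "(1 / fact 4) * x ^ 4 \<le> x\<^sup>2 / 4"
    proof -
      have f: "fact 4 = (24::real)" by (simp add: fact_numeral)
      show ?thesis unfolding f using \<open>x ^ 4 \<le> x ^ 2\<close> zero_le_power2[of x] by linarith
    qed
    finally show ?thesis by simp
  qed
  ultimately have cos: "x\<^sup>2 / 2 \<le> 2 * (1 - cos y)" by simp
  have ex: "x \<le> exp x - 1" "1 \<le> exp x" using exp_ge_add_one_self[of x] x by linarith+
  have "(norm (exp (Complex x y) - 1))\<^sup>2 = (exp x * cos y - 1)\<^sup>2 + (exp x * sin y)\<^sup>2"
    by (simp add: cmod_power2 Re_exp Im_exp)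
  also have "\<dots> = (exp x)\<^sup>2 * ((sin y)\<^sup>2 + (cos y)\<^sup>2) + 1 - 2 * exp x * cos y"
  proof -
    have "(E * C - 1)\<^sup>2 + (E * S)\<^sup>2 = E\<^sup>2 * (S\<^sup>2 + C\<^sup>2) + 1 - 2 * E * C" for E C S :: real
      by (simp add: power2_eq_square algebra_simps)
    then show ?thesis .
  qed
  also have "\<dots> = (exp x - 1)\<^sup>2 + exp x * (2 * (1 - cos y))"
    by (simp add: power2_eq_square algebra_simps)
  also have "\<dots> \<ge> x\<^sup>2 + 1 * (x\<^sup>2 / 2)"
    using ex x cos by (intro add_mono power_mono mult_mono) auto
  finally have "(sqrt (3 / 2) * x)\<^sup>2 \<le> (norm (exp (Complex x y) - 1))\<^sup>2"
    by (simp add: power_mult_distrib)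
  then show ?thesis by (rule power2_le_imp_le) simp
qed

lemma Phi_bound:
  assumes "norm q < 1" "norm c = 1"
  shows "norm (Phi k c q) \<le> (1 / (1 - norm q)) ^ 8 * norm (inverse (qp 1 q)) ^ k"
proof -
  have "Phi k c q = (qp 1 q ^ 2 / (qp c q * qp (inverse c) q)) ^ 2 * inverse (qp 1 q) ^ k"
    using Phi_conv_theta_quot[of k c q] by (simp only: theta_quot_def)
  then have "norm (Phi k c q) = norm (qp 1 q ^ 2 / (qp c q * qp (inverse c) q)) ^ 2 * norm (inverse (qp 1 q)) ^ k"
    by (simp only: norm_mult norm_power)
  also have "\<dots> \<le> ((1 / (1 - norm q)) ^ 4) ^ 2 * norm (inverse (qp 1 q)) ^ k"
    using qp_theta_quotient_bound[OF assms] by (intro mult_right_mono power_mono) auto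
  finally show ?thesis by (simp flip: power_mult)
qed

text \<open>On the minor arc the first Lambert term contributes at most sqrt(2/3)/x, where the bound
  through |q| alone allows 1/x. The difference is the saving per factor of eta.\<close>

definition minor_gain :: real where "minor_gain = 1 - sqrt (2 / 3)"

lemma minor_gain_pos: "minor_gain > 0"
  by (simp add: minor_gain_def)

lemma Phi_minor_arc:
  assumes x: "0 < x" "x \<le> 1" and y: "x \<le> \<bar>y\<bar>" "\<bar>y\<bar> \<le> pi" and c: "norm c = 1"
  shows "norm (Phi k c (exp (- Complex x y))) \<le> (2 / x) ^ 8 * exp (real k * (pi\<^sup>2 / 6 - minor_gain) / x)"
proof -
  define q where "q = exp (- Complex x y)"
  have nq: "norm q = exp (- x)" by (simp add: q_def norm_exp)
  have q: "norm q < 1" using x by (simp add: nq)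
  \<comment> \<open>This leads to exp(-x) <= 1 - x/2 on (0, 1], which turns powers of 1/(1 - |q|)
    into powers of 2/x.\<close>
  have "(1 + x) * (1 - x / 2) \<ge> 1"
    using x mult_left_mono[of x 1 x] by (simp add: algebra_simps power2_eq_square)
  moreover have "1 + x \<le> exp x" by (rule exp_ge_add_one_self_aux)  (use x in auto)
  ultimately have "exp x * (1 - x / 2) \<ge> 1"
    using x mult_right_mono[of "1 + x" "exp x" "1 - x / 2"] by linarith
  then have "exp (- x) \<le> 1 - x / 2" by (simp add: exp_minus field_simps)
  then have 1: "1 / (1 - norm q) \<le> 2 / x" "0 \<le> 1 / (1 - norm q)"
    using x by (auto simp: nq field_simps)
  have "1 / norm (exp (Complex x y) - 1) \<le> 1 / (sqrt (3 / 2) * x)"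
    using norm_exp_minus_one_ge[OF x y] x by (intro divide_left_mono) (auto intro!: mult_pos_pos elim: less_le_trans[rotated])
  also have "\<dots> = sqrt (2 / 3) / x"
    by (simp add: real_sqrt_divide field_simps)
  finally have "1 / norm (exp (Complex x y) - 1) \<le> sqrt (2 / 3) / x" .
  then have "(pi\<^sup>2 / 6 - 1) / x + 1 / norm (exp (Complex x y) - 1) \<le> (pi\<^sup>2 / 6 - minor_gain) / x"
    by (simp add: minor_gain_def diff_divide_distrib)
  then have 2: "norm (inverse (qp 1 q)) \<le> exp ((pi\<^sup>2 / 6 - minor_gain) / x)"
    using norm_inverse_qp_1_le[of "Complex x y"] x unfolding q_def by (simp add: order_trans)
  have "norm (Phi k c q) \<le> (1 / (1 - norm q)) ^ 8 * norm (inverse (qp 1 q)) ^ k"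
    by (rule Phi_bound[OF q c])
  also have "\<dots> \<le> (2 / x) ^ 8 * exp ((pi\<^sup>2 / 6 - minor_gain) / x) ^ k"
    using 1 2 x by (intro mult_mono power_mono) auto
  also have "exp ((pi\<^sup>2 / 6 - minor_gain) / x) ^ k = exp (real k * (pi\<^sup>2 / 6 - minor_gain) / x)"
    by (simp flip: exp_of_nat_mult)
  finally show ?thesis by (simp add: q_def)
qed

section \<open>The Fourier coefficient in w and Cauchy's formula for \<open>acoeff\<close>\<close>

definition fourier_Phi :: "nat \<Rightarrow> int \<Rightarrow> complex \<Rightarrow> complex" where
  "fourier_Phi k m q = integral {-1/2..1/2} (\<lambda>w::real. Phi k (qpar (of_real w)) q * qpar (- of_int m * of_real w))"

lemma norm_qpar_real [simp]: "norm (qpar (of_real w)) = 1" "norm (qpar (- of_int m * of_real w)) = 1"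
  "norm (qpar (- (of_int m * of_real w))) = 1"
  by (simp_all add: norm_qpar)

text \<open>Cauchy's inequality on the circle of radius r. Uniformity over norm c = 1 provides the
  majorant for interchanging the sum over n with the integral over w.\<close>

lemma Phi_coeff_bound:
  assumes r: "0 < r" "r < 1"
  obtains B where "B \<ge> 0" "\<And>c n. norm c = 1 \<Longrightarrow> norm (Phi_coeff k c n) \<le> B / r ^ n"
proof -
  have "compact (sphere (0::complex) r)" by simp
  moreover have "continuous_on (sphere 0 r) (\<lambda>q. norm (inverse (qp 1 q)) ^ k)"
  proof -
    have "qp 1 holomorphic_on sphere 0 r"
      by (rule holomorphic_on_subset[OF holomorphic_on_qp_ball]) (use r in auto)
    then show ?thesis
      using r by (intro continuous_intros holomorphic_on_imp_continuous_on) (auto simp: qp_1_nonzero)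
  qed
  ultimately have "compact ((\<lambda>q. norm (inverse (qp 1 q)) ^ k) ` sphere 0 r)"
    by (rule compact_continuous_image[rotated])
  then have "bounded ((\<lambda>q. norm (inverse (qp 1 q)) ^ k) ` sphere 0 r)"
    by (rule compact_imp_bounded)
  then obtain M where "\<forall>y\<in>(\<lambda>q. norm (inverse (qp 1 q)) ^ k) ` sphere 0 r. norm y \<le> M"
    unfolding bounded_iff by blast
  then have M: "norm (inverse (qp 1 q)) ^ k \<le> M" if "norm q = r" for q
    using that by simp
  define B where "B = (1 / (1 - r)) ^ 8 * \<bar>M\<bar>"
  show ?thesis
  proof (rule that[of B])
    show "B \<ge> 0" using r by (simp add: B_def)
    fix c :: complex and n assume c: "norm c = 1"
    then have hol: "Phi k c holomorphic_on ball 0 1"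
      using holomorphic_on_Phi[of c k] by (cases "c = 0") auto
    have "norm ((deriv ^^ n) (Phi k c) 0) \<le> fact n * B / r ^ n"
    proof (rule Cauchy_inequality)
      show "Phi k c holomorphic_on ball 0 r"
        by (rule holomorphic_on_subset[OF hol]) (use r in auto)
      show "continuous_on (cball 0 r) (Phi k c)"
        by (rule continuous_on_subset[OF holomorphic_on_imp_continuous_on[OF hol]]) (use r in auto)
      fix q :: complex assume "norm (0 - q) = r"
      then have q: "norm q = r" by simp
      have "norm (Phi k c q) \<le> (1 / (1 - norm q)) ^ 8 * norm (inverse (qp 1 q)) ^ k"
        using q r by (intro Phi_bound c) auto
      also have "\<dots> \<le> (1 / (1 - r)) ^ 8 * \<bar>M\<bar>"
        using M[OF q] r q by (intro mult_mono) auto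
      finally show "norm (Phi k c q) \<le> B" by (simp add: B_def)
    qed (use r in auto)
    then show "norm (Phi_coeff k c n) \<le> B / r ^ n"
      by (simp add: Phi_coeff_def norm_divide divide_le_eq mult_ac)
  qed
qed

lemma acoeff_integral:
  "((\<lambda>w::real. Phi_coeff k (qpar (of_real w)) n * qpar (- of_int m * of_real w)) has_integral acoeff k m n) {-1/2..1/2}"
  by (rule is_fk_expansion_integral[OF acoeff_expansion])

lemma norm_acoeff_le:
  assumes "\<And>c. norm c = 1 \<Longrightarrow> norm (Phi_coeff k c n) \<le> D"
  shows "norm (acoeff k m n) \<le> D"
proof -
  have "norm (acoeff k m n) \<le> D * measure lborel {-1/2..1/2::real}"
    using assms by (intro has_integral_bound_real[OF _ finite.emptyI acoeff_integral[of k n m]])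
      (auto simp: norm_mult intro: order_trans[OF norm_ge_zero assms[of 1]])
  then show ?thesis by simp
qed

lemma acoeff_sums_fourier_Phi:
  assumes q: "norm q < 1"
  shows "(\<lambda>n. acoeff k m n * q ^ n) sums fourier_Phi k m q"
proof -
  \<comment> \<open>A radius strictly between |q| and 1 makes (|q|/r)^n a summable majorant.\<close>
  define r where "r = (1 + norm q) / 2"
  have r: "0 < r" "r < 1" "norm q < r" using q by (simp_all add: r_def add_pos_nonneg)
  obtain B where B: "B \<ge> 0" "\<And>c n. norm c = 1 \<Longrightarrow> norm (Phi_coeff k c n) \<le> B / r ^ n"
    using Phi_coeff_bound[OF r(1,2)] by blast
  define h where "h = (\<lambda>n (w::real). Phi_coeff k (qpar (of_real w)) n * qpar (- of_int m * of_real w))"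
  have h_cont: "continuous_on {-1/2..1/2} (h n)" for n
    unfolding h_def is_fk_expansion_coeff[OF acoeff_expansion[of k], symmetric] unfolding qpar_powi
    unfolding qpar_def by (intro continuous_intros)
  have ul: "uniform_limit {-1/2..1/2} (\<lambda>N w. \<Sum>n<N. h n w * q ^ n) (\<lambda>w. \<Sum>n. h n w * q ^ n) sequentially"
  proof (rule Weierstrass_m_test)
    show "norm (h n w * q ^ n) \<le> B * (norm q / r) ^ n" for n w
      using B(2)[of "qpar (of_real w)" n] r mult_right_mono[of "norm (Phi_coeff k (qpar (of_real w)) n)" "B / r ^ n" "norm q ^ n"]
      by (simp add: h_def norm_mult norm_power power_divide)
    show "summable (\<lambda>n. B * (norm q / r) ^ n)"
      using r by (intro summable_mult summable_geometric) auto
  qed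
  have lim_eq: "(\<Sum>n. h n w * q ^ n) = Phi k (qpar (of_real w)) q * qpar (- of_int m * of_real w)" for w
  proof -
    have "(\<lambda>n. Phi_coeff k (qpar (of_real w)) n * q ^ n) sums Phi k (qpar (of_real w)) q"
      using q by (intro Phi_sums) auto
    from sums_mult2[OF this, of "qpar (- of_int m * of_real w)"] show ?thesis
      by (simp add: h_def sums_iff mult_ac)
  qed
  have "continuous_on {-1/2..1/2} (\<lambda>w. \<Sum>n<N. h n w * q ^ n)" for N
    by (intro continuous_intros h_cont)
  from uniform_limit_integral[OF ul this sequentially_bot]
  obtain I J where IJ: "\<And>N. ((\<lambda>w. \<Sum>n<N. h n w * q ^ n) has_integral I N) {-1/2..1/2}"
      "((\<lambda>w. \<Sum>n. h n w * q ^ n) has_integral J) {-1/2..1/2}" "I \<longlonglongrightarrow> J"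
    by blast
  have "((\<lambda>w. \<Sum>n<N. h n w * q ^ n) has_integral (\<Sum>n<N. acoeff k m n * q ^ n)) {-1/2..1/2}" for N
    unfolding h_def by (intro has_integral_sum has_integral_mult_left acoeff_integral) auto
  then have "I = (\<lambda>N. \<Sum>n<N. acoeff k m n * q ^ n)"
    using IJ(1) has_integral_unique by blast
  moreover have "J = fourier_Phi k m q"
    using IJ(2) unfolding lim_eq fourier_Phi_def by (simp add: integral_unique)
  ultimately show ?thesis using IJ(3) by (simp only: sums_def)
qed

lemma has_integral_exp_int:
  "((\<lambda>y::real. exp (of_int j * \<i> * of_real y)) has_integral (if j = 0 then 2 * of_real pi else 0)) {-pi..pi}"
proof (cases "j = 0")
  case True
  then show ?thesis using has_integral_const_real[of "1::complex" "-pi" pi] by (simp add: scaleR_conv_of_real)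
next
  case False
  define d where "d = of_int j * \<i>"
  have d: "d \<noteq> 0" using False by (simp add: d_def)
  have "((\<lambda>y. exp (d * of_real y)) has_integral (exp (d * of_real pi) / d - exp (d * of_real (-pi)) / d)) {-pi..pi}"
  proof (rule fundamental_theorem_of_calculus)
    fix y :: real
    have "((\<lambda>z. exp (d * z) / d) has_field_derivative exp (d * of_real y)) (at (of_real y))"
      using d by (auto intro!: derivative_eq_intros)
    from has_vector_derivative_real_field[OF this]
    show "((\<lambda>y. exp (d * of_real y) / d) has_vector_derivative exp (d * of_real y)) (at y within {-pi..pi})"
      by (rule has_vector_derivative_at_within)
  qed simp
  moreover have "exp (d * of_real pi) = exp (d * of_real (-pi))"
  proof -
    have "exp (d * of_real pi) = exp (d * of_real (-pi)) * exp (2 * of_real pi * \<i> * of_int j)"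
    proof -
      have "d * of_real pi = d * of_real (-pi) + 2 * of_real pi * \<i> * of_int j"
        by (simp add: d_def algebra_simps)
      then show ?thesis by (simp only: exp_add)
    qed
    also have "exp (2 * of_real pi * \<i> * of_int j) = 1"
      using qpar_int(1)[of j] by (simp add: qpar_def)
    finally show ?thesis by simp
  qed
  ultimately show ?thesis using False by (simp add: d_def)
qed

text \<open>Cauchy's coefficient formula on |q| = exp(-x), obtained by integrating the uniformly
  convergent series term by term and using orthogonality of the exponentials on [-pi, pi].\<close>

lemma acoeff_contour:
  assumes x: "x > 0"
  shows "((\<lambda>y. fourier_Phi k m (exp (- Complex x y)) * exp (of_nat n * Complex x y)) has_integral (2 * of_real pi * acoeff k m n)) {-pi..pi}"
proof -
  \<comment> \<open>Since r^2 = exp(-x), the bound B / r^j on the coefficients against |q|^j =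
    r^(2j) leaves the summable r^j.\<close>
  define r where "r = exp (- x / 2)"
  have r: "0 < r" "r < 1" using x by (simp_all add: r_def)
  obtain B where B: "B \<ge> 0" "\<And>c n. norm c = 1 \<Longrightarrow> norm (Phi_coeff k c n) \<le> B / r ^ n"
    using Phi_coeff_bound[OF r] by blast
  have aB: "norm (acoeff k m j) \<le> B / r ^ j" for j
    by (rule norm_acoeff_le) (rule B(2))
  define h where "h = (\<lambda>j y. acoeff k m j * exp (- Complex x y) ^ j * exp (of_nat n * Complex x y))"
  have Cxy: "Complex x y = of_real x + \<i> * of_real y" for y by (simp add: complex_eq_iff)
  have ul: "uniform_limit {-pi..pi} (\<lambda>N y. \<Sum>j<N. h j y) (\<lambda>y. \<Sum>j. h j y) sequentially"
  proof (rule Weierstrass_m_test)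
    show "norm (h j y) \<le> B * exp (real n * x) * (r ^ j)" for j y
    proof -
      have "norm (h j y) = norm (acoeff k m j) * (r ^ j * r ^ j) * exp (real n * x)"
        by (simp add: h_def norm_mult norm_power norm_exp r_def flip: power_mult_distrib exp_add)
      also have "\<dots> \<le> B / r ^ j * (r ^ j * r ^ j) * exp (real n * x)"
        using aB r by (intro mult_right_mono) auto
      also have "\<dots> = B * exp (real n * x) * r ^ j" using r by simp
      finally show ?thesis .
    qed
    show "summable (\<lambda>j. B * exp (real n * x) * r ^ j)"
      using r by (intro summable_mult summable_geometric) auto
  qed
  have lim_eq: "(\<Sum>j. h j y) = fourier_Phi k m (exp (- Complex x y)) * exp (of_nat n * Complex x y)" for y
  proof -
    have "norm (exp (- Complex x y)) < 1" using x by (simp add: norm_exp)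
    from sums_mult2[OF acoeff_sums_fourier_Phi[OF this], of k m "exp (of_nat n * Complex x y)"] show ?thesis
      by (simp add: h_def sums_iff)
  qed
  have h_eq: "h j y = acoeff k m j * exp (of_real ((real n - real j) * x)) * exp (of_int (int n - int j) * \<i> * of_real y)" for j y
    by (simp add: h_def Cxy algebra_simps flip: exp_of_nat_mult exp_add)
  have "continuous_on {-pi..pi} (\<lambda>y. \<Sum>j<N. h j y)" for N
    unfolding h_eq by (intro continuous_intros)
  from uniform_limit_integral[OF ul this sequentially_bot]
  obtain I J where IJ: "\<And>N. ((\<lambda>y. \<Sum>j<N. h j y) has_integral I N) {-pi..pi}"
      "((\<lambda>y. \<Sum>j. h j y) has_integral J) {-pi..pi}" "I \<longlonglongrightarrow> J"
    by blast
  have "I N = 2 * of_real pi * acoeff k m n" if "N > n" for N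
  proof -
    have "((\<lambda>y. \<Sum>j<N. h j y) has_integral (\<Sum>j<N. acoeff k m j * exp (of_real ((real n - real j) * x)) *
        (if int n - int j = 0 then 2 * of_real pi else 0))) {-pi..pi}"
      unfolding h_eq by (intro has_integral_sum has_integral_mult_right has_integral_exp_int) auto
    also have "(\<Sum>j<N. acoeff k m j * exp (of_real ((real n - real j) * x)) * (if int n - int j = 0 then 2 * of_real pi else 0)) =
        (\<Sum>j<N. if j = n then 2 * of_real pi * acoeff k m n else 0)"
      by (intro sum.cong) auto
    also have "\<dots> = 2 * of_real pi * acoeff k m n" using that by simp
    finally show ?thesis using IJ(1) has_integral_unique by blast
  qed
  then have "I \<longlonglongrightarrow> 2 * of_real pi * acoeff k m n"
    by (intro tendsto_eventually) (auto simp: eventually_sequentially intro!: exI[of _ "Suc n"])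
  then have "J = 2 * of_real pi * acoeff k m n" using IJ(3) LIMSEQ_unique by blast
  then show ?thesis using IJ(2) by (simp only: lim_eq)
qed

section \<open>The major arc\<close>

text \<open>All denominators of the Lambert series have norm at least 1/2, so a geometric series of
  ratio at most 1/2 dominates it. Working with the exponent \<open>L\<close> makes powers and
  quotients of several products easy to estimate.\<close>

lemma qp_eq_exp_small:
  assumes "norm q \<le> 1 / 2" "norm (c * q) \<le> 1 / 2"
  obtains L where "qp c q = exp L" "norm L \<le> 4 * norm (c * q)"
proof -
  define t where "t = (\<lambda>r. (c * q) ^ Suc r / (of_nat (Suc r) * (1 - q ^ Suc r)))"
  have lt: "norm q < 1" "norm (c * q) < 1" using assms by auto
  have L: "summable (\<lambda>r. norm (t r))" "qp c q = exp (- suminf t)"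
    unfolding t_def by (rule qp_eq_exp_Lambert[OF lt])+
  have tb: "norm (t r) \<le> 2 * norm (c * q) * norm (c * q) ^ r" for r
  proof -
    have "norm q ^ Suc r \<le> norm q * 1"
      using assms(1) unfolding power_Suc by (intro mult_left_mono power_le_one) auto
    then have "1 / 2 \<le> norm (1 - q ^ Suc r)"
      using norm_triangle_ineq2[of 1 "q ^ Suc r"] assms(1) by (simp add: norm_power del: power_Suc)
    then have "1 * (1 / 2) \<le> real (Suc r) * norm (1 - q ^ Suc r)"
      by (intro mult_mono) auto
    then have "norm (t r) \<le> norm (c * q) ^ Suc r / (1 / 2)"
      unfolding t_def norm_divide norm_power norm_mult[of "of_nat (Suc r)"] norm_of_nat
      by (intro divide_left_mono) auto
    then show ?thesis by simp
  qed
  have geo: "(\<lambda>r. 2 * norm (c * q) * norm (c * q) ^ r) sums (2 * norm (c * q) * (1 / (1 - norm (c * q))))"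
    using lt by (intro sums_mult geometric_sums) auto
  have "norm (suminf t) \<le> (\<Sum>r. norm (t r))" using L(1) by (rule summable_norm)
  also have "\<dots> \<le> (\<Sum>r. 2 * norm (c * q) * norm (c * q) ^ r)"
    using tb L(1) geo by (intro suminf_le) (auto simp: sums_iff)
  also have "\<dots> = 2 * norm (c * q) * (1 / (1 - norm (c * q)))" using geo by (simp add: sums_iff)
  also have "\<dots> \<le> 2 * norm (c * q) * 2"
    using assms(2) by (intro mult_left_mono) (auto simp: field_simps)
  finally have "norm (- suminf t) \<le> 4 * norm (c * q)" by simp
  with L(2) that show ?thesis by blast
qed

lemma norm_exp_minus_1_le:
  fixes u :: complex
  assumes "norm u \<le> 1"
  shows "norm (exp u - 1) \<le> 3 * norm u"
proof -
  have "norm (exp u - 1) \<le> exp \<bar>Re u\<bar> * norm u" using Taylor_exp[of u 0] by simp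
  also have "exp \<bar>Re u\<bar> \<le> exp 1" using abs_Re_le_cmod[of u] assms by simp
  also have "exp 1 \<le> (3::real)" by (rule exp_le)
  finally show ?thesis by (simp add: mult_right_mono)
qed

text \<open>This is \<open>ntheta_transform\<close> at \<tau> = i z / (2 pi): the new q is exp(-4
  pi^2 / z), and dividing w by \<tau> turns the sine into sinh. The restriction w > 0 keeps both
  sines nonzero, as the passage between \<open>ntheta\<close> and \<open>theta_quot\<close>
  requires.\<close>

lemma theta_quot_transform:
  assumes z: "Re z > 0" and w: "0 < w" "w \<le> 1 / 2"
  shows "theta_quot (qpar (of_real w)) (exp (- z)) =
    2 * of_real pi / z * (of_real (sin (pi * w)) * exp (of_real (2 * pi\<^sup>2 * w\<^sup>2) / z) / sinh (of_real (2 * pi\<^sup>2 * w) / z)) *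
    theta_quot (exp (of_real (4 * pi\<^sup>2 * w) / z)) (exp (- of_real (4 * pi\<^sup>2) / z))"
proof -
  define \<tau> where "\<tau> = \<i> * z / (2 * of_real pi)"
  have z0: "z \<noteq> 0" using z by auto
  have \<tau>: "Im \<tau> > 0" "\<tau> \<noteq> 0" using z by (auto simp: \<tau>_def Im_divide)
  define \<sigma> where "\<sigma> = - 1 / \<tau>"
  have q\<tau>: "qpar \<tau> = exp (- z)" by (simp add: qpar_def \<tau>_def)
  have q\<sigma>: "qpar \<sigma> = exp (- of_real (4 * pi\<^sup>2) / z)"
    using z0 by (simp add: qpar_def \<sigma>_def \<tau>_def field_simps power2_eq_square)
  have c': "qpar (of_real w / \<tau>) = exp (of_real (4 * pi\<^sup>2 * w) / z)"
    using z0 by (simp add: qpar_def \<tau>_def field_simps power2_eq_square)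
  have sw: "sin (pi * w) > 0" using w by (intro sin_gt_zero) auto
  have sw': "sin (of_real pi * complex_of_real w) = of_real (sin (pi * w))"
    by (simp only: of_real_mult[symmetric] sin_of_real)
  have tq: "theta_quot c (qpar \<rho>) = sin (of_real pi * v) / ntheta \<rho> v" if "qpar v = c" "sin (of_real pi * v) \<noteq> 0" for c \<rho> v
    using that by (simp add: theta_quot_def ntheta_def qpar_minus)
  have sin\<sigma>: "sin (of_real pi * (of_real w / \<tau>)) = - \<i> * sinh (of_real (2 * pi\<^sup>2 * w) / z)"
  proof -
    have "of_real pi * (of_real w / \<tau>) = - (\<i> * (of_real (2 * pi\<^sup>2 * w) / z))"
      using z0 by (simp add: \<tau>_def field_simps power2_eq_square)
    then show ?thesis by (simp only: sin_minus) (simp add: sinh_conv_sin)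
  qed
  have sinh0: "sinh (of_real (2 * pi\<^sup>2 * w) / z) \<noteq> 0"
  proof -
    have "Re (of_real (2 * pi\<^sup>2 * w) / z) > 0"
      using z w by (simp add: Re_divide_of_real Re_divide zero_less_divide_iff sum_power2_gt_zero_iff zero_less_mult_iff)
    then have "0 < sinh (Re (of_real (2 * pi\<^sup>2 * w) / z))" by simp
    then show ?thesis using norm_sinh_ge[of "of_real (2 * pi\<^sup>2 * w) / z"] by auto
  qed
  have sx0: "sin (of_real pi * (of_real w / \<tau>)) \<noteq> 0"
    unfolding sin\<sigma> using sinh0 by simp
  have frac: "S / (a * n) = S / (a * x) * (x / n)" if "x \<noteq> 0" for S a n x :: complex
    using that by simp
  have "theta_quot (qpar (of_real w)) (qpar \<tau>) = sin (of_real pi * of_real w) / ntheta \<tau> (of_real w)"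
  proof (rule tq[OF refl])
    show "sin (of_real pi * complex_of_real w) \<noteq> 0" unfolding sw' using sw by simp
  qed
  also have "ntheta \<tau> (of_real w) = \<tau> * qpar (- (of_real w)\<^sup>2 / (2 * \<tau>)) * ntheta \<sigma> (of_real w / \<tau>)"
    unfolding \<sigma>_def by (rule ntheta_transform[OF \<tau>(1)])
  also have "sin (of_real pi * of_real w) / (\<tau> * qpar (- (of_real w)\<^sup>2 / (2 * \<tau>)) * ntheta \<sigma> (of_real w / \<tau>)) =
      of_real (sin (pi * w)) / (\<tau> * qpar (- (of_real w)\<^sup>2 / (2 * \<tau>)) * sin (of_real pi * (of_real w / \<tau>))) *
      (sin (of_real pi * (of_real w / \<tau>)) / ntheta \<sigma> (of_real w / \<tau>))"
    unfolding sw' by (rule frac[OF sx0])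
  also have "sin (of_real pi * (of_real w / \<tau>)) / ntheta \<sigma> (of_real w / \<tau>) = theta_quot (qpar (of_real w / \<tau>)) (qpar \<sigma>)"
    by (rule tq[symmetric, OF refl sx0])
  also have "qpar (- (of_real w)\<^sup>2 / (2 * \<tau>)) = inverse (exp (of_real (2 * pi\<^sup>2 * w\<^sup>2) / z))"
  proof -
    have "2 * of_real pi * \<i> * (- (of_real w)\<^sup>2 / (2 * \<tau>)) = - (of_real (2 * pi\<^sup>2 * w\<^sup>2) / z)"
      using z0 by (simp add: \<tau>_def field_simps power2_eq_square)
    then show ?thesis by (simp only: qpar_def exp_minus)
  qed
  also have "of_real (sin (pi * w)) / (\<tau> * inverse (exp (of_real (2 * pi\<^sup>2 * w\<^sup>2) / z)) * sin (of_real pi * (of_real w / \<tau>))) =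
      2 * of_real pi / z * (of_real (sin (pi * w)) * exp (of_real (2 * pi\<^sup>2 * w\<^sup>2) / z) / sinh (of_real (2 * pi\<^sup>2 * w) / z))"
    unfolding sin\<sigma> using z0 sinh0 by (simp add: \<tau>_def field_simps)
  finally show ?thesis by (simp only: q\<tau> q\<sigma> c')
qed

text \<open>This is \<open>eta_transform\<close> written for the products: the powers q^(1/24) on
  the two sides become exp(-z/24) and exp(-pi^2/(6z)). The inverse of the latter is the source of
  the exponential growth.\<close>

lemma qp_1_transform:
  assumes z: "Re z > 0"
  shows "inverse (qp 1 (exp (- z))) =
    csqrt (z / (2 * of_real pi)) * exp (- z / 24) * exp (of_real (pi\<^sup>2 / 6) / z) * inverse (qp 1 (exp (- of_real (4 * pi\<^sup>2) / z)))"
proof -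
  have z0: "z \<noteq> 0" using z by auto
  define P P' where "P = qp 1 (exp (- z))" and "P' = qp 1 (exp (- of_real (4 * pi\<^sup>2) / z))"
  have "eta (2 * of_real pi * \<i> / z) = exp (- of_real (pi\<^sup>2 / 6) / z) * P'"
  proof -
    have "2 * of_real pi * \<i> * (2 * of_real pi * \<i> / z) = - of_real (4 * pi\<^sup>2) / z"
      "2 * of_real pi * \<i> * (2 * of_real pi * \<i> / z / 24) = - of_real (pi\<^sup>2 / 6) / z"
      using z0 by (simp_all add: field_simps power2_eq_square)
    then show ?thesis by (simp only: eta_conv_qp qpar_def P'_def)
  qed
  moreover have "eta (\<i> * z / (2 * of_real pi)) = exp (- z / 24) * P"
  proof -
    have "2 * of_real pi * \<i> * (\<i> * z / (2 * of_real pi)) = - z"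
      "2 * of_real pi * \<i> * (\<i> * z / (2 * of_real pi) / 24) = - z / 24"
      by simp_all
    then show ?thesis by (simp only: eta_conv_qp qpar_def P_def)
  qed
  ultimately have eq: "exp (- of_real (pi\<^sup>2 / 6) / z) * P' = csqrt (z / (2 * of_real pi)) * (exp (- z / 24) * P)"
    using eta_transform[OF z] by simp
  have nP: "P \<noteq> 0" unfolding P_def using z by (intro qp_1_nonzero) (simp add: norm_exp)
  have nP': "P' \<noteq> 0"
  proof -
    have "Re (of_real (4 * pi\<^sup>2) / z) > 0"
      using z by (simp add: Re_divide zero_less_divide_iff sum_power2_gt_zero_iff)
    then show ?thesis unfolding P'_def by (intro qp_1_nonzero) (simp add: norm_exp)
  qed
  have "exp (of_real (pi\<^sup>2 / 6) / z) * exp (- of_real (pi\<^sup>2 / 6) / z) = 1"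
    by (simp flip: exp_add)
  then have "P' = exp (of_real (pi\<^sup>2 / 6) / z) * (csqrt (z / (2 * of_real pi)) * (exp (- z / 24) * P))"
    unfolding eq[symmetric] by (simp flip: mult.assoc)
  then show ?thesis
    unfolding P_def[symmetric] P'_def[symmetric] using nP nP' by (simp add: field_simps)
qed

text \<open>After the transformation |q|, |cq| and |q/c| are all at most \<epsilon>. The worst is
  |cq| = exp(-4 pi^2 (1 - w) Re (1/z)), which reaches \<epsilon> at w = 1/2. Every product is
  therefore 1 up to O(\<epsilon>).\<close>

lemma correction_bound:
  fixes k :: nat
  assumes w: "0 \<le> w" "w \<le> 1 / 2" and R: "Re (1 / z) > 0"
    and \<epsilon>: "\<epsilon> = exp (- 2 * pi\<^sup>2 * Re (1 / z))" and small: "(32 + 4 * real k) * \<epsilon> \<le> 1"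
  shows "norm (theta_quot (exp (of_real (4 * pi\<^sup>2 * w) / z)) (exp (- of_real (4 * pi\<^sup>2) / z)) ^ 2 *
      inverse (qp 1 (exp (- of_real (4 * pi\<^sup>2) / z))) ^ k - 1) \<le> 3 * (32 + 4 * real k) * \<epsilon>"
proof -
  define q c where "q = exp (- of_real (4 * pi\<^sup>2) / z)" and "c = exp (of_real (4 * pi\<^sup>2 * w) / z)"
  define r where "r = Re (1 / z)"
  have Rr: "Re (of_real a / z) = a * r" for a :: real
    by (simp add: r_def Re_divide)
  have Rr': "Re (- of_real a / z) = - (a * r)" for a :: real
    using Rr[of a] by simp
  have "\<epsilon> > 0" by (simp add: \<epsilon>)
  have "32 * \<epsilon> \<le> (32 + 4 * real k) * \<epsilon>" using \<open>\<epsilon> > 0\<close> by (intro mult_right_mono) auto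
  then have \<epsilon>2: "\<epsilon> \<le> 1 / 2" using small by linarith
  have nq: "norm q = exp (- (4 * pi\<^sup>2 * r))"
    unfolding q_def norm_exp_eq_Re Rr' ..
  have nc: "norm c = exp (4 * pi\<^sup>2 * w * r)"
    unfolding c_def norm_exp_eq_Re Rr ..
  have pr: "pi\<^sup>2 * r > 0" using R by (simp add: r_def)
  have 1: "norm (1 * q) \<le> \<epsilon>" using R by (simp add: nq \<epsilon> r_def)
  have 2: "norm (c * q) \<le> \<epsilon>"
  proof -
    have "pi\<^sup>2 * r * w \<le> pi\<^sup>2 * r * (1 / 2)" using pr w by (intro mult_left_mono) auto
    then show ?thesis by (simp add: norm_mult nq nc \<epsilon> r_def mult_ac flip: exp_add)
  qed
  have 3: "norm (inverse c * q) \<le> \<epsilon>"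
  proof -
    have "0 \<le> pi\<^sup>2 * r * w" using pr w by simp
    moreover have "4 * pi\<^sup>2 * w * r = 4 * (pi\<^sup>2 * r * w)" "4 * pi\<^sup>2 * r = 4 * (pi\<^sup>2 * r)"
        "- 2 * pi\<^sup>2 * r = - 2 * (pi\<^sup>2 * r)"
      by (simp_all only: mult_ac)
    ultimately have "- (4 * pi\<^sup>2 * w * r) + - (4 * pi\<^sup>2 * r) \<le> - 2 * pi\<^sup>2 * r"
      using pr by linarith
    moreover have "norm (inverse c * q) = exp (- (4 * pi\<^sup>2 * w * r) + - (4 * pi\<^sup>2 * r))"
      by (simp only: norm_mult norm_inverse nq nc exp_add exp_minus)
    ultimately show ?thesis by (simp only: \<epsilon> r_def[symmetric] exp_le_cancel_iff)
  qed
  have q2: "norm q \<le> 1 / 2" using 1 \<epsilon>2 by simp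
  obtain L1 where L1: "qp 1 q = exp L1" "norm L1 \<le> 4 * norm (1 * q)"
    using qp_eq_exp_small[of q 1] q2 by auto
  obtain L2 where L2: "qp c q = exp L2" "norm L2 \<le> 4 * norm (c * q)"
    using qp_eq_exp_small[of q c] q2 2 \<epsilon>2 by auto
  obtain L3 where L3: "qp (inverse c) q = exp L3" "norm L3 \<le> 4 * norm (inverse c * q)"
    using qp_eq_exp_small[of q "inverse c"] q2 3 \<epsilon>2 by auto
  \<comment> \<open>The weights 4, 2, 2 and k, with each logarithm at most 4 \<epsilon>, give the
    constant 32 + 4k.\<close>
  define u where "u = 4 * L1 - 2 * L2 - 2 * L3 - of_nat k * L1"
  have "theta_quot c q ^ 2 * inverse (qp 1 q) ^ k = exp u"
  proof -
    have "theta_quot c q = exp (2 * L1 - L2 - L3)"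
      by (simp add: theta_quot_def L1(1) L2(1) L3(1) exp_diff exp_double)
    then have "theta_quot c q ^ 2 = exp (4 * L1 - 2 * L2 - 2 * L3)"
      by (simp add: power2_eq_square algebra_simps flip: exp_add)
    moreover have "inverse (qp 1 q) ^ k = exp (- (of_nat k * L1))"
      by (simp add: L1(1) exp_of_nat_mult exp_minus power_inverse)
    ultimately show ?thesis by (simp add: u_def flip: exp_add)
  qed
  have "norm u \<le> (4 * norm L1 + 2 * norm L2 + 2 * norm L3) + real k * norm L1"
    unfolding u_def by (intro norm_triangle_le_diff add_mono order_refl) (simp_all add: norm_mult)
  also have "\<dots> \<le> (4 * (4 * \<epsilon>) + 2 * (4 * \<epsilon>) + 2 * (4 * \<epsilon>)) + real k * (4 * \<epsilon>)"
    using L1(2) L2(2) L3(2) 1 2 3 by (intro add_mono mult_left_mono) auto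
  also have "\<dots> = (32 + 4 * real k) * \<epsilon>" by (simp add: algebra_simps)
  finally have u: "norm u \<le> (32 + 4 * real k) * \<epsilon>" .
  then have "norm (exp u - 1) \<le> 3 * norm u" using small by (intro norm_exp_minus_1_le) auto
  also have "\<dots> \<le> 3 * ((32 + 4 * real k) * \<epsilon>)" using u by simp
  also have "\<dots> = 3 * (32 + 4 * real k) * \<epsilon>" by (simp only: mult.assoc)
  finally show ?thesis
    unfolding q_def[symmetric] c_def[symmetric] \<open>theta_quot c q ^ 2 * inverse (qp 1 q) ^ k = exp u\<close> .
qed

text \<open>\<open>Phi\<close> is invariant under replacing c by 1/c, so the integral folds onto
  [0, 1/2] and the exponential becomes the cosine in \<open>gm1\<close>.\<close>

lemma fourier_Phi_half:
  assumes q: "norm q < 1"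
  shows "((\<lambda>w::real. 2 * of_real (cos (2 * pi * of_int m * w)) * Phi k (qpar (of_real w)) q) has_integral fourier_Phi k m q) {0..1/2}"
proof -
  define H where "H = (\<lambda>w::real. Phi k (qpar (of_real w)) q * qpar (- of_int m * of_real w))"
  have nz: "qp (qpar (of_real w)) q \<noteq> 0" "qp (inverse (qpar (of_real w))) q \<noteq> 0" for w
    by (rule qp_nonzero[OF q], simp add: norm_mult norm_inverse q)+
  have "continuous_on A (\<lambda>w::real. qp (qpar (of_real w)) q)" for A
  proof -
    have "(\<lambda>w. qp (qpar w) q) holomorphic_on UNIV"
      using q by (intro holomorphic_intros) auto
    from continuous_on_compose2[OF holomorphic_on_imp_continuous_on[OF this], of A of_real] show ?thesis
      by (auto intro: continuous_intros)
  qed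
  moreover have "continuous_on A (\<lambda>w::real. qp (inverse (qpar (of_real w))) q)" for A
  proof -
    have "(\<lambda>w. qp (inverse (qpar w)) q) holomorphic_on UNIV"
      using q by (intro holomorphic_intros) auto
    from continuous_on_compose2[OF holomorphic_on_imp_continuous_on[OF this], of A of_real] show ?thesis
      by (auto intro: continuous_intros)
  qed
  ultimately have cont: "continuous_on A H" for A
    unfolding H_def Phi_def using nz qp_1_nonzero[OF q] by (intro continuous_intros) (auto simp: qpar_def intro!: continuous_intros)
  have even: "Phi k (qpar (of_real (- w))) q = Phi k (qpar (of_real w)) q" for w
    by (simp add: Phi_def qpar_minus mult.commute)
  have "(H has_integral integral {-1/2..0} H) {-1/2..0}" "(H has_integral integral {0..1/2} H) {0..1/2}"
    using cont by (auto intro!: integrable_integral integrable_continuous_interval)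
  then have "(H has_integral (integral {-1/2..0} H + integral {0..1/2} H)) {-1/2..1/2}"
    by (intro has_integral_combine[of "-1/2" 0 "1/2"]) auto
  then have "fourier_Phi k m q = integral {-1/2..0} H + integral {0..1/2} H"
    by (simp add: fourier_Phi_def H_def integral_unique)
  moreover have "((\<lambda>w. H (- w)) has_integral integral {-1/2..0} H) {0..1/2}"
  proof -
    have "((\<lambda>w. H (- w)) has_integral integral {-1/2..0} H) {- 0..- (-1/2)}"
      by (rule has_integral_reflect_real[THEN iffD2]) (rule \<open>(H has_integral integral {-1/2..0} H) {-1/2..0}\<close>)
    moreover have "{- 0..- (-1/2)} = {0..1/2::real}" by simp
    ultimately show ?thesis by (simp only:)
  qed
  ultimately have "((\<lambda>w. H (- w) + H w) has_integral fourier_Phi k m q) {0..1/2}"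
    using has_integral_add[OF _ \<open>(H has_integral integral {0..1/2} H) {0..1/2}\<close>] by (simp only:)
  moreover have "H (- w) + H w = 2 * of_real (cos (2 * pi * of_int m * w)) * Phi k (qpar (of_real w)) q" for w
  proof -
    have "qpar (of_int m * of_real w) + qpar (- of_int m * of_real w) = 2 * of_real (cos (2 * pi * of_int m * w))"
      by (simp add: qpar_def cos_exp_eq mult_ac flip: cos_of_real)
    moreover have "H (- w) + H w = Phi k (qpar (of_real w)) q * (qpar (of_int m * of_real w) + qpar (- of_int m * of_real w))"
      unfolding H_def even by (simp add: algebra_simps)
    ultimately show ?thesis by simp
  qed
  ultimately show ?thesis by simp
qed

lemma exp_minus_inverse_le:
  assumes "z \<in> sector" "z \<noteq> 0"
  shows "exp (- 2 * pi\<^sup>2 * Re (1 / z)) \<le> fact n * norm z ^ n"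
proof -
  define t where "t = norm (1 / z)"
  have t: "t > 0" using assms by (simp add: t_def norm_divide)
  have "1 \<le> pi\<^sup>2" using pi_ge_two by (simp add: one_le_power)
  then have "Re (1 / z) * 1 \<le> Re (1 / z) * pi\<^sup>2"
    using sector_inverse(1)[OF assms] by (intro mult_left_mono) auto
  then have "t \<le> 2 * pi\<^sup>2 * Re (1 / z)"
    using sector_inverse(3)[OF assms] by (simp add: t_def mult_ac)
  then have "exp (- 2 * pi\<^sup>2 * Re (1 / z)) \<le> exp (- t)" by simp
  also have "\<dots> \<le> fact n / t ^ n"
    using power_le_fact_exp[of t n] t by (simp add: exp_minus field_simps)
  also have "\<dots> = fact n * norm z ^ n" using assms by (simp add: t_def norm_divide power_divide)
  finally show ?thesis .
qed

text \<open>The transformations rewrite the integrand as that of \<open>gm1\<close> times a factor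
  \<open>X\<close> with X - 1 exponentially small in 1/z. The \<open>gm1\<close> integrand is
  O(1/(Re s)^2), which balances the prefactor s^2, so replacing \<open>X\<close> by 1 costs less
  than any power of z; the expansion with \<open>dcoeff\<close> then applies.\<close>

lemma fourier_Phi_major_arc:
  fixes k N :: nat and m :: int
  assumes N: "N \<ge> 1"
  obtains C \<epsilon> :: real where "C > 0" "\<epsilon> > 0"
    "\<And>z. z \<in> sector \<Longrightarrow> z \<noteq> 0 \<Longrightarrow> norm z < \<epsilon> \<Longrightarrow>
      \<exists>B. fourier_Phi k m (exp (- z)) = csqrt (z / (2 * of_real pi)) ^ k * exp (of_real (real k * pi\<^sup>2 / 6) / z) * B \<and>
        norm (B - (\<Sum>l=1..N. dcoeff m k l * z ^ l)) \<le> C * norm z ^ (N + 1)"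
proof -
  obtain C1 \<epsilon>1 :: real where 1: "C1 > 0" "\<epsilon>1 > 0"
    "\<And>z. z \<in> sector \<Longrightarrow> z \<noteq> 0 \<Longrightarrow> norm z < \<epsilon>1 \<Longrightarrow>
      norm (exp (- of_nat k * z / 24) * gm1 m z - (\<Sum>l=1..N. dcoeff m k l * z ^ l)) \<le> C1 * norm z ^ (N + 1)"
    by (rule dcoeff_approx[OF N, of k m]) (rule that)
  obtain C2 :: real where C2: "C2 > 0"
    "\<And>m s w. Re s > 0 \<Longrightarrow> w \<in> {0..1/2} \<Longrightarrow> norm (gm1_integrand m s w) \<le> C2 / Re s ^ 2"
    by (rule gm1_integrand_bound) (rule that)
  define a where "a = 32 + 4 * real k"
  have a: "a > 0" by (simp add: a_def add_pos_nonneg)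
  define C where "C = C1 + exp (real k) * (8 * pi\<^sup>2 * (4 * C2) * (3 * a * fact (N + 1)))"
  show ?thesis
  proof (rule that[of C "min \<epsilon>1 (min 1 (1 / a))"])
    show "C > 0" unfolding C_def using 1 C2 a by (intro add_pos_nonneg) auto
    show "min \<epsilon>1 (min 1 (1 / a)) > 0" using 1 a by auto
    fix z assume z: "z \<in> sector" "z \<noteq> 0" "norm z < min \<epsilon>1 (min 1 (1 / a))"
    have Rez: "Re z > 0" using z by (auto simp: sector_def complex_eq_iff)
    define s where "s = 1 / z"
    note s = sector_inverse[OF z(1,2), folded s_def]
    define \<epsilon> where "\<epsilon> = exp (- 2 * pi\<^sup>2 * Re (1 / z))"
    have "\<epsilon> \<le> norm z" using exp_minus_inverse_le[OF z(1,2), of 1] by (simp add: \<epsilon>_def)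
    then have "a * \<epsilon> \<le> a * (1 / a)" using z(3) a by (intro mult_left_mono) auto
    then have small: "a * \<epsilon> \<le> 1" using a by simp
    define q where "q = exp (- z)"
    have q: "norm q < 1" using Rez by (simp add: q_def norm_exp)
    define X where "X = (\<lambda>w. theta_quot (exp (of_real (4 * pi\<^sup>2 * w) / z)) (exp (- of_real (4 * pi\<^sup>2) / z)) ^ 2 *
      inverse (qp 1 (exp (- of_real (4 * pi\<^sup>2) / z))) ^ k)"
    have X: "norm (X w - 1) \<le> 3 * a * \<epsilon>" if "w \<in> {0..1/2}" for w
      unfolding X_def a_def using that s(1) small[unfolded a_def]
      by (intro correction_bound \<epsilon>_def) (auto simp: s_def)
    define A where "A = csqrt (z / (2 * of_real pi)) ^ k * exp (- of_nat k * z / 24) * exp (of_real (real k * pi\<^sup>2 / 6) / z)"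
    have A0: "A \<noteq> 0" using z(2) by (simp add: A_def)
    have integrand: "2 * of_real (cos (2 * pi * of_int m * w)) * Phi k (qpar (of_real w)) q =
        A * (8 * of_real pi ^ 2 * s ^ 2 * (gm1_integrand m s w * X w))" if "w \<in> {0..1/2} - {0}" for w
    proof -
      have w: "0 < w" "w \<le> 1 / 2" using that by auto
      define E where "E = theta_quot (exp (of_real (4 * pi\<^sup>2 * w) / z)) (exp (- of_real (4 * pi\<^sup>2) / z))"
      define P where "P = inverse (qp 1 (exp (- of_real (4 * pi\<^sup>2) / z)))"
      define h where "h = exp (of_real (2 * pi\<^sup>2 * w\<^sup>2) / z)"
      have h2: "h ^ 2 = exp (of_real (4 * pi\<^sup>2 * w\<^sup>2) * s)"
        by (simp add: h_def s_def mult.assoc flip: exp_of_nat_mult)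
      have "inverse (qp 1 q) ^ k = A * P ^ k"
        unfolding q_def qp_1_transform[OF Rez] A_def P_def power_mult_distrib
        by (simp add: exp_of_nat_mult[symmetric] mult_ac)
      then have "Phi k (qpar (of_real w)) q = (2 * of_real pi * s * (of_real (sin (pi * w)) * h / sh s w) * E) ^ 2 * (A * P ^ k)"
        unfolding Phi_conv_theta_quot q_def theta_quot_transform[OF Rez w]
        by (simp add: E_def h_def sh_def s_def)
      also have "\<dots> = 4 * of_real pi ^ 2 * s ^ 2 * (of_real (sin (pi * w)) ^ 2 * h ^ 2 / sh s w ^ 2) * (A * (E ^ 2 * P ^ k))"
        by (simp add: power_mult_distrib power_divide)
      finally show ?thesis
        unfolding h2 gm1_integrand_def X_def E_def[symmetric] P_def[symmetric] by simp
    qed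
    \<comment> \<open>The transformed integrand is available for w > 0 only; the missing point does
      not affect the integral.\<close>
    have neg: "negligible {0::real}" by simp
    have "((\<lambda>w. A * (8 * of_real pi ^ 2 * s ^ 2 * (gm1_integrand m s w * X w))) has_integral fourier_Phi k m q) {0..1/2}"
      by (rule has_integral_spike[OF neg _ fourier_Phi_half[OF q, of m k]]) (use integrand in auto)
    then have "((\<lambda>w. inverse A * (A * (8 * of_real pi ^ 2 * s ^ 2 * (gm1_integrand m s w * X w)))) has_integral inverse A * fourier_Phi k m q) {0..1/2}"
      by (rule has_integral_mult_right)
    then have I1: "((\<lambda>w. 8 * of_real pi ^ 2 * s ^ 2 * (gm1_integrand m s w * X w)) has_integral inverse A * fourier_Phi k m q) {0..1/2}"
      using A0 by (simp flip: mult.assoc)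
    have I2: "((\<lambda>w. 8 * of_real pi ^ 2 * s ^ 2 * gm1_integrand m s w) has_integral gm1 m z) {0..1/2}"
      unfolding gm1_conv_integrand s_def[symmetric]
      by (intro has_integral_mult_right integrable_integral gm1_integrand_integrable s(1))
    have "((\<lambda>w. 8 * of_real pi ^ 2 * s ^ 2 * (gm1_integrand m s w * (X w - 1))) has_integral (inverse A * fourier_Phi k m q - gm1 m z)) {0..1/2}"
      using has_integral_diff[OF I1 I2] by (simp add: algebra_simps)
    then have "norm (inverse A * fourier_Phi k m q - gm1 m z) \<le> (8 * pi\<^sup>2 * (4 * C2) * (3 * a * \<epsilon>)) * measure lborel {0..1/2::real}"
    proof (rule has_integral_bound_real[where S = "{}", rotated 2])
      fix w :: real assume "w \<in> {0..1/2} - {}"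
      then have w: "w \<in> {0..1/2}" by simp
      have "norm s ^ 2 \<le> (2 * Re s) ^ 2" using s(3) by (intro power_mono) auto
      then have "norm s ^ 2 * (C2 / Re s ^ 2) \<le> (2 * Re s) ^ 2 * (C2 / Re s ^ 2)"
        using C2(1) by (intro mult_right_mono) auto
      also have "\<dots> = 4 * C2" using s(1) by (simp add: power_mult_distrib)
      finally have sC: "norm s ^ 2 * (C2 / Re s ^ 2) \<le> 4 * C2" .
      have "norm (8 * of_real pi ^ 2 * s ^ 2 * (gm1_integrand m s w * (X w - 1))) =
          8 * pi\<^sup>2 * (norm s ^ 2 * norm (gm1_integrand m s w)) * norm (X w - 1)"
        by (simp add: norm_mult norm_power)
      also have "\<dots> \<le> 8 * pi\<^sup>2 * (norm s ^ 2 * (C2 / Re s ^ 2)) * (3 * a * \<epsilon>)"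
        using C2(2)[OF s(1) w, of m] X[OF w] C2(1) by (intro mult_mono mult_nonneg_nonneg) auto
      also have "\<dots> \<le> 8 * pi\<^sup>2 * (4 * C2) * (3 * a * \<epsilon>)"
        using sC a by (intro mult_right_mono mult_left_mono) (auto simp: \<epsilon>_def)
      finally show "norm (8 * of_real pi ^ 2 * s ^ 2 * (gm1_integrand m s w * (X w - 1))) \<le> 8 * pi\<^sup>2 * (4 * C2) * (3 * a * \<epsilon>)" .
    qed (use C2 a in \<open>auto simp: \<epsilon>_def\<close>)
    also have "\<dots> \<le> (8 * pi\<^sup>2 * (4 * C2) * (3 * a * \<epsilon>)) * 1"
      using C2 a by (intro mult_left_mono) (auto simp: \<epsilon>_def)
    also have "\<dots> \<le> 8 * pi\<^sup>2 * (4 * C2) * (3 * a * (fact (N + 1) * norm z ^ (N + 1)))"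
      using exp_minus_inverse_le[OF z(1,2), of "N + 1"] C2(1) a unfolding \<epsilon>_def mult_1_right
      by (intro mult_left_mono) auto
    finally have diff: "norm (inverse A * fourier_Phi k m q - gm1 m z) \<le>
        8 * pi\<^sup>2 * (4 * C2) * (3 * a * fact (N + 1)) * norm z ^ (N + 1)" by (simp add: mult.assoc)
    define B where "B = exp (- of_nat k * z / 24) * (inverse A * fourier_Phi k m q)"
    have "fourier_Phi k m (exp (- z)) = csqrt (z / (2 * of_real pi)) ^ k * exp (of_real (real k * pi\<^sup>2 / 6) / z) * B"
    proof -
      have "csqrt (z / (2 * of_real pi)) ^ k * exp (of_real (real k * pi\<^sup>2 / 6) / z) * B = A * inverse A * fourier_Phi k m q"
        unfolding B_def by (simp add: A_def mult_ac)
      then show ?thesis using A0 by (simp add: q_def)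
    qed
    moreover have "norm (B - (\<Sum>l=1..N. dcoeff m k l * z ^ l)) \<le> C * norm z ^ (N + 1)"
    proof -
      have "B - (\<Sum>l=1..N. dcoeff m k l * z ^ l) = exp (- of_nat k * z / 24) * (inverse A * fourier_Phi k m q - gm1 m z) +
          (exp (- of_nat k * z / 24) * gm1 m z - (\<Sum>l=1..N. dcoeff m k l * z ^ l))"
        by (simp add: B_def algebra_simps)
      also have "norm \<dots> \<le> exp (real k) * (8 * pi\<^sup>2 * (4 * C2) * (3 * a * fact (N + 1)) * norm z ^ (N + 1)) + C1 * norm z ^ (N + 1)"
      proof (intro norm_triangle_mono)
        have "norm (exp (- of_nat k * z / 24)) \<le> exp (real k)"
          using Rez by (simp add: norm_exp add_nonneg_nonneg order_trans[of _ 0])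
        then show "norm (exp (- of_nat k * z / 24) * (inverse A * fourier_Phi k m q - gm1 m z)) \<le>
            exp (real k) * (8 * pi\<^sup>2 * (4 * C2) * (3 * a * fact (N + 1)) * norm z ^ (N + 1))"
          unfolding norm_mult[of "exp _"] using diff by (intro mult_mono) auto
        show "norm (exp (- of_nat k * z / 24) * gm1 m z - (\<Sum>l=1..N. dcoeff m k l * z ^ l)) \<le> C1 * norm z ^ (N + 1)"
          using 1(3)[OF z(1,2)] z(3) by simp
      qed
      also have "\<dots> = C * norm z ^ (N + 1)" by (simp add: C_def algebra_simps)
      finally show ?thesis .
    qed
    ultimately show "\<exists>B. fourier_Phi k m (exp (- z)) = csqrt (z / (2 * of_real pi)) ^ k * exp (of_real (real k * pi\<^sup>2 / 6) / z) * B \<and>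
        norm (B - (\<Sum>l=1..N. dcoeff m k l * z ^ l)) \<le> C * norm z ^ (N + 1)" by blast
  qed
qed

section \<open>Hankel integrals\<close>

definition slit :: "complex set" where "slit = - \<real>\<^sub>\<le>\<^sub>0"

text \<open>The slit plane is starlike, so holomorphic functions on it have primitives. Pieces of
  different contours can then be compared as differences of values of one function.\<close>

lemma slit_primitive:
  assumes "f holomorphic_on slit"
  obtains G where "\<And>t. t \<in> slit \<Longrightarrow> (G has_field_derivative f t) (at t)"
proof -
  have "slit = - (complex_of_real ` {..0})"
    by (auto simp: slit_def complex_nonpos_Reals_iff image_iff complex_eq_iff intro: exI[of _ "Re _"])
  then have "starlike slit"
    using starlike_slotted_complex_plane_left[of 0] by simp
  moreover have "open slit" unfolding slit_def by (simp add: open_Compl)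
  ultimately obtain G where G: "\<forall>t\<in>slit. (G has_field_derivative f t) (at t)"
    using holomorphic_starlike_primitive[of slit f "{}"] assms
    by (metis Diff_empty finite.emptyI holomorphic_on_imp_continuous_on holomorphic_on_imp_differentiable_at)
  with that show ?thesis by blast
qed

lemma primitive_segment_bound:
  assumes G: "\<And>t. t \<in> slit \<Longrightarrow> (G has_field_derivative f t) (at t)"
    and "closed_segment a b \<subseteq> slit"
    and B: "\<And>t. t \<in> closed_segment a b \<Longrightarrow> norm (f t) \<le> B"
  shows "norm (G b - G a) \<le> B * norm (b - a)"
proof (rule field_differentiable_bound[of "closed_segment a b" G f B])
  show "(G has_field_derivative f t) (at t within closed_segment a b)" if "t \<in> closed_segment a b" for t
    using that assms(2) by (intro has_field_derivative_at_within[OF G]) auto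
qed (use B in auto)

text \<open>Controls t^p along the two horizontal rays of the loop: the power costs exp(-s/2), half
  of the decay exp s available for s <= 0.\<close>

lemma one_minus_powr_le:
  fixes p :: real
  assumes "p \<ge> 0"
  obtains C :: real where "C > 0" "\<And>s. s \<le> 0 \<Longrightarrow> (1 - s) powr p \<le> C * exp (- s / 2)"
proof -
  obtain n where n: "p \<le> real n" using real_arch_simple by blast
  define C :: real where "C = fact n * 2 ^ n * exp (1 / 2)"
  have "(1 - s) powr p \<le> C * exp (- s / 2)" if "s \<le> 0" for s
  proof -
    have "((1 - s) / 2) ^ n \<le> fact n * exp ((1 - s) / 2)"
    proof -
      have "(\<Sum>i\<in>{n}. inverse (fact i) * ((1 - s) / 2) ^ i) \<le> (\<Sum>i. inverse (fact i) * ((1 - s) / 2) ^ i)"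
        using summable_exp[of "(1 - s) / 2"] that by (intro sum_le_suminf) auto
      also have "\<dots> = exp ((1 - s) / 2)"
        by (simp add: exp_def scaleR_conv_of_real)
      finally show ?thesis by (simp add: field_simps)
    qed
    then have "(1 - s) ^ n \<le> fact n * 2 ^ n * exp ((1 - s) / 2)"
      by (simp add: power_divide field_simps)
    also have "\<dots> = C * exp (- s / 2)"
      by (simp add: C_def mult_exp_exp diff_divide_distrib)
    finally have "(1 - s) ^ n \<le> C * exp (- s / 2)" .
    moreover have "(1 - s) powr p \<le> (1 - s) powr real n"
      using n that by (intro powr_mono) auto
    ultimately show ?thesis using that by (simp add: powr_realpow)
  qed
  moreover have "C > 0" by (simp add: C_def)
  ultimately show ?thesis using that by blast
qed

lemma set_integrable_exp_half_Iic: "set_integrable lborel {..0} (\<lambda>s::real. exp (s / 2))"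
proof -
  have "set_integrable lborel (einterval (-\<infinity>) (ereal 1)) (\<lambda>s::real. exp (s / 2))"
  proof (rule interval_integral_FTC_nonneg(1)[where F = "\<lambda>s. 2 * exp (s / 2)" and A = 0 and B = "2 * exp (1 / 2)"])
    show "((\<lambda>s. 2 * exp (s / 2)) has_real_derivative exp (s / 2)) (at s)" for s :: real
      by (auto intro!: derivative_eq_intros)
    have "((\<lambda>s::real. 2 * exp (s / 2)) \<longlongrightarrow> 0) at_bot"
    proof (intro tendsto_mult_right_zero filterlim_compose[OF exp_at_bot])
      show "filterlim (\<lambda>s::real. s / 2) at_bot at_bot"
        unfolding filterlim_at_bot eventually_at_bot_linorder
      proof
        fix Z :: real
        show "\<exists>N. \<forall>n\<le>N. n / 2 \<le> Z" by (rule exI[of _ "2 * Z"]) auto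
      qed
    qed
    then show "(((\<lambda>s. 2 * exp (s / 2)) \<circ> real_of_ereal) \<longlongrightarrow> 0) (at_right (- \<infinity>))"
      by (simp add: ereal_tendsto_simps)
    have "((\<lambda>s::real. 2 * exp (s / 2)) \<longlongrightarrow> 2 * exp (1 / 2)) (at_left 1)"
      by (intro tendsto_intros) simp
    then show "(((\<lambda>s. 2 * exp (s / 2)) \<circ> real_of_ereal) \<longlongrightarrow> 2 * exp (1 / 2)) (at_left (ereal 1))"
      by (simp add: ereal_tendsto_simps)
  qed auto
  then show ?thesis
    by (rule set_integrable_subset) auto
qed

lemma norm_powr_of_real:
  fixes t :: complex
  shows "norm (t powr of_real p) = norm t powr p"
  by (simp add: norm_powr_real_powr')

text \<open>The truncated vertical line and the Hankel contour differ by paths on which the integrand is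
  exponentially smaller than at the saddle point \<open>T\<close>: on \<open>Re t \<le> 0\<close> one has
  \<open>Re (t + T\<^sup>2/t) \<le> 0\<close>, and on \<open>Im t = \<plusminus>T\<close>, \<open>0 \<le> Re t \<le> T\<close> it is at most \<open>3T/2\<close>.\<close>

lemma hankel_integral_approx:
  fixes p :: real
  assumes p: "p \<ge> 0"
  obtains C :: real where "C > 0"
    "\<And>T G. T \<ge> 1 \<Longrightarrow> (\<And>t. t \<in> slit \<Longrightarrow> (G has_field_derivative t powr of_real p * exp (t + of_real (T\<^sup>2) / t)) (at t)) \<Longrightarrow>
       norm (hankel_integral (\<lambda>t. t powr of_real p * exp (t + of_real (T\<^sup>2) / t)) - (G (Complex T T) - G (Complex T (- T))))
         \<le> C * T powr (p + 1) * exp (3 * T / 2)"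
proof -
  obtain C1 where C1: "C1 > 0" "\<And>s. s \<le> 0 \<Longrightarrow> (1 - s) powr p \<le> C1 * exp (- s / 2)"
    using one_minus_powr_le[OF p] by blast
  define J where "J = (LINT s:{..0}|lborel. exp (s / 2 :: real))"
  have J: "J \<ge> 0" unfolding J_def set_lebesgue_integral_def by (intro Bochner_Integration.integral_nonneg) auto
  define C where "C = 2 * (C1 * J) + 2 + 2 * 2 powr p"
  show ?thesis
  proof (rule that[of C])
    show "C > 0" using C1 J by (simp add: C_def add_nonneg_pos)
    fix T :: real and G :: "complex \<Rightarrow> complex"
    assume T: "T \<ge> 1"
    define h :: "complex \<Rightarrow> complex" where "h = (\<lambda>t. t powr of_real p * exp (t + of_real (T\<^sup>2) / t))"
    assume G': "\<And>t. t \<in> slit \<Longrightarrow> (G has_field_derivative t powr of_real p * exp (t + of_real (T\<^sup>2) / t)) (at t)"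
    have G: "(G has_field_derivative h t) (at t)" if "t \<in> slit" for t
      using G'[OF that] by (simp add: h_def)
    have norm_h: "norm (h t) = norm t powr p * exp (Re t + T\<^sup>2 * Re t / (Re t ^ 2 + Im t ^ 2))" for t
      by (simp add: h_def norm_mult norm_powr_of_real norm_exp Re_divide)
    have half: "norm (LINT s:{..0}|lborel. h (Complex s e)) \<le> C1 * J" if "\<bar>e\<bar> = 1" for e :: real
    proof -
      have b: "norm (h (Complex s e)) \<le> C1 * exp (s / 2)" if "s \<le> 0" for s
      proof -
        have "norm (Complex s e) \<le> 1 - s"
          using cmod_le[of "Complex s e"] that \<open>\<bar>e\<bar> = 1\<close> by simp
        then have "norm (Complex s e) powr p \<le> (1 - s) powr p" using p by (intro powr_mono2) auto
        also have "\<dots> \<le> C1 * exp (- s / 2)" by (rule C1(2)[OF that])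
        finally have "norm (Complex s e) powr p \<le> C1 * exp (- s / 2)" .
        moreover have "T\<^sup>2 * s / (s\<^sup>2 + e\<^sup>2) \<le> 0"
          using that by (intro divide_nonpos_nonneg mult_nonneg_nonpos) auto
        then have "exp (s + T\<^sup>2 * s / (s\<^sup>2 + e\<^sup>2)) \<le> exp s" by simp
        ultimately have "norm (h (Complex s e)) \<le> C1 * exp (- s / 2) * exp s"
          unfolding norm_h using C1(1) by (intro mult_mono) auto
        also have "C1 * exp (- s / 2) * exp s = C1 * exp (s / 2)" by (simp add: mult.assoc mult_exp_exp)
        finally show ?thesis .
      qed
      have "norm (LINT s:{..0}|lborel. h (Complex s e)) \<le> (LINT s|lborel. norm (indicator {..0} s *\<^sub>R h (Complex s e)))"
        unfolding set_lebesgue_integral_def by (rule integral_norm_bound)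
      also have "\<dots> \<le> (LINT s|lborel. indicator {..0} s *\<^sub>R (C1 * exp (s / 2)))"
      proof (rule integral_mono')
        have "set_integrable lborel {..0} (\<lambda>s. C1 * exp (s / 2 :: real))"
          by (intro set_integrable_mult_right set_integrable_exp_half_Iic)
        then show "integrable lborel (\<lambda>s. indicator {..0} s *\<^sub>R (C1 * exp (s / 2 :: real)))"
          by (simp add: set_integrable_def)
        show "norm (indicator {..0} s *\<^sub>R h (Complex s e)) \<le> indicator {..0} s *\<^sub>R (C1 * exp (s / 2))" for s :: real
          using b[of s] by (auto simp: indicator_def)
        show "0 \<le> indicator {..0} s *\<^sub>R (C1 * exp (s / 2))" for s :: real
          using C1(1) by (auto simp: indicator_def)
      qed
      also have "\<dots> = C1 * J"
        unfolding J_def set_lebesgue_integral_def by (simp add: mult.left_commute)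
      finally show ?thesis .
    qed
    have arc: "contour_integral (part_circlepath 0 1 (- pi / 2) (pi / 2)) h = G \<i> - G (- \<i>)"
    proof -
      have img: "path_image (part_circlepath 0 1 (- pi / 2) (pi / 2)) \<subseteq> slit"
      proof -
        have "0 + of_real 1 * exp (\<i> * of_real x) \<notin> \<real>\<^sub>\<le>\<^sub>0" if "- pi / 2 \<le> x" "x \<le> pi / 2" for x
        proof (cases "\<bar>x\<bar> = pi / 2")
          case True
          then have "x = pi / 2 \<or> x = - (pi / 2)" by (auto simp: abs_if split: if_splits)
          then have "sin x = 1 \<or> sin x = - 1" by (metis sin_minus sin_pi_half)
          then have "sin x \<noteq> 0" by auto
          then show ?thesis by (simp add: complex_nonpos_Reals_iff Im_exp)
        next
          case False
          then have "cos x > 0" using that by (intro cos_gt_zero_pi) auto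
          then show ?thesis by (simp add: complex_nonpos_Reals_iff Re_exp)
        qed
        then show ?thesis by (auto simp: path_image_part_circlepath slit_def)
      qed
      have "(h has_contour_integral G (pathfinish (part_circlepath 0 1 (- pi / 2) (pi / 2))) -
          G (pathstart (part_circlepath 0 1 (- pi / 2) (pi / 2)))) (part_circlepath 0 1 (- pi / 2) (pi / 2))"
        by (rule contour_integral_primitive[of slit]) (use img G in \<open>auto intro: has_field_derivative_at_within\<close>)
      moreover have "exp (\<i> * of_real (pi / 2)) = \<i>" "exp (\<i> * of_real (- pi / 2)) = - \<i>"
        by (simp_all only: cis_conv_exp[symmetric]) (simp_all add: complex_eq_iff)
      ultimately show ?thesis
        by (simp add: contour_integral_unique)
    qed
    \<comment> \<open>On the imaginary axis t + T^2/t is purely imaginary, so only the power t^p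
      contributes.\<close>
    have vert: "norm (G (Complex 0 (e * T)) - G (Complex 0 e)) \<le> T powr (p + 1)" if "\<bar>e\<bar> = 1" for e
    proof -
      have seg: "Re t = 0 \<and> 1 \<le> \<bar>Im t\<bar> \<and> \<bar>Im t\<bar> \<le> T" if "t \<in> closed_segment (Complex 0 e) (Complex 0 (e * T))" for t
      proof -
        from that obtain u where u: "0 \<le> u" "u \<le> 1" "t = (1 - u) *\<^sub>R Complex 0 e + u *\<^sub>R Complex 0 (e * T)"
          by (auto simp: closed_segment_def)
        then have t: "Im t = (1 - u) * e + u * (e * T)" "Re t = 0" by simp_all
        from t(1) have "Im t = e * (1 + u * (T - 1))" by (simp add: algebra_simps)
        moreover have "0 \<le> u * (T - 1)" using u T by simp
        moreover have "u * (T - 1) \<le> 1 * (T - 1)"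
          using u T by (intro mult_right_mono) auto
        ultimately show ?thesis using t(2) \<open>\<bar>e\<bar> = 1\<close> by (auto simp: abs_mult)
      qed
      have "norm (G (Complex 0 (e * T)) - G (Complex 0 e)) \<le> T powr p * norm (Complex 0 (e * T) - Complex 0 e)"
      proof (rule primitive_segment_bound[OF G])
        show "closed_segment (Complex 0 e) (Complex 0 (e * T)) \<subseteq> slit"
          using seg by (fastforce simp: slit_def complex_nonpos_Reals_iff)
        fix t assume "t \<in> closed_segment (Complex 0 e) (Complex 0 (e * T))"
        from seg[OF this] have "Re t = 0" "norm t \<le> T" using cmod_le[of t] by auto
        then show "norm (h t) \<le> T powr p"
          unfolding norm_h using p by (auto intro: powr_mono2)
      qed
      also have "norm (Complex 0 (e * T) - Complex 0 e) = \<bar>e * (T - 1)\<bar>"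
        by (simp add: complex_diff cmod_def algebra_simps)
      also have "\<dots> = T - 1" using that T by (simp add: abs_mult)
      also have "T powr p * (T - 1) \<le> T powr p * T" by (intro mult_left_mono) auto
      also have "\<dots> = T powr (p + 1)" using T by (simp add: powr_add)
      finally show ?thesis .
    qed
    have hor: "norm (G (Complex T (e * T)) - G (Complex 0 (e * T))) \<le> 2 powr p * T powr (p + 1) * exp (3 * T / 2)"
      if "\<bar>e\<bar> = 1" for e
    proof -
      have seg: "0 \<le> Re t \<and> Re t \<le> T \<and> Im t = e * T" if "t \<in> closed_segment (Complex 0 (e * T)) (Complex T (e * T))" for t
      proof -
        from that obtain u where u: "0 \<le> u" "u \<le> 1" "t = (1 - u) *\<^sub>R Complex 0 (e * T) + u *\<^sub>R Complex T (e * T)"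
          by (auto simp: closed_segment_def)
        then have "Re t = u * T" "Im t = (1 - u) * (e * T) + u * (e * T)" by simp_all
        moreover have "u * T \<le> 1 * T" using u T by (intro mult_right_mono) auto
        ultimately show ?thesis using u(1,2) T by (simp add: algebra_simps)
      qed
      have "norm (G (Complex T (e * T)) - G (Complex 0 (e * T))) \<le>
          ((2 * T) powr p * exp (3 * T / 2)) * norm (Complex T (e * T) - Complex 0 (e * T))"
      proof (rule primitive_segment_bound[OF G])
        have "e * T \<noteq> 0" using that T by auto
        then show "closed_segment (Complex 0 (e * T)) (Complex T (e * T)) \<subseteq> slit"
          using seg by (fastforce simp: slit_def complex_nonpos_Reals_iff)
        fix t assume "t \<in> closed_segment (Complex 0 (e * T)) (Complex T (e * T))"
        from seg[OF this] have t: "0 \<le> Re t" "Re t \<le> T" "\<bar>Im t\<bar> = T" "Im t ^ 2 = T\<^sup>2"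
          using that T by (auto simp: abs_mult power_mult_distrib abs_square_eq_1)
        have "norm t \<le> 2 * T" using cmod_le[of t] t by simp
        then have 1: "norm t powr p \<le> (2 * T) powr p" using p by (intro powr_mono2) auto
        \<comment> \<open>Nonnegativity of the square gives T^2 Re t / ((Re t)^2 + T^2) <= T/2. With
          Re t <= T the exponent is at most 3T/2, below the 2T at the saddle point.\<close>
        have "0 \<le> T * (Re t - T)\<^sup>2" using T by simp
        then have "2 * (T\<^sup>2 * Re t) \<le> T * (Re t ^ 2 + T\<^sup>2)"
          by (simp add: power2_eq_square algebra_simps)
        then have "T\<^sup>2 * Re t / (Re t ^ 2 + T\<^sup>2) \<le> T / 2"
          using T by (simp add: divide_le_eq sum_power2_gt_zero_iff)
        then have "Re t + T\<^sup>2 * Re t / (Re t ^ 2 + Im t ^ 2) \<le> 3 * T / 2"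
          using t by simp
        then show "norm (h t) \<le> (2 * T) powr p * exp (3 * T / 2)"
          unfolding norm_h using 1 by (intro mult_mono) auto
      qed
      also have "norm (Complex T (e * T) - Complex 0 (e * T)) = T"
        using T by (simp add: complex_diff cmod_def)
      also have "(2 * T) powr p * exp (3 * T / 2) * T = 2 powr p * T powr (p + 1) * exp (3 * T / 2)"
        using T by (simp add: powr_mult powr_add)
      finally show ?thesis .
    qed
    have ii: "Complex 0 1 = \<i>" "Complex 0 (- 1) = - \<i>" by (simp_all add: complex_eq_iff)
    \<comment> \<open>\<open>a1\<close> and \<open>a2\<close> are the rays, \<open>a3\<close> to
      \<open>a6\<close> the connecting segments. The value G(i) - G(-i) of the arc is cancelled
      through \<open>a3\<close> and \<open>a4\<close>, and the rest telescopes.\<close>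
    define a1 a2 a3 a4 a5 a6 where "a1 = (LINT s:{..0}|lborel. h (Complex s (-1)))"
      and "a2 = (LINT s:{..0}|lborel. h (Complex s 1))"
      and "a3 = G (Complex 0 T) - G \<i>" and "a4 = G (Complex 0 (- T)) - G (- \<i>)"
      and "a5 = G (Complex T T) - G (Complex 0 T)" and "a6 = G (Complex T (- T)) - G (Complex 0 (- T))"
    have "hankel_integral h - (G (Complex T T) - G (Complex T (- T))) = a1 - a2 - a3 + a4 - a5 + a6"
      unfolding hankel_integral_def arc a1_def a2_def a3_def a4_def a5_def a6_def by simp
    also have "norm \<dots> \<le> norm a1 + norm a2 + norm a3 + norm a4 + norm a5 + norm a6"
      by (intro norm_triangle_le norm_triangle_le_diff add_mono order_refl)
    also have "\<dots> \<le> C1 * J + C1 * J + T powr (p + 1) + T powr (p + 1) +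
        2 powr p * T powr (p + 1) * exp (3 * T / 2) + 2 powr p * T powr (p + 1) * exp (3 * T / 2)"
      using half[of "-1"] half[of 1] vert[of 1] vert[of "-1"] hor[of 1] hor[of "-1"]
      unfolding a1_def a2_def a3_def a4_def a5_def a6_def by (intro add_mono) (simp_all add: ii)
    also have "\<dots> \<le> C * T powr (p + 1) * exp (3 * T / 2)"
    proof -
      define X Y where "X = T powr (p + 1)" and "Y = exp (3 * T / 2)"
      have XY: "X \<ge> 1" "Y \<ge> 1" using T p by (auto simp: X_def Y_def ge_one_powr_ge_zero)
      have "1 * 1 \<le> X * Y" using XY by (intro mult_mono) auto
      then have "C1 * J * 1 \<le> C1 * J * (X * Y)" using C1 J by (intro mult_left_mono) auto
      moreover have "X * 1 \<le> X * Y" using XY by (intro mult_left_mono) auto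
      ultimately show ?thesis unfolding X_def[symmetric] Y_def[symmetric] C_def
        by (simp add: algebra_simps)
    qed
    finally show "norm (hankel_integral (\<lambda>t. t powr of_real p * exp (t + of_real (T\<^sup>2) / t)) -
        (G (Complex T T) - G (Complex T (- T)))) \<le> C * T powr (p + 1) * exp (3 * T / 2)"
      by (simp add: h_def)
  qed
qed

text \<open>The substitution \<open>t = n z\<close> with \<open>n z = T\<close> at the saddle point \<open>z = x = c/\<surd>n\<close>.\<close>

lemma bessel_I_approx:
  fixes p c :: real
  assumes p: "p \<ge> 0" and c: "c > 0"
  obtains C :: real where "C > 0"
    "\<And>n T x. n > 0 \<Longrightarrow> T = c * sqrt n \<Longrightarrow> x = c / sqrt n \<Longrightarrow> T \<ge> 1 \<Longrightarrow>
       \<exists>I. ((\<lambda>y. Complex x y powr of_real p * exp (of_real n * Complex x y + of_real (c\<^sup>2) / Complex x y)) has_integral I) {-x..x} \<and>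
       norm (I / of_real (2 * pi) - of_real (n powr (- (1 + p) / 2) * c powr (1 + p)) * bessel_I (- 1 - p) (2 * T))
         \<le> C * n powr (- 1 - p) * T powr (p + 1) * exp (3 * T / 2)"
proof -
  obtain C :: real where C: "C > 0"
    "\<And>T G. T \<ge> 1 \<Longrightarrow> (\<And>t. t \<in> slit \<Longrightarrow> (G has_field_derivative t powr of_real p * exp (t + of_real (T\<^sup>2) / t)) (at t)) \<Longrightarrow>
       norm (hankel_integral (\<lambda>t. t powr of_real p * exp (t + of_real (T\<^sup>2) / t)) - (G (Complex T T) - G (Complex T (- T))))
         \<le> C * T powr (p + 1) * exp (3 * T / 2)"
    using hankel_integral_approx[OF p] by blast
  show ?thesis
  proof (rule that[OF C(1)])
    fix n T x :: real
    assume n: "n > 0" and T: "T = c * sqrt n" and x: "x = c / sqrt n" and T1: "T \<ge> 1"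
    have nx: "n * x = T" using n by (simp add: T x field_simps flip: real_sqrt_mult)
    have x0: "x > 0" using c n by (simp add: x)
    have T2: "T\<^sup>2 = n * c\<^sup>2" using n by (simp add: T power_mult_distrib)
    define h :: "complex \<Rightarrow> complex" where "h = (\<lambda>t. t powr of_real p * exp (t + of_real (T\<^sup>2) / t))"
    have "h holomorphic_on slit"
      unfolding h_def by (intro holomorphic_intros) (auto simp: slit_def)
    then obtain G where G: "\<And>t. t \<in> slit \<Longrightarrow> (G has_field_derivative h t) (at t)"
      using slit_primitive by blast
    define H where "H = hankel_integral h"
    have H: "norm (H - (G (Complex T T) - G (Complex T (- T)))) \<le> C * T powr (p + 1) * exp (3 * T / 2)"
      using C(2)[OF T1, of G] G unfolding H_def h_def by blast
    have Cxy: "Complex x y = of_real x + \<i> * of_real y" for y by (simp add: complex_eq_iff)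
    have nC: "of_real n * Complex x y = Complex T (n * y)" for y
      using nx by (simp add: complex_eq_iff)
    have inS: "of_real n * Complex x y \<in> slit" for y
      using T1 by (simp add: nC slit_def complex_nonpos_Reals_iff)
    have hn: "h (of_real n * Complex x y) = of_real (n powr p) * (Complex x y powr of_real p *
        exp (of_real n * Complex x y + of_real (c\<^sup>2) / Complex x y))" for y
    proof -
      have "(of_real n * Complex x y) powr of_real p = of_real (n powr p) * Complex x y powr of_real p"
        using n powr_times_real_left[of "of_real n" "Complex x y" "of_real p"] by (simp add: powr_of_real)
      moreover have "of_real (T\<^sup>2) / (of_real n * Complex x y) = of_real (c\<^sup>2) / Complex x y"
        using n by (simp add: T2)
      ultimately show ?thesis by (simp only: h_def mult.assoc)
    qed
    have "((\<lambda>y. of_real n * \<i> * h (of_real n * Complex x y)) has_integral (G (of_real n * Complex x x) - G (of_real n * Complex x (- x)))) {- x..x}"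
    proof (rule fundamental_theorem_of_calculus)
      show "- x \<le> x" using x0 by simp
      fix y assume "y \<in> {- x..x}"
      have "((\<lambda>y. of_real n * Complex x y) has_vector_derivative of_real n * \<i>) (at y within {- x..x})"
        unfolding Cxy has_vector_derivative_def
        by (auto intro!: derivative_eq_intros simp: scaleR_conv_of_real algebra_simps)
      from field_vector_diff_chain_within[OF this has_field_derivative_at_within[OF G[OF inS]]]
      show "((\<lambda>y. G (of_real n * Complex x y)) has_vector_derivative of_real n * \<i> * h (of_real n * Complex x y)) (at y within {- x..x})"
        by (simp add: o_def)
    qed
    then have "((\<lambda>y. inverse (of_real n * \<i> * of_real (n powr p)) * (of_real n * \<i> * h (of_real n * Complex x y))) has_integral
        inverse (of_real n * \<i> * of_real (n powr p)) * (G (of_real n * Complex x x) - G (of_real n * Complex x (- x)))) {- x..x}"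
      by (rule has_integral_mult_right)
    moreover have "inverse (of_real n * \<i> * of_real (n powr p)) * (of_real n * \<i> * h (of_real n * Complex x y)) =
        Complex x y powr of_real p * exp (of_real n * Complex x y + of_real (c\<^sup>2) / Complex x y)" for y
      unfolding hn using n by (simp add: field_simps)
    moreover have "G (of_real n * Complex x x) - G (of_real n * Complex x (- x)) = G (Complex T T) - G (Complex T (- T))"
      unfolding nC using nx by simp
    ultimately have I: "((\<lambda>y. Complex x y powr of_real p * exp (of_real n * Complex x y + of_real (c\<^sup>2) / Complex x y)) has_integral
        inverse (of_real n * \<i> * of_real (n powr p)) * (G (Complex T T) - G (Complex T (- T)))) {- x..x}"
      by simp
    define I where "I = inverse (of_real n * \<i> * of_real (n powr p)) * (G (Complex T T) - G (Complex T (- T)))"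
    define k where "k = inverse (of_real n * \<i> * of_real (n powr p)) / of_real (2 * pi)"
    \<comment> \<open>The exponent p corresponds to \<nu> = -1 - p, since -\<nu> - 1 = p. The
      prefactor of \<open>bessel_I\<close> is T^(-1-p); its power of c cancels, and the powers of n
      combine to n^(-1-p), as the substitution t = nz demands.\<close>
    have bess: "of_real (n powr (- (1 + p) / 2) * c powr (1 + p)) * bessel_I (- 1 - p) (2 * T) = k * H"
    proof -
      have "(2 * T / 2)\<^sup>2 powr ((- 1 - p) / 2) = T powr (- 1 - p)"
        using T1 by (simp add: powr_powr diff_divide_distrib flip: powr_numeral)
      moreover have "(\<lambda>t. t powr (- of_real (- 1 - p) - 1) * exp (t + of_real ((2 * T / 2)\<^sup>2) / t)) = h"
        by (simp add: h_def)
      ultimately have "bessel_I (- 1 - p) (2 * T) = of_real (T powr (- 1 - p)) / (2 * of_real pi * \<i>) * H"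
        unfolding bessel_I_def Let_def H_def by simp
      moreover have "n powr (- (1 + p) / 2) * c powr (1 + p) * T powr (- 1 - p) = inverse (n * n powr p)"
      proof -
        have "T powr (- 1 - p) = c powr (- 1 - p) * n powr ((- 1 - p) / 2)"
          unfolding T using c n by (simp add: powr_mult powr_half_sqrt[symmetric] powr_powr)
        moreover have "c powr (1 + p) * c powr (- 1 - p) = 1"
          using c by (simp flip: powr_add)
        moreover have "n powr (- (1 + p) / 2) * n powr ((- 1 - p) / 2) = n powr (- (1 + p))"
        proof -
          have "- (1 + p) / 2 + (- 1 - p) / 2 = - (1 + p)" by (simp add: field_simps)
          then show ?thesis by (simp only: powr_add[symmetric])
        qed
        moreover have "n powr (- (1 + p)) = inverse (n * n powr p)"
          using n by (simp only: powr_minus powr_add) simp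
        ultimately show ?thesis
          by (metis (no_types, opaque_lifting) mult.assoc mult.commute mult.right_neutral)
      qed
      ultimately have "of_real (n powr (- (1 + p) / 2) * c powr (1 + p)) * bessel_I (- 1 - p) (2 * T) =
          of_real (inverse (n * n powr p)) / (2 * of_real pi * \<i>) * H"
        by (metis (no_types, opaque_lifting) mult.assoc of_real_mult times_divide_eq_right)
      then show ?thesis by (simp add: k_def field_simps)
    qed
    have "I / of_real (2 * pi) - k * H = - (k * (H - (G (Complex T T) - G (Complex T (- T)))))"
    proof -
      have "j * X / d - j / d * Y = - (j / d * (Y - X))" for j X Y d :: complex
        by (simp add: divide_inverse algebra_simps)
      then show ?thesis unfolding I_def k_def .
    qed
    then have "norm (I / of_real (2 * pi) - k * H) = norm k * norm (H - (G (Complex T T) - G (Complex T (- T))))"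
      by (simp add: norm_mult)
    also have "\<dots> \<le> n powr (- 1 - p) * (C * T powr (p + 1) * exp (3 * T / 2))"
    proof (rule mult_mono[OF _ H])
      have "norm k = inverse (n * n powr p) / (2 * pi)"
        using n by (simp add: k_def norm_mult norm_divide norm_inverse)
      also have "\<dots> \<le> inverse (n * n powr p) / 1"
        using n pi_gt3 by (intro divide_left_mono) auto
      also have "\<dots> = n powr (- (1 + p))"
        using n by (simp only: powr_minus powr_add) simp
      also have "- (1 + p) = - 1 - p" by simp
      finally show "norm k \<le> n powr (- 1 - p)" .
    qed auto
    also have "\<dots> = C * n powr (- 1 - p) * T powr (p + 1) * exp (3 * T / 2)" by (simp add: mult_ac)
    finally show "\<exists>I. ((\<lambda>y. Complex x y powr of_real p * exp (of_real n * Complex x y + of_real (c\<^sup>2) / Complex x y)) has_integral I) {-x..x} \<and>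
       norm (I / of_real (2 * pi) - of_real (n powr (- (1 + p) / 2) * c powr (1 + p)) * bessel_I (- 1 - p) (2 * T))
         \<le> C * n powr (- 1 - p) * T powr (p + 1) * exp (3 * T / 2)"
      using I unfolding bess I_def by blast
  qed
qed

section \<open>The circle method\<close>

text \<open>Savings exponential in sqrt n absorb any power of n: for an integer j >= b, n^b is at
  most (sqrt n)^(2j), hence at most a constant times exp(a sqrt n).\<close>

lemma exp_sqrt_le:
  fixes a b :: real
  assumes a: "a > 0"
  obtains C :: real where "C > 0" "\<And>n. n \<ge> 1 \<Longrightarrow> exp (- (a * sqrt n)) \<le> C * n powr (- b)"
proof -
  obtain j where j: "b \<le> real j" using real_arch_simple by blast
  define C :: real where "C = fact (2 * j) / a ^ (2 * j)"
  have C: "C > 0" using a by (simp add: C_def)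
  have "exp (- (a * sqrt n)) \<le> C * n powr (- b)" if n: "n \<ge> 1" for n :: real
  proof -
    have "n powr b \<le> n powr real j" using n j by (intro powr_mono) auto
    also have "\<dots> = sqrt n ^ (2 * j)" using n by (simp add: powr_realpow power_mult)
    also have "\<dots> \<le> C * exp (a * sqrt n)"
      unfolding C_def by (rule power_le_exp) (use n a in auto)
    finally have "n powr b \<le> C * exp (a * sqrt n)" .
    then show ?thesis using n by (simp add: exp_minus powr_minus field_simps)
  qed
  with C that show ?thesis by blast
qed

lemma norm_fourier_Phi_le:
  assumes "\<And>c. norm c = 1 \<Longrightarrow> norm (Phi k c q) \<le> B"
  shows "norm (fourier_Phi k m q) \<le> B"
proof -
  have B: "B \<ge> 0" using order_trans[OF norm_ge_zero assms[of 1]] by simp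
  show ?thesis
  proof (cases "(\<lambda>w::real. Phi k (qpar (of_real w)) q * qpar (- of_int m * of_real w)) integrable_on {-1/2..1/2}")
    case True
    have "norm (fourier_Phi k m q) \<le> B * measure lborel {-1/2..1/2::real}"
      using assms B unfolding fourier_Phi_def
      by (intro has_integral_bound_real[OF _ finite.emptyI integrable_integral[OF True]]) (auto simp: norm_mult)
    then show ?thesis by simp
  next
    \<comment> \<open>The integral of a non-integrable function is 0 by convention, so the bound
      holds in this case too.\<close>
    case False
    then show ?thesis using B by (simp add: fourier_Phi_def not_integrable_integral)
  qed
qed

text \<open>Division by the positive number 2 pi changes Ln by a real constant and so stays on the
  principal branch. The k-th power of the root is then the principal power z^(k/2) up to a
  scalar.\<close>

lemma csqrt_power_eq_powr:
  assumes "z \<noteq> 0"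
  shows "csqrt (z / (2 * of_real pi)) ^ k = of_real ((2 * pi) powr (- real k / 2)) * z powr of_real (real k / 2)"
proof -
  have L: "Ln (z / (2 * of_real pi)) = Ln z - of_real (ln (2 * pi))"
  proof (rule Ln_unique)
    have "exp (complex_of_real (ln (2 * pi))) = 2 * of_real pi"
      unfolding exp_of_real by simp
    then show "exp (Ln z - of_real (ln (2 * pi))) = z / (2 * of_real pi)"
      using assms by (simp only: exp_diff exp_Ln not_False_eq_True)
  qed (use mpi_less_Im_Ln[OF assms] Im_Ln_le_pi[OF assms] in simp_all)
  have nz: "z / (2 * of_real pi) \<noteq> 0" using assms by simp
  have "csqrt (z / (2 * of_real pi)) ^ k = exp (of_nat k * (Ln (z / (2 * of_real pi)) / 2))"
    unfolding csqrt_exp_Ln[OF nz] exp_of_nat_mult ..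
  also have "of_nat k * (Ln (z / (2 * of_real pi)) / 2) = of_real (- real k / 2 * ln (2 * pi)) + of_real (real k / 2) * Ln z"
    unfolding L by (simp add: field_simps)
  also have "exp \<dots> = of_real ((2 * pi) powr (- real k / 2)) * z powr of_real (real k / 2)"
  proof -
    have "exp (of_real (- real k / 2 * ln (2 * pi))) = complex_of_real ((2 * pi) powr (- real k / 2))"
      unfolding exp_of_real by (simp add: powr_def)
    moreover have "exp (of_real (real k / 2) * Ln z) = z powr of_real (real k / 2)"
      using assms by (simp add: powr_def)
    ultimately show ?thesis by (simp only: exp_add)
  qed
  finally show ?thesis .
qed

lemma norm_integral_le_interval:
  fixes f :: "real \<Rightarrow> complex"
  assumes "f integrable_on {a..b}" "a \<le> b" "B \<ge> 0" "\<And>y. y \<in> {a..b} \<Longrightarrow> norm (f y) \<le> B"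
  shows "norm (integral {a..b} f) \<le> B * (b - a)"
proof -
  have "norm (integral {a..b} f) \<le> B * measure lborel {a..b}"
    by (rule has_integral_bound_real[OF assms(3) finite.emptyI integrable_integral[OF assms(1)]]) (use assms(4) in auto)
  then show ?thesis using assms(2) by simp
qed

text \<open>Circle method on the circle \<open>Re z = x = c/\<surd>n\<close>, where both \<open>e\<^bsup>nz\<^esup>\<close> and \<open>e\<^bsup>c\<^sup>2/z\<^esup>\<close> have size
  at most \<open>e\<^bsup>T\<^esup>\<close> with \<open>T = c\<surd>n\<close>.\<close>

lemma acoeff_circle_method:
  fixes k N :: nat and m :: int
  assumes k: "k \<ge> 1" and N: "N \<ge> 1"
  defines "c \<equiv> pi * sqrt (real k / 6)"
  obtains n0 C :: real where
    "\<And>n. real n \<ge> n0 \<Longrightarrow>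
      norm (acoeff k m n - of_real ((2 * pi) powr (- real k / 2)) *
        (\<Sum>l=1..N. dcoeff m k l * (of_real (real n powr (- (1 + (real l + real k / 2)) / 2) * c powr (1 + (real l + real k / 2))) *
          bessel_I (- 1 - (real l + real k / 2)) (2 * (c * sqrt (real n))))))
      \<le> C * (real n powr (- 1 - real N / 2 - real k / 4) * exp (2 * (c * sqrt (real n))))"
proof -
  define e where "e = 1 + real N / 2 + real k / 4"
  define p where "p = (\<lambda>l::nat. real l + real k / 2)"
  have c: "c > 0" using k by (simp add: c_def)
  have c2: "c\<^sup>2 = real k * pi\<^sup>2 / 6" by (simp add: c_def power_mult_distrib)
  obtain CM \<epsilon> :: real where M: "CM > 0" "\<epsilon> > 0"
    "\<And>z. z \<in> sector \<Longrightarrow> z \<noteq> 0 \<Longrightarrow> norm z < \<epsilon> \<Longrightarrow>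
      \<exists>B. fourier_Phi k m (exp (- z)) = csqrt (z / (2 * of_real pi)) ^ k * exp (of_real (real k * pi\<^sup>2 / 6) / z) * B \<and>
        norm (B - (\<Sum>l=1..N. dcoeff m k l * z ^ l)) \<le> CM * norm z ^ (N + 1)"
    by (rule fourier_Phi_major_arc[OF N, of k m]) (rule that)
  have *: "\<exists>Cb>0. \<forall>n T x. n > 0 \<longrightarrow> T = c * sqrt n \<longrightarrow> x = c / sqrt n \<longrightarrow> T \<ge> 1 \<longrightarrow>
       (\<exists>I. ((\<lambda>y. Complex x y powr of_real (p l) * exp (of_real n * Complex x y + of_real (c\<^sup>2) / Complex x y)) has_integral I) {-x..x} \<and>
       norm (I / of_real (2 * pi) - of_real (n powr (- (1 + p l) / 2) * c powr (1 + p l)) * bessel_I (- 1 - p l) (2 * T))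
         \<le> Cb * n powr (- 1 - p l) * T powr (p l + 1) * exp (3 * T / 2))" for l
  proof -
    have "p l \<ge> 0" by (simp add: p_def)
    from bessel_I_approx[OF this c] obtain Cb where "Cb > 0"
      "\<And>n T x. n > 0 \<Longrightarrow> T = c * sqrt n \<Longrightarrow> x = c / sqrt n \<Longrightarrow> T \<ge> 1 \<Longrightarrow>
       \<exists>I. ((\<lambda>y. Complex x y powr of_real (p l) * exp (of_real n * Complex x y + of_real (c\<^sup>2) / Complex x y)) has_integral I) {-x..x} \<and>
       norm (I / of_real (2 * pi) - of_real (n powr (- (1 + p l) / 2) * c powr (1 + p l)) * bessel_I (- 1 - p l) (2 * T))
         \<le> Cb * n powr (- 1 - p l) * T powr (p l + 1) * exp (3 * T / 2)"
      by blast
    then show ?thesis by blast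
  qed
  define Q where "Q = (\<lambda>l Cb. Cb > 0 \<and> (\<forall>n T x. n > 0 \<longrightarrow> T = c * sqrt n \<longrightarrow> x = c / sqrt n \<longrightarrow> T \<ge> 1 \<longrightarrow>
       (\<exists>I. ((\<lambda>y. Complex x y powr of_real (p l) * exp (of_real n * Complex x y + of_real (c\<^sup>2) / Complex x y)) has_integral I) {-x..x} \<and>
       norm (I / of_real (2 * pi) - of_real (n powr (- (1 + p l) / 2) * c powr (1 + p l)) * bessel_I (- 1 - p l) (2 * T))
         \<le> Cb * n powr (- 1 - p l) * T powr (p l + 1) * exp (3 * T / 2))))"
  have "\<forall>l. \<exists>Cb. Q l Cb" using * unfolding Q_def by blast
  from choice[OF this] obtain Cb where Q: "\<And>l. Q l (Cb l)" by blast
  have Cb: "Cb l > 0" for l using Q[of l] by (simp add: Q_def)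
  have bess: "\<exists>I. ((\<lambda>y. Complex x y powr of_real (p l) * exp (of_real n * Complex x y + of_real (c\<^sup>2) / Complex x y)) has_integral I) {-x..x} \<and>
       norm (I / of_real (2 * pi) - of_real (n powr (- (1 + p l) / 2) * c powr (1 + p l)) * bessel_I (- 1 - p l) (2 * T))
         \<le> Cb l * n powr (- 1 - p l) * T powr (p l + 1) * exp (3 * T / 2)"
    if "n > 0" "T = c * sqrt n" "x = c / sqrt n" "T \<ge> 1" for l n T x
    using Q[of l] that unfolding Q_def by blast
  \<comment> \<open>The extra 4 in the exponent pays for the factor (2/x)^8 of the minor arc bound,
    which has order n^4.\<close>
  obtain C3 where C3: "C3 > 0" "\<And>n. n \<ge> 1 \<Longrightarrow> exp (- (real k * minor_gain / c * sqrt n)) \<le> C3 * n powr (- (e + 4))"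
    using exp_sqrt_le[of "real k * minor_gain / c" "e + 4"] k c minor_gain_pos by auto
  obtain C4 where C4: "C4 > 0" "\<And>n. n \<ge> 1 \<Longrightarrow> exp (- (c / 2 * sqrt n)) \<le> C4 * n powr (- e)"
    using exp_sqrt_le[of "c / 2" e] c by auto
  \<comment> \<open>The four thresholds secure in turn n >= 1, x <= 1, T >= 1 and 2x < \<epsilon>;
    the last places the whole major arc where the expansion is valid.\<close>
  define n0 where "n0 = Max {1, c\<^sup>2, 1 / c\<^sup>2, (4 * c / \<epsilon>)\<^sup>2}"
  define C where "C = (2 / c) ^ 8 * C3 + CM * (2 * c) powr (real k / 2 + real N + 2) +
    (\<Sum>l=1..N. norm (dcoeff m k l) * (Cb l * c powr (p l + 1) * C4))"
  have main: "norm (acoeff k m n - of_real ((2 * pi) powr (- real k / 2)) *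
        (\<Sum>l=1..N. dcoeff m k l * (of_real (real n powr (- (1 + p l) / 2) * c powr (1 + p l)) * bessel_I (- 1 - p l) (2 * (c * sqrt (real n))))))
      \<le> C * (real n powr (- e) * exp (2 * (c * sqrt (real n))))" if nn: "real n \<ge> n0" for n
  proof -
    define r where "r = sqrt (real n)"
    define T x where "T = c * r" and "x = c / r"
    have n: "real n \<ge> 1" "real n \<ge> c\<^sup>2" "real n \<ge> 1 / c\<^sup>2" "real n \<ge> (4 * c / \<epsilon>)\<^sup>2"
      using nn by (auto simp: n0_def)
    have r: "r \<ge> 1" "r \<ge> c" "r \<ge> 1 / c" "r \<ge> 4 * c / \<epsilon>" "r ^ 2 = real n"
      using n real_le_rsqrt[OF n(2)] real_le_rsqrt[OF n(4)] real_le_rsqrt[of "1 / c" "real n"]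
      by (auto simp: r_def power_divide)
    have x: "x > 0" "x \<le> 1" using c r by (simp_all add: x_def field_simps)
    have x\<epsilon>: "2 * x < \<epsilon>"
    proof -
      have "2 * c < r * \<epsilon>" using r(4) M(2) c by (simp add: field_simps)
      then show ?thesis using r(1) by (simp add: x_def field_simps)
    qed
    have T1: "T \<ge> 1" using r c by (simp add: T_def field_simps)
    have nx: "real n * x = T" using r by (simp add: x_def T_def power2_eq_square flip: r(5))
    have cx: "c\<^sup>2 / x = T" using c r by (simp add: x_def T_def power2_eq_square)
    define f where "f = (\<lambda>y. fourier_Phi k m (exp (- Complex x y)) * exp (of_nat n * Complex x y))"
    have f: "(f has_integral (2 * of_real pi * acoeff k m n)) {-pi..pi}"
      unfolding f_def by (rule acoeff_contour[OF x(1)])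
    have xpi: "x \<le> pi" using x pi_ge_two by linarith
    have fint: "f integrable_on {-pi..-x}" "f integrable_on {-x..x}" "f integrable_on {x..pi}"
      using xpi x by (auto intro!: integrable_on_subinterval[OF has_integral_integrable[OF f]])
    have "(f has_integral (integral {-pi..-x} f + integral {-x..x} f)) {-pi..x}"
      using xpi x fint by (intro has_integral_combine[of "-pi" "-x" x] integrable_integral) auto
    then have "(f has_integral (integral {-pi..-x} f + integral {-x..x} f + integral {x..pi} f)) {-pi..pi}"
      using xpi x fint by (intro has_integral_combine[of "-pi" x pi] integrable_integral) auto
    with f have split: "2 * of_real pi * acoeff k m n = integral {-pi..-x} f + integral {-x..x} f + integral {x..pi} f"
      by (rule has_integral_unique)

    define Mn where "Mn = (2 / x) ^ 8 * exp (real k * (pi\<^sup>2 / 6 - minor_gain) / x) * exp T"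
    have Mn: "Mn \<ge> 0" using x by (simp add: Mn_def)
    have minor: "norm (f y) \<le> Mn" if "x \<le> \<bar>y\<bar>" "\<bar>y\<bar> \<le> pi" for y
    proof -
      have "norm (fourier_Phi k m (exp (- Complex x y))) \<le> (2 / x) ^ 8 * exp (real k * (pi\<^sup>2 / 6 - minor_gain) / x)"
        by (intro norm_fourier_Phi_le Phi_minor_arc x that)
      then show ?thesis
        unfolding f_def Mn_def norm_mult by (intro mult_mono) (auto simp: norm_exp nx)
    qed
    have minor1: "norm (integral {-pi..-x} f) \<le> Mn * pi"
    proof -
      have "norm (integral {-pi..-x} f) \<le> Mn * (- x - - pi)"
        using xpi x Mn by (intro norm_integral_le_interval fint minor) auto
      also have "\<dots> \<le> Mn * pi" using x Mn by (intro mult_left_mono) auto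
      finally show ?thesis .
    qed
    have minor2: "norm (integral {x..pi} f) \<le> Mn * pi"
    proof -
      have "norm (integral {x..pi} f) \<le> Mn * (pi - x)"
        using xpi x Mn by (intro norm_integral_le_interval fint minor) auto
      also have "\<dots> \<le> Mn * pi" using x Mn by (intro mult_left_mono) auto
      finally show ?thesis .
    qed

    define A where "A = (2 * pi) powr (- real k / 2)"
    have A: "0 \<le> A" "A \<le> 1"
    proof -
      show "0 \<le> A" by (simp add: A_def)
      have "1 \<le> 2 * pi" using pi_ge_two by linarith
      then have "(2 * pi) powr (- real k / 2) \<le> (2 * pi) powr 0" by (intro powr_mono) auto
      then show "A \<le> 1" using pi_gt_zero by (simp add: A_def)
    qed
    have "\<forall>l. \<exists>I. ((\<lambda>y. Complex x y powr of_real (p l) * exp (of_real (real n) * Complex x y + of_real (c\<^sup>2) / Complex x y)) has_integral I) {-x..x} \<and>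
       norm (I / of_real (2 * pi) - of_real (real n powr (- (1 + p l) / 2) * c powr (1 + p l)) * bessel_I (- 1 - p l) (2 * T))
         \<le> Cb l * real n powr (- 1 - p l) * T powr (p l + 1) * exp (3 * T / 2)"
      using bess[of "real n" T x] n(1) T1 by (auto simp: T_def x_def r_def)
    from choice[OF this] obtain I where
      I: "\<And>l. ((\<lambda>y. Complex x y powr of_real (p l) * exp (of_real (real n) * Complex x y + of_real (c\<^sup>2) / Complex x y)) has_integral I l) {-x..x}"
      and Ib: "\<And>l. norm (I l / of_real (2 * pi) - of_real (real n powr (- (1 + p l) / 2) * c powr (1 + p l)) * bessel_I (- 1 - p l) (2 * T))
         \<le> Cb l * real n powr (- 1 - p l) * T powr (p l + 1) * exp (3 * T / 2)"
      by blast
    define S where "S = (\<Sum>l=1..N. dcoeff m k l * I l)"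
    define g where "g = (\<lambda>y. of_real A * (\<Sum>l=1..N. dcoeff m k l * (Complex x y powr of_real (p l) *
      exp (of_real (real n) * Complex x y + of_real (c\<^sup>2) / Complex x y))))"
    have g: "(g has_integral (of_real A * S)) {-x..x}"
      unfolding g_def S_def by (intro has_integral_mult_right has_integral_sum I) auto
    \<comment> \<open>On the major arc norm z <= 2x and both exponentials are at most exp T. The
      power of x comes from z^(k/2) and the remainder of order N + 1; the length 2x of the arc adds
      one more, which makes exactly n^(-e).\<close>
    define Mj where "Mj = CM * (2 * x) powr (real k / 2 + real N + 1) * exp (2 * T)"
    have Mj: "Mj \<ge> 0" using M(1) by (simp add: Mj_def)
    have major: "norm (f y - g y) \<le> Mj" if y: "y \<in> {-x..x}" for y
    proof -
      define z where "z = Complex x y"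
      have z: "z \<in> sector" "z \<noteq> 0" using x y by (auto simp: z_def sector_def complex_eq_iff)
      have nz: "norm z \<le> 2 * x" using norm_le_2_Re[of z] z(1) by (simp add: sector_def z_def)
      obtain B where B: "fourier_Phi k m (exp (- z)) = csqrt (z / (2 * of_real pi)) ^ k * exp (of_real (real k * pi\<^sup>2 / 6) / z) * B"
        "norm (B - (\<Sum>l=1..N. dcoeff m k l * z ^ l)) \<le> CM * norm z ^ (N + 1)"
        using M(3)[OF z] nz x\<epsilon> by (meson le_less_trans)
      define E where "E = exp (of_real (real n) * z + of_real (c\<^sup>2) / z)"
      have fy: "f y = of_real A * z powr of_real (real k / 2) * E * B"
      proof -
        have "f y = (of_real A * z powr of_real (real k / 2)) * exp (of_real (c\<^sup>2) / z) * B * exp (of_nat n * z)"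
          unfolding f_def z_def[symmetric] B(1) csqrt_power_eq_powr[OF z(2)] A_def c2 ..
        also have "\<dots> = of_real A * z powr of_real (real k / 2) * E * B"
          by (simp add: E_def exp_add mult_ac)
        finally show ?thesis .
      qed
      have "z powr of_real (p l) = z powr of_real (real k / 2) * z ^ l" for l
        using z(2) by (simp add: p_def powr_add mult.commute)
      then have gy: "g y = of_real A * z powr of_real (real k / 2) * E * (\<Sum>l=1..N. dcoeff m k l * z ^ l)"
        unfolding g_def z_def[symmetric] E_def[symmetric] by (simp add: sum_distrib_left mult_ac)
      have nE: "norm E \<le> exp (2 * T)"
      proof -
        have "Re (of_real (c\<^sup>2) / z) = c\<^sup>2 * x / (x\<^sup>2 + y\<^sup>2)" by (simp add: z_def Re_divide)
        also have "\<dots> \<le> c\<^sup>2 * x / x\<^sup>2" using x by (intro divide_left_mono) (auto simp: sum_power2_gt_zero_iff)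
        also have "\<dots> = T" using x by (simp add: power2_eq_square flip: cx)
        finally have "Re (of_real (c\<^sup>2) / z) \<le> T" .
        moreover have "Re (of_real (real n) * z) = T" by (simp add: z_def nx)
        ultimately show ?thesis by (simp only: E_def norm_exp_eq_Re plus_complex.sel exp_le_cancel_iff)
      qed
      have "f y - g y = of_real A * z powr of_real (real k / 2) * E * (B - (\<Sum>l=1..N. dcoeff m k l * z ^ l))"
        unfolding fy gy by (simp add: right_diff_distrib)
      then have "norm (f y - g y) = A * norm z powr (real k / 2) * norm E * norm (B - (\<Sum>l=1..N. dcoeff m k l * z ^ l))"
        using A(1) by (simp only: norm_mult norm_powr_of_real norm_of_real)
      also have "\<dots> \<le> 1 * norm z powr (real k / 2) * exp (2 * T) * (CM * norm z ^ (N + 1))"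
        using A nE B(2) M(1) by (intro mult_mono) auto
      also have "\<dots> = CM * norm z powr (real k / 2 + real N + 1) * exp (2 * T)"
      proof -
        have "norm z ^ (N + 1) = norm z powr (real (N + 1))" using z(2) by (intro powr_realpow[symmetric]) auto
        then show ?thesis using z(2) by (simp add: powr_add mult_ac)
      qed
      also have "\<dots> \<le> Mj"
        unfolding Mj_def using nz M(1) by (intro mult_right_mono mult_left_mono powr_mono2) auto
      finally show ?thesis .
    qed
    have major': "norm (integral {-x..x} f - of_real A * S) \<le> Mj * (2 * x)"
    proof -
      have d: "((\<lambda>y. f y - g y) has_integral (integral {-x..x} f - of_real A * S)) {-x..x}"
        using integrable_integral[OF fint(2)] g by (rule has_integral_diff)
      have "norm (integral {-x..x} (\<lambda>y. f y - g y)) \<le> Mj * (x - - x)"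
        using d x Mj by (intro norm_integral_le_interval major) auto
      then show ?thesis using integral_unique[OF d] by simp
    qed
    define D where "D = acoeff k m n - of_real A * S / of_real (2 * pi)"
    have "of_real (2 * pi) * D = integral {-pi..-x} f + (integral {-x..x} f - of_real A * S) + integral {x..pi} f"
      using split by (simp add: D_def right_diff_distrib)
    then have "2 * pi * norm D = norm (integral {-pi..-x} f + (integral {-x..x} f - of_real A * S) + integral {x..pi} f)"
      by (simp add: norm_mult flip: \<open>of_real (2 * pi) * D = _\<close>)
    also have "\<dots> \<le> Mn * pi + Mj * (2 * x) + Mn * pi"
      by (intro norm_triangle_mono minor1 minor2 major')
    also have "\<dots> \<le> 2 * pi * (Mn + Mj * (2 * x))"
    proof -
      have "1 * (Mj * (2 * x)) \<le> 2 * pi * (Mj * (2 * x))"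
        using pi_ge_two Mj x by (intro mult_right_mono) auto
      then show ?thesis by (simp add: algebra_simps)
    qed
    finally have D: "norm D \<le> Mn + Mj * (2 * x)" by simp

    define b where "b = (\<lambda>l. of_real (real n powr (- (1 + p l) / 2) * c powr (1 + p l)) * bessel_I (- 1 - p l) (2 * T))"
    have "norm (of_real A * S / of_real (2 * pi) - of_real A * (\<Sum>l=1..N. dcoeff m k l * b l)) \<le>
        (\<Sum>l=1..N. norm (dcoeff m k l) * (Cb l * real n powr (- 1 - p l) * T powr (p l + 1) * exp (3 * T / 2)))"
    proof -
      have "of_real A * S / of_real (2 * pi) - of_real A * (\<Sum>l=1..N. dcoeff m k l * b l) =
          of_real A * (\<Sum>l=1..N. dcoeff m k l * (I l / of_real (2 * pi) - b l))"
      proof -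
        have "of_real A * S / of_real (2 * pi) = of_real A * (\<Sum>l=1..N. dcoeff m k l * (I l / of_real (2 * pi)))"
          by (simp only: S_def sum_divide_distrib times_divide_eq_right[symmetric])
        then show ?thesis by (simp only: right_diff_distrib sum_subtractf)
      qed
      also have "norm \<dots> = A * norm (\<Sum>l=1..N. dcoeff m k l * (I l / of_real (2 * pi) - b l))"
        using A by (simp add: norm_mult)
      also have "\<dots> \<le> 1 * norm (\<Sum>l=1..N. dcoeff m k l * (I l / of_real (2 * pi) - b l))"
        using A by (intro mult_right_mono) auto
      also have "norm (\<Sum>l=1..N. dcoeff m k l * (I l / of_real (2 * pi) - b l)) \<le>
          (\<Sum>l=1..N. norm (dcoeff m k l) * (Cb l * real n powr (- 1 - p l) * T powr (p l + 1) * exp (3 * T / 2)))"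
      proof (rule sum_norm_le)
        fix l
        show "norm (dcoeff m k l * (I l / of_real (2 * pi) - b l)) \<le>
            norm (dcoeff m k l) * (Cb l * real n powr (- 1 - p l) * T powr (p l + 1) * exp (3 * T / 2))"
          unfolding b_def norm_mult[of "dcoeff m k l"] by (rule mult_left_mono[OF Ib norm_ge_zero])
      qed
      finally show ?thesis by simp
    qed
    \<comment> \<open>Here exp(3T/2) is exp(2T) times exp(-(c/2) sqrt n), and the second factor
      yields n^(-e). The remaining power n^(-(p+1)/2) is at most 1.\<close>
    also have "\<dots> \<le> (\<Sum>l=1..N. norm (dcoeff m k l) * (Cb l * c powr (p l + 1) * C4)) * (real n powr (- e) * exp (2 * T))"
      unfolding sum_distrib_right
    proof (rule sum_mono)
      fix l
      have pl: "p l \<ge> 0" by (simp add: p_def)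
      have "T powr (p l + 1) = c powr (p l + 1) * real n powr ((p l + 1) / 2)"
        unfolding T_def using c r(1) by (simp add: powr_mult r_def powr_half_sqrt[symmetric] powr_powr)
      then have "real n powr (- 1 - p l) * T powr (p l + 1) = c powr (p l + 1) * (real n powr (- 1 - p l) * real n powr ((p l + 1) / 2))"
        by simp
      also have "real n powr (- 1 - p l) * real n powr ((p l + 1) / 2) = real n powr (- ((p l + 1) / 2))"
      proof -
        have "- 1 - p l + (p l + 1) / 2 = - ((p l + 1) / 2)" by (simp add: field_simps)
        then show ?thesis by (simp only: powr_add[symmetric])
      qed
      also have "c powr (p l + 1) * real n powr (- ((p l + 1) / 2)) \<le> c powr (p l + 1) * 1"
      proof (intro mult_left_mono)
        have "real n powr (- ((p l + 1) / 2)) \<le> real n powr 0" using n(1) pl by (intro powr_mono) auto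
        then show "real n powr (- ((p l + 1) / 2)) \<le> 1" using n(1) by simp
      qed auto
      finally have 1: "real n powr (- 1 - p l) * T powr (p l + 1) \<le> c powr (p l + 1)" by simp
      have 2: "exp (3 * T / 2) \<le> C4 * real n powr (- e) * exp (2 * T)"
      proof -
        have "exp (3 * T / 2) = exp (- (c / 2 * sqrt (real n))) * exp (2 * T)"
          by (simp add: T_def r_def flip: exp_add)
        also have "\<dots> \<le> C4 * real n powr (- e) * exp (2 * T)"
          using C4(2)[OF n(1)] by (intro mult_right_mono) auto
        finally show ?thesis .
      qed
      have "Cb l * (real n powr (- 1 - p l) * T powr (p l + 1)) * exp (3 * T / 2) \<le>
          Cb l * c powr (p l + 1) * (C4 * real n powr (- e) * exp (2 * T))"
        using 1 2 Cb[of l] by (intro mult_mono mult_left_mono) auto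
      then have "norm (dcoeff m k l) * (Cb l * (real n powr (- 1 - p l) * T powr (p l + 1)) * exp (3 * T / 2)) \<le>
          norm (dcoeff m k l) * (Cb l * c powr (p l + 1) * (C4 * real n powr (- e) * exp (2 * T)))"
        by (intro mult_left_mono) auto
      then show "norm (dcoeff m k l) * (Cb l * real n powr (- 1 - p l) * T powr (p l + 1) * exp (3 * T / 2)) \<le>
          norm (dcoeff m k l) * (Cb l * c powr (p l + 1) * C4) * (real n powr (- e) * exp (2 * T))"
        by (simp add: mult_ac)
    qed
    finally have bessel_part: "norm (of_real A * S / of_real (2 * pi) - of_real A * (\<Sum>l=1..N. dcoeff m k l * b l)) \<le>
        (\<Sum>l=1..N. norm (dcoeff m k l) * (Cb l * c powr (p l + 1) * C4)) * (real n powr (- e) * exp (2 * T))" .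
    have Mn_le: "Mn \<le> (2 / c) ^ 8 * C3 * (real n powr (- e) * exp (2 * T))"
    proof -
      \<comment> \<open>Since c^2 = k pi^2/6, the exponent is c^2/x = T less the accumulated gain,
        which is proportional to sqrt n.\<close>
      have "real k * (pi\<^sup>2 / 6 - minor_gain) / x = c\<^sup>2 / x - real k * minor_gain / c * r"
        using c r(1) by (simp add: c2 x_def field_simps)
      then have "exp (real k * (pi\<^sup>2 / 6 - minor_gain) / x) * exp T = exp (- (real k * minor_gain / c * r)) * exp (2 * T)"
        by (simp add: cx flip: exp_add)
      moreover have "(2 / x) ^ 8 = (2 / c) ^ 8 * real n powr 4"
      proof -
        have "(2 / x) ^ 8 = (2 / c) ^ 8 * r ^ 8" by (simp add: x_def power_divide power_mult_distrib)
        also have "r ^ 8 = (r ^ 2) ^ 4" by (simp flip: power_mult)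
        also have "\<dots> = real n powr 4" using n(1) unfolding r(5) by simp
        finally show ?thesis .
      qed
      ultimately have "Mn = (2 / c) ^ 8 * real n powr 4 * (exp (- (real k * minor_gain / c * r)) * exp (2 * T))"
        by (simp add: Mn_def mult.assoc)
      also have "\<dots> \<le> (2 / c) ^ 8 * real n powr 4 * ((C3 * real n powr (- (e + 4))) * exp (2 * T))"
        using C3(2)[OF n(1)] c unfolding r_def by (intro mult_left_mono mult_right_mono) auto
      also have "\<dots> = (2 / c) ^ 8 * C3 * ((real n powr 4 * real n powr (- (e + 4))) * exp (2 * T))"
        by (simp add: mult_ac)
      also have "real n powr 4 * real n powr (- (e + 4)) = real n powr (- e)"
        unfolding powr_add[symmetric] by simp
      finally show ?thesis .
    qed
    have Mj_eq: "Mj * (2 * x) = CM * (2 * c) powr (real k / 2 + real N + 2) * (real n powr (- e) * exp (2 * T))"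
    proof -
      have "real n powr (- (1 / 2)) = inverse r"
        unfolding powr_minus r_def by (subst powr_half_sqrt) auto
      then have x2: "2 * x = (2 * c) * real n powr (- (1 / 2))"
        by (simp only: x_def divide_inverse mult.assoc)
      have "(2 * x) powr (real k / 2 + real N + 1) * (2 * x) = (2 * x) powr (real k / 2 + real N + 1) * (2 * x) powr 1"
        using x by simp
      also have "\<dots> = (2 * x) powr (real k / 2 + real N + 2)"
        unfolding powr_add[symmetric] by (simp add: add.assoc)
      also have "\<dots> = (2 * c) powr (real k / 2 + real N + 2) *
          (real n powr (- (1 / 2))) powr (real k / 2 + real N + 2)"
        unfolding x2 using c by (intro powr_mult)
      also have "(real n powr (- (1 / 2))) powr (real k / 2 + real N + 2) = real n powr (- e)"
        unfolding powr_powr by (rule arg_cong[of _ _ "\<lambda>t. real n powr t"]) (simp add: e_def field_simps)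
      finally have eq: "(2 * x) powr (real k / 2 + real N + 1) * (2 * x) =
        (2 * c) powr (real k / 2 + real N + 2) * real n powr (- e)" .
      have "Mj * (2 * x) = CM * ((2 * x) powr (real k / 2 + real N + 1) * (2 * x)) * exp (2 * T)"
        by (simp only: Mj_def mult_ac)
      then show ?thesis unfolding eq by (simp only: mult_ac)
    qed
    have "acoeff k m n - of_real A * (\<Sum>l=1..N. dcoeff m k l * b l) =
        D + (of_real A * S / of_real (2 * pi) - of_real A * (\<Sum>l=1..N. dcoeff m k l * b l))"
      by (simp add: D_def)
    also have "norm \<dots> \<le> (Mn + Mj * (2 * x)) +
        (\<Sum>l=1..N. norm (dcoeff m k l) * (Cb l * c powr (p l + 1) * C4)) * (real n powr (- e) * exp (2 * T))"
      by (intro norm_triangle_mono D bessel_part)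
    also have "\<dots> \<le> C * (real n powr (- e) * exp (2 * T))"
      using Mn_le unfolding Mj_eq C_def by (simp add: ring_distribs)
    finally show ?thesis by (simp add: A_def b_def T_def r_def)
  qed
  have e: "- 1 - real N / 2 - real k / 4 = - e" by (simp add: e_def)
  show ?thesis
  proof (rule that[of n0 C])
    fix n assume "real n \<ge> n0"
    from main[OF this] show "norm (acoeff k m n - of_real ((2 * pi) powr (- real k / 2)) *
        (\<Sum>l=1..N. dcoeff m k l * (of_real (real n powr (- (1 + (real l + real k / 2)) / 2) * c powr (1 + (real l + real k / 2))) *
          bessel_I (- 1 - (real l + real k / 2)) (2 * (c * sqrt (real n))))))
      \<le> C * (real n powr (- 1 - real N / 2 - real k / 4) * exp (2 * (c * sqrt (real n))))"
      unfolding e p_def .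
  qed
qed

theorem theorem1p1:
  fixes k N :: nat and m :: int
  assumes "k \<ge> 1" and "N \<ge> 1"
  shows "(\<lambda>n::nat. norm (acoeff k m n -
            of_real ((2 * pi) powr (- real k / 2)) *
            (\<Sum>l=1..N. dcoeff m k l *
               of_real (real n powr (- (2 + 2 * real l + real k) / 4)) *
               of_real ((pi * sqrt (real k / 6)) powr (1 + real l + real k / 2)) *
               bessel_I (- 1 - real l - real k / 2) (pi * sqrt (2 * real k * real n / 3)))))
         \<in> O(\<lambda>n. real n powr (- 1 - real N / 2 - real k / 4) * exp (pi * sqrt (2 * real k * real n / 3)))"
proof -
  define c where "c = pi * sqrt (real k / 6)"
  obtain n0 C where *: "\<And>n. real n \<ge> n0 \<Longrightarrow>
      norm (acoeff k m n - of_real ((2 * pi) powr (- real k / 2)) *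
        (\<Sum>l=1..N. dcoeff m k l * (of_real (real n powr (- (1 + (real l + real k / 2)) / 2) * c powr (1 + (real l + real k / 2))) *
          bessel_I (- 1 - (real l + real k / 2)) (2 * (c * sqrt (real n))))))
      \<le> C * (real n powr (- 1 - real N / 2 - real k / 4) * exp (2 * (c * sqrt (real n))))"
    using acoeff_circle_method[OF assms, folded c_def] by blast
  have arg: "2 * (c * sqrt (real n)) = pi * sqrt (2 * real k * real n / 3)" for n
  proof -
    have "2 * real k * real n / 3 = 2\<^sup>2 * (real k / 6 * real n)" by simp
    then have "sqrt (2 * real k * real n / 3) = 2 * (sqrt (real k / 6) * sqrt (real n))"
      by (simp only: real_sqrt_mult real_sqrt_abs)
    then show ?thesis by (simp add: c_def)
  qed
  have summand: "dcoeff m k l * of_real (real n powr (- (2 + 2 * real l + real k) / 4)) *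
      of_real ((pi * sqrt (real k / 6)) powr (1 + real l + real k / 2)) *
      bessel_I (- 1 - real l - real k / 2) (pi * sqrt (2 * real k * real n / 3)) =
    dcoeff m k l * (of_real (real n powr (- (1 + (real l + real k / 2)) / 2) * c powr (1 + (real l + real k / 2))) *
      bessel_I (- 1 - (real l + real k / 2)) (2 * (c * sqrt (real n))))" for l n
  proof -
    have e: "- (2 + 2 * real l + real k) / 4 = - (1 + (real l + real k / 2)) / 2"
      "1 + real l + real k / 2 = 1 + (real l + real k / 2)"
      "- 1 - real l - real k / 2 = - 1 - (real l + real k / 2)"
      by (simp_all add: field_simps)
    show ?thesis
      unfolding e arg[symmetric] c_def[symmetric] by (simp only: of_real_mult mult.assoc)
  qed
  show ?thesis
  proof (rule landau_o.bigI[of "\<bar>C\<bar> + 1"])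
    show "eventually (\<lambda>n. norm (norm (acoeff k m n -
            of_real ((2 * pi) powr (- real k / 2)) *
            (\<Sum>l=1..N. dcoeff m k l *
               of_real (real n powr (- (2 + 2 * real l + real k) / 4)) *
               of_real ((pi * sqrt (real k / 6)) powr (1 + real l + real k / 2)) *
               bessel_I (- 1 - real l - real k / 2) (pi * sqrt (2 * real k * real n / 3))))) \<le>
        (\<bar>C\<bar> + 1) * norm (real n powr (- 1 - real N / 2 - real k / 4) * exp (pi * sqrt (2 * real k * real n / 3)))) sequentially"
    proof (rule eventually_sequentiallyI[of "nat \<lceil>n0\<rceil>"])
      fix n assume "nat \<lceil>n0\<rceil> \<le> n"
      then have "real n \<ge> n0" by linarith
      from *[OF this, unfolded arg summand[unfolded arg, symmetric]]
      have "norm (acoeff k m n -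
            of_real ((2 * pi) powr (- real k / 2)) *
            (\<Sum>l=1..N. dcoeff m k l *
               of_real (real n powr (- (2 + 2 * real l + real k) / 4)) *
               of_real ((pi * sqrt (real k / 6)) powr (1 + real l + real k / 2)) *
               bessel_I (- 1 - real l - real k / 2) (pi * sqrt (2 * real k * real n / 3))))
          \<le> C * (real n powr (- 1 - real N / 2 - real k / 4) * exp (pi * sqrt (2 * real k * real n / 3)))"
        .
      also have "\<dots> \<le> (\<bar>C\<bar> + 1) * (real n powr (- 1 - real N / 2 - real k / 4) * exp (pi * sqrt (2 * real k * real n / 3)))"
        by (intro mult_right_mono) auto
      finally show "norm (norm (acoeff k m n -
            of_real ((2 * pi) powr (- real k / 2)) *
            (\<Sum>l=1..N. dcoeff m k l *
               of_real (real n powr (- (2 + 2 * real l + real k) / 4)) *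
               of_real ((pi * sqrt (real k / 6)) powr (1 + real l + real k / 2)) *
               bessel_I (- 1 - real l - real k / 2) (pi * sqrt (2 * real k * real n / 3))))) \<le>
        (\<bar>C\<bar> + 1) * norm (real n powr (- 1 - real N / 2 - real k / 4) * exp (pi * sqrt (2 * real k * real n / 3)))"
        by simp
    qed
  qed auto
qed

end
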